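(* Let $T>0$, $H\in(0,1)$, and let $S^H=(S^H_t)_{t\in[0,T]}$ be a sub-fractional Brownian motion, i.e. a centered Gaussian process with $S^H_0=0$ and covariance function $$G_H(s,t)=s^{2H}+t^{2H}-\tfrac12\big[(s+t)^{2H}+|s-t|^{2H}\big],\qquad (s,t)\in[0,T]^2.$$ Then $X=S^H$ has the Orey index $\gamma=H$, satisfies condition (C2) of the context with $\kappa=1$, and satisfies the following three conditions, where $B^H$ is the fractional Brownian motion with Hurst index $H$: (i) there is a constant $C$ such that for all $n$ and $i=1,2$, $\max_{1\le k\le in-1}\sum_{j=1}^{in-1}\big|d^{\widehat X,in}_{j,k}\big|\le C$; (ii) for all $i,j\in\{1,2\}$, $$\frac1n\Big(\operatorname{cov}\big(i^{-1}V^{\widehat X}_{in,T},\,j^{-1}V^{\widehat X}_{jn,T}\big)-\operatorname{cov}\big(i^{-1}V^{\widehat B^H}_{in,T},\,j^{-1}V^{\widehat B^H}_{jn,T}\big)\Big)\xrightarrow[n\to\infty]{}0;$$ (iii) $\sqrt n\,\big((in)^{-1}\mathbf{E}V^{\widehat X}_{in,T}-1\big)\xrightarrow[n\to\infty]{}0$ for $i=1,2$. Consequently, for $$\widehat\gamma_n=\frac12-\frac{1}{2\ln2}\ln\left(\frac{\sum_{k=1}^{2n-1}\big(\Delta^{(2)}_{2n,k}S^H\big)^2}{\sum_{k=1}^{n-1}\big(\Delta^{(2)}_{n,k}S^H\big)^2}\right)$$ one has, as $n\to\infty$, $\widehat\gamma_n\to H$ almost surely and $$2\ln2\,\sqrt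 n\,(\widehat\gamma_n-H)\xrightarrow{\ d\ }\mathcal N(0;\sigma_H^2),\qquad \sigma_H^2=\tfrac32\Sigma_{11}-2\Sigma_{12},$$ where $\Sigma_{11},\Sigma_{12}$ are the numbers (depending on $H$) defined in the context.
   Context: **Orey index.** For a zero-mean process $X=(X_t)_{t\in[0,T]}$ with finite second moments put $\sigma_X^2(s,t)=\mathbf{E}[X_t-X_s]^2$, $\sigma_X=\sqrt{\sigma_X^2}$. Let $\Psi$ be the set of functions $f$ on $(0,T)$, regularly varying at zero with index $1$, such that $f(h)/h\to\infty$ as $h\downarrow0$. For $\varphi\in\Psi$ let $$\gamma_*(\varphi)=\inf\Big\{g>0:\lim_{h\downarrow0}\sup_{\varphi(h)\le s\le T-h}\frac{h^g}{\sigma_X(s,s+h)}=0\Big\},\quad \widetilde\gamma_*=\inf\Big\{g>0:\lim_{h\downarrow0}\frac{h^g}{\sigma_X(0,h)}=0\Big\},$$ $$\gamma^*(\varphi)=\sup\Big\{g>0:\lim_{h\downarrow0}\inf_{\varphi(h)\le s\le T-h}\frac{h^g}{\sigma_X(s,s+h)}=+\infty\Big\},\quad \widetilde\gamma^*=\sup\Big\{g>0:\lim_{h\downarrow0}\frac{h^g}{\sigma_X(0,h)}=+\infty\Big\}.$$ If $\sup_{0\le s\le T-h}\sigma_X(s,s+h)\to0$ as $h\to0$ and $\gamma_*(\varphi)=\widetilde\gamma_*=\gamma^*(\varphi)=\widetilde\gamma^*$ for every $\varphi\in\Psi$, then $X$ is said to have the Orey index $\gamma_X=\widetilde\gamma_*=\widetilde\gamma^*$.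 **Condition (C2)** (with constant $\kappa>0$ and exponent $\gamma$): for every $\varphi\in\Psi$, $$\sup_{\varphi(\delta)\le t\le T-\delta}\ \sup_{0<h\le\delta}\Big|\frac{\sigma_X(t,t+h)}{\kappa h^\gamma}-1\Big|\longrightarrow0\quad\text{as }\delta\downarrow0.$$ **Increments.** For an integer $N\ge2$ (used with $N=in$, the product of $i\in\{1,2\}$ and $n$), $1\le k\le N-1$, and $Y=S^H$ or $Y=B^H$ (for both $\kappa=1$ and $\gamma=H$), put $$\Delta^{(2)}_{N,k}Y=Y_{\frac{k+1}{N}T}-2Y_{\frac kN T}+Y_{\frac{k-1}{N}T},\qquad \Delta^{(2)}_{N,k}\widehat Y=\frac{\Delta^{(2)}_{N,k}Y}{\sqrt{4-2^{2H}}\,(T/N)^H},$$ $$V^{\widehat Y}_{N,T}=\sum_{k=1}^{N-1}\big(\Delta^{(2)}_{N,k}\widehat Y\big)^2,\qquad d^{\widehat Y,N}_{j,k}=\mathbf{E}\big[\Delta^{(2)}_{N,j}\widehat Y\,\Delta^{(2)}_{N,k}\widehat Y\big],\quad 1\le j,k\le N-1.$$ Empty sums and maxima (case $N=1$) are taken to be $0$; $\widehat\gamma_n$ is considered for $n\ge2$. The fractional Brownian motion $B^H$ is the centered Gaussian process on $[0,T]$ with $\mathbf{E}B^H_tB^H_s=\frac12(t^{2H}+s^{2H}-|t-s|^{2H})$. **Constants.** $$\Sigma_{11}=2\Big(1+\frac{2}{(4-2^{2H})^2}\sum_{j=1}^\infty\widehat\rho_H^{\,2}(j)\Big),\qquad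 \Sigma_{12}=\frac{1}{2^{2H}(4-2^{2H})^2}\sum_{j\in\mathbb Z}\widetilde\rho_H^{\,2}(j),$$ $$\widehat\rho_H(j)=\tfrac12\big[-6|j|^{2H}-|j-2|^{2H}-|j+2|^{2H}+4|j-1|^{2H}+4|j+1|^{2H}\big],$$ $$\widetilde\rho_H(j)=\tfrac12\big[|j+1|^{2H}+2|j+2|^{2H}-|j+3|^{2H}+|j-1|^{2H}-4|j|^{2H}-|j-3|^{2H}+2|j-2|^{2H}\big].$$ *)

theory Defs
  imports "HOL-Probability.Probability"
begin

definition covariance :: "'a measure \<Rightarrow> ('a \<Rightarrow> real) \<Rightarrow> ('a \<Rightarrow> real) \<Rightarrow> real" where
  "covariance M U V =
     (\<integral>\<omega>. (U \<omega> - (\<integral>\<omega>'. U \<omega>' \<partial>M)) * (V \<omega> - (\<integral>\<omega>'. V \<omega>' \<partial>M)) \<partial>M)"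


subsection \<open>Gaussian processes\<close>

text \<open>
  A process on \<open>[0,T]\<close> is a function \<open>X :: real \<Rightarrow> 'a \<Rightarrow> real\<close> of which only the values
  \<open>X t\<close> with \<open>0 \<le> t \<le> T\<close> matter.
\<close>

text \<open>
  The second parameter is the variance.  The library density is meaningful only for positive
  variance; variance \<open>0\<close> gives the Dirac measure.
\<close>

definition normal_law :: "real \<Rightarrow> real \<Rightarrow> real measure" where
  "normal_law m v =
     (if v = 0 then return borel m else density lborel (normal_density m (sqrt v)))"

definition gaussian_process :: "'a measure \<Rightarrow> real \<Rightarrow> (real \<Rightarrow> 'a \<Rightarrow> real) \<Rightarrow> bool" where
  "gaussian_process M T X \<longleftrightarrow>
     (\<forall>t\<in>{0..T}. X t \<in> borel_measurable M) \<and>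
     (\<forall>I c. finite I \<and> I \<subseteq> {0..T} \<longrightarrow>
        (\<exists>m v. 0 \<le> v \<and> distr M borel (\<lambda>\<omega>. \<Sum>t\<in>I. c t * X t \<omega>) = normal_law m v))"

definition centered_gaussian_process ::
    "'a measure \<Rightarrow> real \<Rightarrow> (real \<Rightarrow> 'a \<Rightarrow> real) \<Rightarrow> bool" where
  "centered_gaussian_process M T X \<longleftrightarrow>
     gaussian_process M T X \<and> (\<forall>t\<in>{0..T}. (\<integral>\<omega>. X t \<omega> \<partial>M) = 0)"

definition subfbm_cov :: "real \<Rightarrow> real \<Rightarrow> real \<Rightarrow> real" where
  "subfbm_cov H s t =
     s powr (2 * H) + t powr (2 * H)
       - 1 / 2 * ((s + t) powr (2 * H) + \<bar>s - t\<bar> powr (2 * H))"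

definition sub_fractional_brownian_motion ::
    "'a measure \<Rightarrow> real \<Rightarrow> real \<Rightarrow> (real \<Rightarrow> 'a \<Rightarrow> real) \<Rightarrow> bool" where
  "sub_fractional_brownian_motion M T H X \<longleftrightarrow>
     centered_gaussian_process M T X \<and>
     (AE \<omega> in M. X 0 \<omega> = 0) \<and>
     (\<forall>s\<in>{0..T}. \<forall>t\<in>{0..T}. covariance M (X s) (X t) = subfbm_cov H s t)"

definition fractional_brownian_motion ::
    "'a measure \<Rightarrow> real \<Rightarrow> real \<Rightarrow> (real \<Rightarrow> 'a \<Rightarrow> real) \<Rightarrow> bool" where
  "fractional_brownian_motion M T H X \<longleftrightarrow>
     centered_gaussian_process M T X \<and>
     (\<forall>s\<in>{0..T}. \<forall>t\<in>{0..T}. (\<integral>\<omega>. X t \<omega> * X s \<omega> \<partial>M) =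
        1 / 2 * (t powr (2 * H) + s powr (2 * H) - \<bar>t - s\<bar> powr (2 * H)))"


subsection \<open>Orey index and condition (C2)\<close>

definition incr_sd :: "'a measure \<Rightarrow> (real \<Rightarrow> 'a \<Rightarrow> real) \<Rightarrow> real \<Rightarrow> real \<Rightarrow> real" where
  "incr_sd M X s t = sqrt (\<integral>\<omega>. (X t \<omega> - X s \<omega>)\<^sup>2 \<partial>M)"

definition zero_mean_process :: "'a measure \<Rightarrow> real \<Rightarrow> (real \<Rightarrow> 'a \<Rightarrow> real) \<Rightarrow> bool" where
  "zero_mean_process M T X \<longleftrightarrow>
     (\<forall>t\<in>{0..T}. X t \<in> borel_measurable M \<and> integrable M (\<lambda>\<omega>. (X t \<omega>)\<^sup>2) \<and>
        (\<integral>\<omega>. X t \<omega> \<partial>M) = 0)"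

text \<open>As usual in the theory of regular variation, measurability and positivity are part of
  the definition.\<close>

definition regularly_varying_at_zero :: "real \<Rightarrow> real \<Rightarrow> (real \<Rightarrow> real) \<Rightarrow> bool" where
  "regularly_varying_at_zero T \<rho> f \<longleftrightarrow>
     f \<in> borel_measurable (lebesgue_on {0<..<T}) \<and>
     (\<forall>x\<in>{0<..<T}. 0 < f x) \<and>
     (\<forall>c>0. ((\<lambda>h. f (c * h) / f h) \<longlongrightarrow> c powr \<rho>) (at_right 0))"

definition Psi :: "real \<Rightarrow> (real \<Rightarrow> real) set" where
  "Psi T = {f. regularly_varying_at_zero T 1 f \<and>
               filterlim (\<lambda>h. f h / h) at_top (at_right 0)}"

text \<open>
  Suprema, infima and quotients are taken in \<^typ>\<open>ereal\<close>, where \<open>a / 0 = \<infinity>\<close> for \<open>a > 0\<close>,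
  \<open>Inf {} = \<infinity>\<close> and \<open>Sup {} = -\<infinity>\<close>.
\<close>

definition orey_ratio ::
    "'a measure \<Rightarrow> (real \<Rightarrow> 'a \<Rightarrow> real) \<Rightarrow> real \<Rightarrow> real \<Rightarrow> real \<Rightarrow> ereal" where
  "orey_ratio M X g s h = ereal (h powr g) / ereal (incr_sd M X s (s + h))"

definition orey_lower ::
    "'a measure \<Rightarrow> real \<Rightarrow> (real \<Rightarrow> 'a \<Rightarrow> real) \<Rightarrow> (real \<Rightarrow> real) \<Rightarrow> ereal" where
  "orey_lower M T X \<phi> = Inf {ereal g | g. 0 < g \<and>
     ((\<lambda>h. SUP s\<in>{\<phi> h..T - h}. orey_ratio M X g s h) \<longlongrightarrow> 0) (at_right 0)}"

definition orey_lower_zero :: "'a measure \<Rightarrow> (real \<Rightarrow> 'a \<Rightarrow> real) \<Rightarrow> ereal" where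
  "orey_lower_zero M X = Inf {ereal g | g. 0 < g \<and>
     ((\<lambda>h. orey_ratio M X g 0 h) \<longlongrightarrow> 0) (at_right 0)}"

definition orey_upper ::
    "'a measure \<Rightarrow> real \<Rightarrow> (real \<Rightarrow> 'a \<Rightarrow> real) \<Rightarrow> (real \<Rightarrow> real) \<Rightarrow> ereal" where
  "orey_upper M T X \<phi> = Sup {ereal g | g. 0 < g \<and>
     ((\<lambda>h. INF s\<in>{\<phi> h..T - h}. orey_ratio M X g s h) \<longlongrightarrow> \<infinity>) (at_right 0)}"

definition orey_upper_zero :: "'a measure \<Rightarrow> (real \<Rightarrow> 'a \<Rightarrow> real) \<Rightarrow> ereal" where
  "orey_upper_zero M X = Sup {ereal g | g. 0 < g \<and>
     ((\<lambda>h. orey_ratio M X g 0 h) \<longlongrightarrow> \<infinity>) (at_right 0)}"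

definition has_orey_index ::
    "'a measure \<Rightarrow> real \<Rightarrow> (real \<Rightarrow> 'a \<Rightarrow> real) \<Rightarrow> real \<Rightarrow> bool" where
  "has_orey_index M T X \<gamma> \<longleftrightarrow>
     zero_mean_process M T X \<and>
     ((\<lambda>h. SUP s\<in>{0..T - h}. ereal (incr_sd M X s (s + h))) \<longlongrightarrow> 0) (at_right 0) \<and>
     (\<forall>\<phi>\<in>Psi T. orey_lower M T X \<phi> = orey_lower_zero M X \<and>
                 orey_lower_zero M X = orey_upper M T X \<phi> \<and>
                 orey_upper M T X \<phi> = orey_upper_zero M X) \<and>
     orey_lower_zero M X = ereal \<gamma> \<and> orey_upper_zero M X = ereal \<gamma>"

definition condition_C2 ::
    "'a measure \<Rightarrow> real \<Rightarrow> (real \<Rightarrow> 'a \<Rightarrow> real) \<Rightarrow> real \<Rightarrow> real \<Rightarrow> bool" where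
  "condition_C2 M T X \<kappa> \<gamma> \<longleftrightarrow>
     (\<forall>\<phi>\<in>Psi T.
        ((\<lambda>\<delta>. SUP t\<in>{\<phi> \<delta>..T - \<delta>}. SUP h\<in>{0<..\<delta>}.
            ereal \<bar>incr_sd M X t (t + h) / (\<kappa> * h powr \<gamma>) - 1\<bar>) \<longlongrightarrow> 0) (at_right 0))"


subsection \<open>Second order increments\<close>

definition diff2 :: "real \<Rightarrow> nat \<Rightarrow> nat \<Rightarrow> (real \<Rightarrow> 'a \<Rightarrow> real) \<Rightarrow> 'a \<Rightarrow> real" where
  "diff2 T N k Y \<omega> =
     Y ((real k + 1) / real N * T) \<omega> - 2 * Y (real k / real N * T) \<omega>
       + Y ((real k - 1) / real N * T) \<omega>"

definition normalized_diff2 ::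
    "real \<Rightarrow> real \<Rightarrow> nat \<Rightarrow> nat \<Rightarrow> (real \<Rightarrow> 'a \<Rightarrow> real) \<Rightarrow> 'a \<Rightarrow> real" where
  "normalized_diff2 T H N k Y \<omega> =
     diff2 T N k Y \<omega> / (sqrt (4 - 2 powr (2 * H)) * (T / real N) powr H)"

definition quad_var2 ::
    "real \<Rightarrow> real \<Rightarrow> nat \<Rightarrow> (real \<Rightarrow> 'a \<Rightarrow> real) \<Rightarrow> 'a \<Rightarrow> real" where
  "quad_var2 T H N Y \<omega> = (\<Sum>k = 1..N - 1. (normalized_diff2 T H N k Y \<omega>)\<^sup>2)"

definition diff2_moment ::
    "'a measure \<Rightarrow> real \<Rightarrow> real \<Rightarrow> nat \<Rightarrow> (real \<Rightarrow> 'a \<Rightarrow> real) \<Rightarrow> nat \<Rightarrow> nat \<Rightarrow> real" where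
  "diff2_moment M T H N Y j k =
     (\<integral>\<omega>. normalized_diff2 T H N j Y \<omega> * normalized_diff2 T H N k Y \<omega> \<partial>M)"

text \<open>The column sums are nonnegative, so inserting \<open>0\<close> affects only the case \<open>N = 1\<close>, where the
  maximum over the empty set is \<open>0\<close> by convention.\<close>

definition max_column_sum ::
    "'a measure \<Rightarrow> real \<Rightarrow> real \<Rightarrow> nat \<Rightarrow> (real \<Rightarrow> 'a \<Rightarrow> real) \<Rightarrow> real" where
  "max_column_sum M T H N Y =
     Max (insert 0 ((\<lambda>k. \<Sum>j = 1..N - 1. \<bar>diff2_moment M T H N Y j k\<bar>) ` {1..N - 1}))"

definition gamma_hat :: "real \<Rightarrow> (real \<Rightarrow> 'a \<Rightarrow> real) \<Rightarrow> nat \<Rightarrow> 'a \<Rightarrow> real" where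
  "gamma_hat T Y n \<omega> =
     1 / 2 - 1 / (2 * ln 2) *
       ln ((\<Sum>k = 1..2 * n - 1. (diff2 T (2 * n) k Y \<omega>)\<^sup>2) /
           (\<Sum>k = 1..n - 1. (diff2 T n k Y \<omega>)\<^sup>2))"


subsection \<open>Limiting variance\<close>

definition rho_hat :: "real \<Rightarrow> real \<Rightarrow> real" where
  "rho_hat H x =
     1 / 2 * (- 6 * \<bar>x\<bar> powr (2 * H) - \<bar>x - 2\<bar> powr (2 * H) - \<bar>x + 2\<bar> powr (2 * H)
              + 4 * \<bar>x - 1\<bar> powr (2 * H) + 4 * \<bar>x + 1\<bar> powr (2 * H))"

definition rho_tilde :: "real \<Rightarrow> real \<Rightarrow> real" where
  "rho_tilde H x =
     1 / 2 * (\<bar>x + 1\<bar> powr (2 * H) + 2 * \<bar>x + 2\<bar> powr (2 * H) - \<bar>x + 3\<bar> powr (2 * H)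
              + \<bar>x - 1\<bar> powr (2 * H) - 4 * \<bar>x\<bar> powr (2 * H) - \<bar>x - 3\<bar> powr (2 * H)
              + 2 * \<bar>x - 2\<bar> powr (2 * H))"

definition Sigma11 :: "real \<Rightarrow> real" where
  "Sigma11 H =
     2 * (1 + 2 / (4 - 2 powr (2 * H))\<^sup>2 * (\<Sum>j. (rho_hat H (real (Suc j)))\<^sup>2))"

definition Sigma12 :: "real \<Rightarrow> real" where
  "Sigma12 H =
     1 / (2 powr (2 * H) * (4 - 2 powr (2 * H))\<^sup>2) *
       (\<Sum>\<^sub>\<infinity>j::int. (rho_tilde H (of_int j))\<^sup>2)"

definition sigma_sq :: "real \<Rightarrow> real" where
  "sigma_sq H = 3 / 2 * Sigma11 H - 2 * Sigma12 H"

end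

theory Submission
  imports Defs
begin

text \<open>
  On the grids of mesh \<open>T/n\<close> and \<open>T/(2n)\<close> the normalised second order increments of \<open>S\<^sup>H\<close> form a
  centred Gaussian family with explicit covariances.  A mixed second difference in \<open>s\<close> and \<open>t\<close>
  annihilates every function of \<open>s\<close> alone or of \<open>t\<close> alone, so that only \<open>\<bar>s - t\<bar>\<close> and \<open>s + t\<close> to the
  power \<open>2H\<close> contribute: the \<open>j\<close>-th and the \<open>k\<close>-th increment on one grid have covariance
  \<open>r(j - k) + r(j + k)\<close>, where \<open>r(j - k)\<close> is the covariance for \<open>B\<^sup>H\<close>.  An increment on the coarse grid is
  a combination of three increments on the fine grid, so the covariances between the grids have the
  same form.  Since \<open>r\<close> is a fourth difference of \<open>\<bar>x\<bar>\<^sup>2\<^sup>H\<close>, it is \<open>O(m\<^sup>-\<^sup>2)\<close> (\<open>rho_hat_decay\<close>); hence all row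
  sums are bounded, and everything due to \<open>r(j + k)\<close>, which is all that distinguishes \<open>S\<^sup>H\<close> from \<open>B\<^sup>H\<close>,
  stays bounded while the main terms grow like \<open>n\<close>.  This gives the bound for the column sums, the
  asymptotic agreement of the covariances with those of \<open>B\<^sup>H\<close>, the estimate of the means, and the limits
  of the variances and covariances (\<open>toeplitz_limit\<close>).

  The limit theorem is proved by moments, uniformly in the family and without densities or
  diagonalisation.  In a space of centred normal variables Wick's formula expresses \<open>E[\<zeta> F]\<close> through
  the derivative of a polynomial \<open>F\<close>; here it follows from the moments of one normal variable by
  polarisation, that is, by differentiating the moments of \<open>\<eta> + s \<zeta>\<close> at \<open>s = 0\<close>.  For a centred
  diagonal quadratic form \<open>W\<close> with weights of size \<open>\<alpha>\<close> it yields
  \<open>E[W\<^sup>m\<^sup>+\<^sup>2] = (m + 1) E[W\<^sup>2] E[W\<^sup>m] + O(\<alpha>)\<close> (\<open>quad_moment_approx_recursion\<close>), with constants that depend only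
  on bounds for the row sums of the covariances and for \<open>\<alpha>\<^sup>2\<close> times the number of variables.  With
  \<open>\<alpha> = 1/\<surd>n\<close> the limit is the recursion of the normal moments.  The case of vanishing limiting variance
  is included.  The same bounds control the eighth moments of the centred quadratic variations, and
  these are so small that the normalised variations converge to \<open>1\<close> almost surely with squared error
  \<open>o(1/\<surd>n)\<close>.  As \<open>2 ln 2 (\<gamma>\<^sub>n - H)\<close> is the difference of the logarithms of the two normalised variations,
  linearising the logarithm gives both the consistency and the asymptotic normality of \<open>\<gamma>\<^sub>n\<close>.

  For the Orey index and condition (C2), the increment variance of \<open>S\<^sup>H\<close> over \<open>[s, s + h]\<close> is \<open>h\<^sup>2\<^sup>H\<close> up to a
  second difference of \<open>x\<^sup>2\<^sup>H\<close>, so its square root is \<open>h\<^sup>H\<close> with relative error at most \<open>(h/s)\<^sup>2\<^sup>-\<^sup>2\<^sup>H\<close>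
  (\<open>rel_sd_close\<close>); this tends to \<open>0\<close> uniformly on \<open>s \<ge> \<phi>(h)\<close>, because \<open>\<phi>(h)/h \<rightarrow> \<infinity>\<close>.  The suprema over
  \<open>[\<phi>(h), T - h]\<close> are nonnegative only if this interval is nonempty, so \<open>\<phi>(h) \<rightarrow> 0\<close> has to be derived from
  the regular variation of \<open>\<phi>\<close> (\<open>regularly_varying_tendsto_0\<close>); this is where the measurability of \<open>\<phi>\<close>
  enters.
\<close>

section \<open>Random variables with moments of all orders\<close>

definition all_moments :: "'a measure \<Rightarrow> ('a \<Rightarrow> real) set" where
  "all_moments M = {X. X \<in> borel_measurable M \<and> (\<forall>p. integrable M (\<lambda>w. X w ^ p))}"

lemma all_moments_measurable: "X \<in> all_moments M \<Longrightarrow> X \<in> borel_measurable M"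
  by (simp add: all_moments_def)

lemma all_moments_integrable: "X \<in> all_moments M \<Longrightarrow> integrable M X"
  unfolding all_moments_def using power_one_right[of "X _"] by (auto dest: spec[of _ 1])

lemma all_moments_const: "finite_measure M \<Longrightarrow> (\<lambda>_. c) \<in> all_moments M"
  by (simp add: all_moments_def finite_measure.integrable_const)

lemma all_moments_mult:
  assumes "X \<in> all_moments M" "Y \<in> all_moments M"
  shows "(\<lambda>w. X w * Y w) \<in> all_moments M"
proof -
  have [measurable]: "X \<in> borel_measurable M" "Y \<in> borel_measurable M"
    using assms by (auto simp: all_moments_def)
  have "integrable M (\<lambda>w. (X w * Y w) ^ p)" for p
  proof (rule Bochner_Integration.integrable_bound)
    show "integrable M (\<lambda>w. X w ^ (p * 2) + Y w ^ (p * 2))"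
      using assms by (auto simp: all_moments_def)
    show "AE w in M. norm ((X w * Y w) ^ p) \<le> norm (X w ^ (p * 2) + Y w ^ (p * 2))"
    proof (intro AE_I2)
      fix w
      have "0 \<le> (\<bar>X w\<bar> ^ p - \<bar>Y w\<bar> ^ p)\<^sup>2" "0 \<le> \<bar>X w\<bar> ^ p * \<bar>Y w\<bar> ^ p" by auto
      then have "\<bar>X w\<bar> ^ p * \<bar>Y w\<bar> ^ p \<le> (X w ^ p)\<^sup>2 + (Y w ^ p)\<^sup>2"
        unfolding power2_diff power_abs[symmetric] power2_abs
        unfolding mult.assoc abs_power2 by linarith
      then show "norm ((X w * Y w) ^ p) \<le> norm (X w ^ (p * 2) + Y w ^ (p * 2))"
        by (simp add: power_mult_distrib abs_mult power_abs power_mult)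
    qed
  qed measurable
  then show ?thesis by (simp add: all_moments_def)
qed

lemma all_moments_add:
  assumes "X \<in> all_moments M" "Y \<in> all_moments M"
  shows "(\<lambda>w. X w + Y w) \<in> all_moments M"
proof -
  have [measurable]: "X \<in> borel_measurable M" "Y \<in> borel_measurable M"
    using assms by (auto simp: all_moments_def)
  have "integrable M (\<lambda>w. (X w + Y w) ^ p)" for p
  proof (rule Bochner_Integration.integrable_bound)
    show "integrable M (\<lambda>w. 2 ^ p * (\<bar>X w ^ p\<bar> + \<bar>Y w ^ p\<bar>))"
      using assms by (auto simp: all_moments_def)
    show "AE w in M. norm ((X w + Y w) ^ p) \<le> norm (2 ^ p * (\<bar>X w ^ p\<bar> + \<bar>Y w ^ p\<bar>))"
    proof (intro AE_I2)
      fix w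
      have "norm ((X w + Y w) ^ p) = \<bar>X w + Y w\<bar> ^ p" by (simp add: power_abs)
      also have "\<dots> \<le> (2 * max \<bar>X w\<bar> \<bar>Y w\<bar>) ^ p" by (intro power_mono) auto
      also have "\<dots> = 2 ^ p * (max \<bar>X w\<bar> \<bar>Y w\<bar>) ^ p" by (simp add: power_mult_distrib)
      also have "\<dots> \<le> 2 ^ p * (\<bar>X w ^ p\<bar> + \<bar>Y w ^ p\<bar>)"
        by (intro mult_left_mono) (auto simp: max_def power_abs)
      finally show "norm ((X w + Y w) ^ p) \<le> norm (2 ^ p * (\<bar>X w ^ p\<bar> + \<bar>Y w ^ p\<bar>))" by simp
    qed
  qed measurable
  then show ?thesis by (simp add: all_moments_def)
qed

lemma all_moments_cmult:
  assumes "finite_measure M" "X \<in> all_moments M"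
  shows "(\<lambda>w. c * X w) \<in> all_moments M"
  using all_moments_mult[OF all_moments_const[OF assms(1)] assms(2)] .

lemma all_moments_diff:
  assumes "finite_measure M" "X \<in> all_moments M" "Y \<in> all_moments M"
  shows "(\<lambda>w. X w - Y w) \<in> all_moments M"
  using all_moments_add[OF assms(2) all_moments_cmult[OF assms(1,3), of "-1"]] by simp

lemma all_moments_sum:
  assumes "finite_measure M" "\<And>i. i \<in> I \<Longrightarrow> X i \<in> all_moments M"
  shows "(\<lambda>w. \<Sum>i\<in>I. X i w) \<in> all_moments M"
  using assms(2)
proof (induction I rule: infinite_finite_induct)
  case (insert i I)
  then show ?case using all_moments_add[of "X i" M "\<lambda>w. \<Sum>i\<in>I. X i w"] by simp
qed (simp_all add: all_moments_const[OF assms(1)])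

abbreviation prod_rv :: "('a \<Rightarrow> real) list \<Rightarrow> 'a \<Rightarrow> real" where
  "prod_rv Xs w \<equiv> prod_list (map (\<lambda>X. X w) Xs)"

lemma all_moments_prod_list:
  assumes "finite_measure M" "set Xs \<subseteq> all_moments M"
  shows "(\<lambda>w. prod_rv Xs w) \<in> all_moments M"
  using assms(2) by (induction Xs) (auto simp: all_moments_const[OF assms(1)] intro: all_moments_mult)

lemma all_moments_power:
  assumes "finite_measure M" "X \<in> all_moments M"
  shows "(\<lambda>w. X w ^ k) \<in> all_moments M"
  by (induction k) (auto simp: all_moments_const[OF assms(1)] intro: all_moments_mult assms)

lemmas all_moments_closure =
  all_moments_const all_moments_add all_moments_diff all_moments_mult all_moments_sum
  all_moments_prod_list all_moments_power

section \<open>Moments of centred normal laws\<close>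

definition gauss_moment :: "nat \<Rightarrow> real" where
  "gauss_moment k = (if odd k then 0 else fact k / (2 ^ (k div 2) * fact (k div 2)))"

lemma gauss_moment_0 [simp]: "gauss_moment 0 = 1"
  and gauss_moment_1 [simp]: "gauss_moment (Suc 0) = 0"
  by (simp_all add: gauss_moment_def)

text \<open>
  The recursion that identifies limits of moments: it is matched with the approximate
  recursion for the moments of quadratic forms.
\<close>

lemma gauss_moment_Suc_Suc: "gauss_moment (Suc (Suc m)) = real (Suc m) * gauss_moment m"
proof (cases "even m")
  case True
  then obtain k where m: "m = 2 * k" by auto
  have "gauss_moment (Suc (Suc m)) = fact (Suc (Suc (2 * k))) / (2 ^ (Suc k) * fact (Suc k))"
    by (simp add: gauss_moment_def m)
  also have "\<dots> = real (Suc (2 * k)) * (fact (2 * k) / (2 ^ k * fact k))"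
    by (simp add: divide_simps)
  finally show ?thesis by (simp add: gauss_moment_def m)
qed (simp add: gauss_moment_def)

lemma normal_law_moments:
  assumes "0 \<le> v"
  shows "has_bochner_integral (normal_law 0 v) (\<lambda>x. x ^ k) (gauss_moment k * sqrt v ^ k)"
proof (cases "v = 0")
  case True
  have "has_bochner_integral (return borel 0) (\<lambda>x::real. x ^ k) (0 ^ k)"
  proof -
    have "has_bochner_integral (return borel (0::real)) (\<lambda>_. 0 ^ k :: real) (0 ^ k)"
      using prob_space.prob_space[OF prob_space_return[of 0 borel]] prob_space_return[of 0 borel]
      by (auto simp: has_bochner_integral_iff prob_space_def intro: finite_measure.integrable_const)
    moreover have "AE x in return borel (0::real). x ^ k = 0 ^ k" by (subst AE_return) auto
    ultimately show ?thesis by (subst has_bochner_integral_cong_AE[of _ _ "\<lambda>_. 0 ^ k"]) auto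
  qed
  then show ?thesis using True by (cases k) (auto simp: normal_law_def)
next
  case False
  then have s: "0 < sqrt v" using assms by simp
  have "has_bochner_integral lborel (\<lambda>x. normal_density 0 (sqrt v) x * x ^ k)
     (gauss_moment k * sqrt v ^ k)"
  proof (cases "even k")
    case True
    then obtain m where k: "k = 2 * m" by auto
    have "sqrt v ^ k = v ^ m" using assms by (simp add: k power_mult)
    then have "fact (2 * m) / ((2 / (sqrt v)\<^sup>2) ^ m * fact m) = gauss_moment k * sqrt v ^ k"
      using s by (simp add: gauss_moment_def k power_divide field_simps)
    then show ?thesis using normal_moment_even[OF s, of 0 m] by (simp add: k)
  next
    case False
    then obtain m where k: "k = 2 * m + 1" using oddE by blast
    show ?thesis using normal_moment_odd[OF s, of 0 m] by (simp add: k gauss_moment_def)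
  qed
  then show ?thesis using False s
    by (auto simp: normal_law_def intro!: has_bochner_integral_density)
qed

lemma real_distribution_normal_law:
  assumes "0 \<le> v" shows "real_distribution (normal_law 0 v)"
  using assms prob_space_normal_density[of "sqrt v" 0] prob_space_return[of 0 borel]
  by (auto simp: real_distribution_def real_distribution_axioms_def normal_law_def)

section \<open>Wick's formula and Gaussian integration by parts\<close>

text \<open>
  A linear space of centred normal variables. Closure under linear combinations is what
  makes the joint law Gaussian, and it is the form in which Gaussianity of a process is
  given.
\<close>

locale gaussian_space = prob_space M for M :: "'a measure" +
  fixes L :: "('a \<Rightarrow> real) set"
  assumes measurable_L: "\<eta> \<in> L \<Longrightarrow> \<eta> \<in> borel_measurable M"
    and law_L: "\<eta> \<in> L \<Longrightarrow> \<exists>v\<ge>0. distr M borel \<eta> = normal_law 0 v"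
    and lin_L: "\<eta> \<in> L \<Longrightarrow> \<zeta> \<in> L \<Longrightarrow> (\<lambda>w. a * \<eta> w + b * \<zeta> w) \<in> L"
begin

lemma finite_M: "finite_measure M" by unfold_locales

lemma moments_L:
  assumes "\<eta> \<in> L"
  shows "has_bochner_integral M (\<lambda>w. \<eta> w ^ k)
           (gauss_moment k * sqrt (expectation (\<lambda>w. (\<eta> w)\<^sup>2)) ^ k)"
proof -
  note [measurable] = measurable_L[OF assms]
  obtain v where v: "0 \<le> v" "distr M borel \<eta> = normal_law 0 v" using law_L[OF assms] by auto
  have *: "has_bochner_integral M (\<lambda>w. \<eta> w ^ k) (gauss_moment k * sqrt v ^ k)" for k
    using normal_law_moments[OF v(1), of k] unfolding v(2)[symmetric]
    by (simp add: has_bochner_integral_iff integrable_distr_eq integral_distr)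
  have "expectation (\<lambda>w. (\<eta> w)\<^sup>2) = v"
    using has_bochner_integral_integral_eq[OF *[of 2]] v(1)
      gauss_moment_Suc_Suc[of 0] by (simp add: numeral_2_eq_2[symmetric])
  then show ?thesis using * by simp
qed

lemma L_all_moments: "\<eta> \<in> L \<Longrightarrow> \<eta> \<in> all_moments M"
  using moments_L by (auto simp: all_moments_def measurable_L has_bochner_integral_iff)

lemma expectation_L: "\<eta> \<in> L \<Longrightarrow> expectation \<eta> = 0"
  using moments_L[of \<eta> 1] by (simp add: has_bochner_integral_iff)

lemma integrable_moments [intro]: "X \<in> all_moments M \<Longrightarrow> integrable M X"
  by (rule all_moments_integrable)

text \<open>
  The tool for polarisation. Both sides of an identity between moments that holds for
  \<open>\<eta> + s \<zeta>\<close> are polynomials in \<open>s\<close>; comparing their derivatives at \<open>0\<close> replaces one factor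
  \<open>\<eta>\<close> by \<open>\<zeta>\<close>. The factor \<open>X\<close> collects the factors that have already been replaced.
\<close>

lemma derivative_power_moment:
  assumes "X \<in> all_moments M" "\<eta> \<in> all_moments M" "\<zeta> \<in> all_moments M"
  shows "((\<lambda>s. expectation (\<lambda>w. X w * (\<eta> w + s * \<zeta> w) ^ Suc q)) has_real_derivative
           real (Suc q) * expectation (\<lambda>w. X w * \<zeta> w * \<eta> w ^ q)) (at 0)"
  using assms(1)
proof (induction q arbitrary: X)
  case 0
  have eq: "expectation (\<lambda>w. X w * (\<eta> w + s * \<zeta> w) ^ Suc 0) =
     expectation (\<lambda>w. X w * \<eta> w) + s * expectation (\<lambda>w. X w * \<zeta> w)" for s
  proof -
    have "expectation (\<lambda>w. X w * (\<eta> w + s * \<zeta> w) ^ Suc 0) =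
      expectation (\<lambda>w. X w * \<eta> w + s * (X w * \<zeta> w))" by (simp add: algebra_simps)
    also have "\<dots> = expectation (\<lambda>w. X w * \<eta> w) + expectation (\<lambda>w. s * (X w * \<zeta> w))"
      by (intro Bochner_Integration.integral_add integrable_moments all_moments_closure
            all_moments_cmult 0 assms finite_M)
    finally show ?thesis by simp
  qed
  show ?case unfolding eq by (auto intro!: derivative_eq_intros)
next
  case (Suc q)
  define f where "f Y s = expectation (\<lambda>w. Y w * (\<eta> w + s * \<zeta> w) ^ Suc q)" for Y s
  have eq: "expectation (\<lambda>w. X w * (\<eta> w + s * \<zeta> w) ^ Suc (Suc q)) =
     f (\<lambda>w. X w * \<eta> w) s + s * f (\<lambda>w. X w * \<zeta> w) s" for s
  proof -
    have "expectation (\<lambda>w. X w * (\<eta> w + s * \<zeta> w) ^ Suc (Suc q)) =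
      expectation (\<lambda>w. X w * \<eta> w * (\<eta> w + s * \<zeta> w) ^ Suc q
         + s * (X w * \<zeta> w * (\<eta> w + s * \<zeta> w) ^ Suc q))" by (simp add: algebra_simps)
    also have "\<dots> = expectation (\<lambda>w. X w * \<eta> w * (\<eta> w + s * \<zeta> w) ^ Suc q)
         + expectation (\<lambda>w. s * (X w * \<zeta> w * (\<eta> w + s * \<zeta> w) ^ Suc q))"
      by (intro Bochner_Integration.integral_add integrable_moments all_moments_closure
            all_moments_cmult Suc assms finite_M)
    finally show ?thesis by (simp add: f_def)
  qed
  have d: "(f Y has_real_derivative
       real (Suc q) * expectation (\<lambda>w. Y w * \<zeta> w * \<eta> w ^ q)) (at 0)"
    if "Y \<in> all_moments M" for Y
    unfolding f_def using Suc.IH[OF that] .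
  have m: "(\<lambda>w. X w * \<eta> w) \<in> all_moments M" "(\<lambda>w. X w * \<zeta> w) \<in> all_moments M"
    using Suc.prems assms by (auto intro: all_moments_mult)
  have f0: "f (\<lambda>w. X w * \<zeta> w) 0 = expectation (\<lambda>w. X w * \<zeta> w * \<eta> w ^ Suc q)"
    by (simp add: f_def)
  have e: "expectation (\<lambda>w. X w * \<eta> w * \<zeta> w * \<eta> w ^ q) = expectation (\<lambda>w. X w * \<zeta> w * \<eta> w ^ Suc q)"
    by (simp add: mult_ac)
  show ?case unfolding eq
    by (rule derivative_eq_intros d[OF m(1)] d[OF m(2)] refl)+ (simp add: f0 e algebra_simps)
qed

text \<open>
  The first polarisation: \<open>E[(\<eta> + s \<zeta>)\<^sup>p\<^sup>+\<^sup>1]\<close> is a normal moment, hence a power of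
  \<open>E[(\<eta> + s \<zeta>)\<^sup>2]\<close>, and the derivative of the latter at \<open>0\<close> is \<open>2 E[\<zeta> \<eta>]\<close>.
\<close>

lemma wick_power:
  assumes "\<zeta> \<in> L" "\<eta> \<in> L"
  shows "expectation (\<lambda>w. \<zeta> w * \<eta> w ^ p)
       = real p * expectation (\<lambda>w. \<zeta> w * \<eta> w) * expectation (\<lambda>w. \<eta> w ^ (p - 1))"
proof (cases "odd p")
  case False
  have d: "((\<lambda>s. expectation (\<lambda>w. 1 * (\<eta> w + s * \<zeta> w) ^ Suc p)) has_real_derivative
           real (Suc p) * expectation (\<lambda>w. 1 * \<zeta> w * \<eta> w ^ p)) (at 0)"
    by (intro derivative_power_moment all_moments_const L_all_moments assms finite_M)
  have z: "expectation (\<lambda>w. 1 * (\<eta> w + s * \<zeta> w) ^ Suc p) = 0" for s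
    using has_bochner_integral_integral_eq[OF moments_L[OF lin_L[OF assms(2,1), of 1 s], of "Suc p"]] False
    by (simp add: gauss_moment_def)
  from d have 1: "real (Suc p) * expectation (\<lambda>w. 1 * \<zeta> w * \<eta> w ^ p) = 0"
    unfolding z by (rule DERIV_unique) (rule DERIV_const)
  have "expectation (\<lambda>w. \<eta> w ^ (p - 1)) = 0" if "p \<noteq> 0"
    using has_bochner_integral_integral_eq[OF moments_L[OF assms(2), of "p - 1"]] False that
    by (simp add: gauss_moment_def)
  then show ?thesis using 1 by (cases "p = 0") auto
next
  case True
  then obtain q where p: "p = Suc (2 * q)" using oddE by fastforce
  note L = L_all_moments[OF assms(1)] L_all_moments[OF assms(2)]
  define e where "e s = expectation (\<lambda>w. (\<eta> w + s * \<zeta> w)\<^sup>2)" for s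
  have e0: "e s \<ge> 0" for s unfolding e_def by simp
  have de: "(e has_real_derivative 2 * expectation (\<lambda>w. \<zeta> w * \<eta> w)) (at 0)"
    using derivative_power_moment[OF all_moments_const[OF finite_M] L(2,1), of 1 1]
    by (simp add: e_def[abs_def] numeral_2_eq_2)
  have "((\<lambda>s. expectation (\<lambda>w. 1 * (\<eta> w + s * \<zeta> w) ^ Suc p)) has_real_derivative
           real (Suc p) * expectation (\<lambda>w. 1 * \<zeta> w * \<eta> w ^ p)) (at 0)"
    by (intro derivative_power_moment all_moments_const L_all_moments assms finite_M)
  moreover have "expectation (\<lambda>w. 1 * (\<eta> w + s * \<zeta> w) ^ Suc p) = gauss_moment (Suc p) * e s ^ Suc q" for s
  proof -
    have "sqrt (e s) ^ Suc p = (sqrt (e s) ^ 2) ^ Suc q"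
      unfolding p power_mult[symmetric] by simp
    then show ?thesis
      using has_bochner_integral_integral_eq[OF moments_L[OF lin_L[OF assms(2,1), of 1 s], of "Suc p"]] e0[of s]
      by (simp add: e_def[symmetric])
  qed
  ultimately have "((\<lambda>s. gauss_moment (Suc p) * e s ^ Suc q) has_real_derivative
           real (Suc p) * expectation (\<lambda>w. 1 * \<zeta> w * \<eta> w ^ p)) (at 0)" by simp
  moreover have "((\<lambda>s. gauss_moment (Suc p) * e s ^ Suc q) has_real_derivative
     gauss_moment (Suc p) * (real (Suc q) * e 0 ^ q * (2 * expectation (\<lambda>w. \<zeta> w * \<eta> w)))) (at 0)"
    by (rule derivative_eq_intros de refl)+ simp
  ultimately have 1: "real (Suc p) * expectation (\<lambda>w. \<zeta> w * \<eta> w ^ p)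
     = gauss_moment (Suc p) * (real (Suc q) * e 0 ^ q * (2 * expectation (\<lambda>w. \<zeta> w * \<eta> w)))"
    using DERIV_unique by fastforce
  have "sqrt (e 0) ^ (2 * q) = e 0 ^ q" using e0[of 0] by (simp add: power_mult)
  then have 2: "expectation (\<lambda>w. \<eta> w ^ (p - 1)) = gauss_moment (2 * q) * e 0 ^ q"
    using has_bochner_integral_integral_eq[OF moments_L[OF assms(2), of "p - 1"]] p
    by (simp add: e_def)
  have 3: "gauss_moment (Suc p) = real p * gauss_moment (2 * q)"
    unfolding p gauss_moment_Suc_Suc ..
  have "real (Suc p) * expectation (\<lambda>w. \<zeta> w * \<eta> w ^ p)
     = real (Suc p) * (real p * expectation (\<lambda>w. \<zeta> w * \<eta> w) * expectation (\<lambda>w. \<eta> w ^ (p - 1)))"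
    unfolding 1 2 3 by (simp add: p algebra_simps)
  then show ?thesis by (rule mult_left_cancel[THEN iffD1, rotated]) simp
qed

end

text \<open>
  The derivative of the product of \<open>Ys\<close> in the direction in which each variable \<open>Y\<close> changes
  at the rate \<open>E[\<zeta> Y]\<close>. It is defined on lists, because distinct polynomials in the
  variables may be the same random variable.
\<close>

primrec wick_diff :: "'a measure \<Rightarrow> ('a \<Rightarrow> real) \<Rightarrow> ('a \<Rightarrow> real) list \<Rightarrow> 'a \<Rightarrow> real" where
  "wick_diff M \<zeta> [] = (\<lambda>w. 0)"
| "wick_diff M \<zeta> (Y # Ys) = (\<lambda>w. (\<integral>w'. \<zeta> w' * Y w' \<partial>M) * prod_rv Ys w
     + Y w * wick_diff M \<zeta> Ys w)"

context gaussian_space begin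

lemma all_moments_wick_diff:
  "set Ys \<subseteq> L \<Longrightarrow> wick_diff M \<zeta> Ys \<in> all_moments M"
proof (induction Ys)
  case Nil
  then show ?case using all_moments_const[OF finite_M, of 0] by simp
next
  case (Cons Y Ys)
  then show ?case
    unfolding wick_diff.simps
    by (intro all_moments_closure all_moments_cmult finite_M)
       (auto intro: L_all_moments)
qed

text \<open>
  Wick's formula. The power of \<open>\<eta>\<close> is carried along so that the induction can polarise once
  more: the step takes the induction hypothesis for \<open>\<eta> + s Y\<close> and compares derivatives at
  \<open>s = 0\<close>.
\<close>

lemma wick_list:
  assumes "\<zeta> \<in> L" "\<eta> \<in> L" "set Ys \<subseteq> L"
  shows "expectation (\<lambda>w. \<zeta> w * prod_rv Ys w * \<eta> w ^ p)
       = expectation (\<lambda>w. wick_diff M \<zeta> Ys w * \<eta> w ^ p)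
         + real p * expectation (\<lambda>w. \<zeta> w * \<eta> w)
             * expectation (\<lambda>w. prod_rv Ys w * \<eta> w ^ (p - 1))"
  using assms(2,3)
proof (induction Ys arbitrary: \<eta> p)
  case Nil
  then show ?case using wick_power[OF assms(1) Nil(1), of p] by simp
next
  case (Cons Y Ys)
  define P where "P = (\<lambda>w. prod_rv Ys w)"
  define D where "D = wick_diff M \<zeta> Ys"
  define cv where "cv U V = expectation (\<lambda>w. U w * V w)" for U V :: "'a \<Rightarrow> real"
  have Y: "Y \<in> L" and Ys: "set Ys \<subseteq> L" using Cons.prems by auto
  have mom: "P \<in> all_moments M" "D \<in> all_moments M" "Y \<in> all_moments M" "\<eta> \<in> all_moments M"
    "\<zeta> \<in> all_moments M"
    using Ys Y Cons.prems assms(1) unfolding P_def D_def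
    by (auto intro!: all_moments_prod_list finite_M all_moments_wick_diff intro: L_all_moments)
  note mI = integrable_moments all_moments_closure all_moments_cmult mom finite_M
  have IH: "expectation (\<lambda>w. \<zeta> w * P w * (\<eta> w + s * Y w) ^ Suc p)
     = expectation (\<lambda>w. D w * (\<eta> w + s * Y w) ^ Suc p)
       + real (Suc p) * (cv \<zeta> \<eta> + s * cv \<zeta> Y) * expectation (\<lambda>w. P w * (\<eta> w + s * Y w) ^ p)" for s
  proof -
    have "expectation (\<lambda>w. \<zeta> w * (\<eta> w + s * Y w)) = expectation (\<lambda>w. \<zeta> w * \<eta> w + s * (\<zeta> w * Y w))"
      by (simp add: algebra_simps)
    also have "\<dots> = cv \<zeta> \<eta> + expectation (\<lambda>w. s * (\<zeta> w * Y w))"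
      unfolding cv_def by (intro Bochner_Integration.integral_add mI)
    finally have "expectation (\<lambda>w. \<zeta> w * (\<eta> w + s * Y w)) = cv \<zeta> \<eta> + s * cv \<zeta> Y"
      by (simp add: cv_def)
    then show ?thesis
      using Cons.IH[of "\<lambda>w. \<eta> w + s * Y w" "Suc p"] lin_L[OF Cons.prems(1) Y, of 1 s] Ys
      by (simp add: P_def D_def)
  qed
  have dL: "((\<lambda>s. expectation (\<lambda>w. \<zeta> w * P w * (\<eta> w + s * Y w) ^ Suc p)) has_real_derivative
      real (Suc p) * expectation (\<lambda>w. \<zeta> w * P w * Y w * \<eta> w ^ p)) (at 0)"
    by (intro derivative_power_moment mI)
  have dD: "((\<lambda>s. expectation (\<lambda>w. D w * (\<eta> w + s * Y w) ^ Suc p)) has_real_derivative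
      real (Suc p) * expectation (\<lambda>w. D w * Y w * \<eta> w ^ p)) (at 0)"
    by (intro derivative_power_moment mI)
  have dP: "((\<lambda>s. expectation (\<lambda>w. P w * (\<eta> w + s * Y w) ^ p)) has_real_derivative
      real p * expectation (\<lambda>w. P w * Y w * \<eta> w ^ (p - 1))) (at 0)"
  proof (cases p)
    case (Suc q)
    show ?thesis unfolding Suc diff_Suc_1 by (intro derivative_power_moment mI)
  qed simp
  have "((\<lambda>s. expectation (\<lambda>w. D w * (\<eta> w + s * Y w) ^ Suc p)
       + real (Suc p) * (cv \<zeta> \<eta> + s * cv \<zeta> Y) * expectation (\<lambda>w. P w * (\<eta> w + s * Y w) ^ p))
     has_real_derivative
       real (Suc p) * expectation (\<lambda>w. D w * Y w * \<eta> w ^ p)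
       + real (Suc p) * cv \<zeta> Y * expectation (\<lambda>w. P w * \<eta> w ^ p)
       + real (Suc p) * cv \<zeta> \<eta> * (real p * expectation (\<lambda>w. P w * Y w * \<eta> w ^ (p - 1)))) (at 0)"
    by (rule derivative_eq_intros dD dP refl)+ simp
  then have "real (Suc p) * expectation (\<lambda>w. \<zeta> w * P w * Y w * \<eta> w ^ p) =
       real (Suc p) * expectation (\<lambda>w. D w * Y w * \<eta> w ^ p)
       + real (Suc p) * cv \<zeta> Y * expectation (\<lambda>w. P w * \<eta> w ^ p)
       + real (Suc p) * cv \<zeta> \<eta> * (real p * expectation (\<lambda>w. P w * Y w * \<eta> w ^ (p - 1)))"
    using dL unfolding IH by (rule DERIV_unique[rotated])
  also have "\<dots> = real (Suc p) * (expectation (\<lambda>w. D w * Y w * \<eta> w ^ p)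
       + cv \<zeta> Y * expectation (\<lambda>w. P w * \<eta> w ^ p)
       + cv \<zeta> \<eta> * (real p * expectation (\<lambda>w. P w * Y w * \<eta> w ^ (p - 1))))"
    by (simp only: distrib_left mult.assoc)
  finally have 1: "expectation (\<lambda>w. \<zeta> w * P w * Y w * \<eta> w ^ p) =
       expectation (\<lambda>w. D w * Y w * \<eta> w ^ p)
       + cv \<zeta> Y * expectation (\<lambda>w. P w * \<eta> w ^ p)
       + cv \<zeta> \<eta> * (real p * expectation (\<lambda>w. P w * Y w * \<eta> w ^ (p - 1)))"
    by (rule mult_left_cancel[THEN iffD1, rotated]) simp
  have "expectation (\<lambda>w. (cv \<zeta> Y * P w + Y w * D w) * \<eta> w ^ p)
      = expectation (\<lambda>w. D w * Y w * \<eta> w ^ p + cv \<zeta> Y * (P w * \<eta> w ^ p))"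
    by (simp add: algebra_simps)
  also have "\<dots> = expectation (\<lambda>w. D w * Y w * \<eta> w ^ p) + expectation (\<lambda>w. cv \<zeta> Y * (P w * \<eta> w ^ p))"
    by (intro Bochner_Integration.integral_add mI)
  finally have 2: "expectation (\<lambda>w. (cv \<zeta> Y * P w + Y w * D w) * \<eta> w ^ p)
      = expectation (\<lambda>w. D w * Y w * \<eta> w ^ p) + cv \<zeta> Y * expectation (\<lambda>w. P w * \<eta> w ^ p)"
    by simp
  have 3: "expectation (\<lambda>w. \<zeta> w * prod_rv (Y # Ys) w * \<eta> w ^ p)
     = expectation (\<lambda>w. \<zeta> w * P w * Y w * \<eta> w ^ p)"
    "expectation (\<lambda>w. prod_rv (Y # Ys) w * \<eta> w ^ (p - 1))
     = expectation (\<lambda>w. P w * Y w * \<eta> w ^ (p - 1))"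
    "expectation (\<lambda>w. wick_diff M \<zeta> (Y # Ys) w * \<eta> w ^ p)
     = expectation (\<lambda>w. (cv \<zeta> Y * P w + Y w * D w) * \<eta> w ^ p)"
    by (simp_all add: P_def D_def cv_def mult_ac)
  show ?case unfolding 3 1 2 by (simp add: cv_def)
qed

text \<open>
  \<open>G\<close> plays the part of \<open>\<Sum>\<^sub>k E[\<zeta> \<xi>\<^sub>k] \<partial>\<^sub>k F\<close> in Gaussian integration by parts. The identity
  is demanded with every product of further variables as an additional factor, since then
  the relation is preserved by multiplication (product rule).
\<close>

definition ibp :: "('a \<Rightarrow> real) \<Rightarrow> ('a \<Rightarrow> real) \<Rightarrow> ('a \<Rightarrow> real) \<Rightarrow> bool" where
  "ibp \<zeta> F G \<longleftrightarrow> F \<in> all_moments M \<and> G \<in> all_moments M \<and>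
     (\<forall>Ys. set Ys \<subseteq> L \<longrightarrow> expectation (\<lambda>w. \<zeta> w * F w * prod_rv Ys w)
        = expectation (\<lambda>w. G w * prod_rv Ys w + F w * wick_diff M \<zeta> Ys w))"

lemma ibp_const:
  assumes "\<zeta> \<in> L" shows "ibp \<zeta> (\<lambda>_. c) (\<lambda>_. 0)"
  unfolding ibp_def
proof (intro conjI allI impI)
  fix Ys assume Ys: "set Ys \<subseteq> L"
  have "expectation (\<lambda>w. \<zeta> w * c * prod_rv Ys w)
     = c * expectation (\<lambda>w. \<zeta> w * prod_rv Ys w)"
    by (subst integral_mult_right_zero[symmetric]) (simp add: mult_ac)
  then show "expectation (\<lambda>w. \<zeta> w * c * prod_rv Ys w) =
     expectation (\<lambda>w. 0 * prod_rv Ys w + c * wick_diff M \<zeta> Ys w)"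
    using wick_list[OF assms assms Ys, of 0] by simp
qed (auto intro: all_moments_const finite_M)

lemma ibp_mult_L:
  assumes "ibp \<zeta> F G" "Y \<in> L"
  shows "ibp \<zeta> (\<lambda>w. F w * Y w) (\<lambda>w. G w * Y w + expectation (\<lambda>w. \<zeta> w * Y w) * F w)"
  unfolding ibp_def
proof (intro conjI allI impI)
  fix Ys assume Ys: "set Ys \<subseteq> L"
  show "expectation (\<lambda>w. \<zeta> w * (F w * Y w) * prod_rv Ys w) =
     expectation (\<lambda>w. (G w * Y w + expectation (\<lambda>w. \<zeta> w * Y w) * F w) * prod_rv Ys w
        + F w * Y w * wick_diff M \<zeta> Ys w)"
    using assms(1)[unfolded ibp_def, THEN conjunct2, THEN conjunct2, rule_format, of "Y # Ys"] assms(2) Ys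
    by (simp add: algebra_simps)
next
  show "(\<lambda>w. F w * Y w) \<in> all_moments M"
    "(\<lambda>w. G w * Y w + expectation (\<lambda>w. \<zeta> w * Y w) * F w) \<in> all_moments M"
    using assms unfolding ibp_def
    by (auto intro!: all_moments_closure all_moments_cmult finite_M intro: L_all_moments)
qed

lemma ibp_lin:
  assumes "\<zeta> \<in> L" "ibp \<zeta> F G" "ibp \<zeta> F' G'"
  shows "ibp \<zeta> (\<lambda>w. F w + c * F' w) (\<lambda>w. G w + c * G' w)"
  unfolding ibp_def
proof (intro conjI allI impI)
  fix Ys assume Ys: "set Ys \<subseteq> L"
  define P where "P = (\<lambda>w. prod_rv Ys w)"
  define D where "D = wick_diff M \<zeta> Ys"
  have mom: "P \<in> all_moments M" "D \<in> all_moments M" "\<zeta> \<in> all_moments M"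
    "F \<in> all_moments M" "G \<in> all_moments M" "F' \<in> all_moments M" "G' \<in> all_moments M"
    using Ys assms unfolding P_def D_def ibp_def
    by (auto intro!: all_moments_prod_list finite_M all_moments_wick_diff intro: L_all_moments)
  note mI = integrable_moments all_moments_closure all_moments_cmult mom finite_M
  have e: "expectation (\<lambda>w. \<zeta> w * F w * P w) = expectation (\<lambda>w. G w * P w + F w * D w)"
    "expectation (\<lambda>w. \<zeta> w * F' w * P w) = expectation (\<lambda>w. G' w * P w + F' w * D w)"
    using assms Ys by (auto simp: ibp_def P_def D_def)
  have "expectation (\<lambda>w. \<zeta> w * (F w + c * F' w) * P w)
     = expectation (\<lambda>w. \<zeta> w * F w * P w + c * (\<zeta> w * F' w * P w))" by (simp add: algebra_simps)
  also have "\<dots> = expectation (\<lambda>w. \<zeta> w * F w * P w) + expectation (\<lambda>w. c * (\<zeta> w * F' w * P w))"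
    by (intro Bochner_Integration.integral_add mI)
  also have "\<dots> = expectation (\<lambda>w. G w * P w + F w * D w)
     + expectation (\<lambda>w. c * (G' w * P w + F' w * D w))"
    unfolding integral_mult_right_zero e ..
  also have "\<dots> = expectation (\<lambda>w. (G w * P w + F w * D w) + c * (G' w * P w + F' w * D w))"
    by (intro Bochner_Integration.integral_add[symmetric] mI)
  also have "\<dots> = expectation (\<lambda>w. (G w + c * G' w) * P w + (F w + c * F' w) * D w)"
    by (simp add: algebra_simps)
  finally show "expectation (\<lambda>w. \<zeta> w * (F w + c * F' w) * prod_rv Ys w) =
     expectation (\<lambda>w. (G w + c * G' w) * prod_rv Ys w
        + (F w + c * F' w) * wick_diff M \<zeta> Ys w)"
    by (simp add: P_def D_def)
next
  show "(\<lambda>w. F w + c * F' w) \<in> all_moments M" "(\<lambda>w. G w + c * G' w) \<in> all_moments M"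
    using assms unfolding ibp_def
    by (auto intro!: all_moments_closure all_moments_cmult finite_M)
qed

lemma ibp_sum:
  assumes "\<zeta> \<in> L" "finite K" "\<And>a. a \<in> K \<Longrightarrow> ibp \<zeta> (F a) (G a)"
  shows "ibp \<zeta> (\<lambda>w. \<Sum>a\<in>K. c a * F a w) (\<lambda>w. \<Sum>a\<in>K. c a * G a w)"
  using assms(2,3)
proof (induction K rule: finite_induct)
  case empty
  show ?case using ibp_const[OF assms(1), of 0] by simp
next
  case (insert x K)
  have "ibp \<zeta> (\<lambda>w. (\<Sum>a\<in>K. c a * F a w) + c x * F x w) (\<lambda>w. (\<Sum>a\<in>K. c a * G a w) + c x * G x w)"
    using insert by (intro ibp_lin assms(1)) auto
  then show ?case using insert by (simp add: add.commute)
qed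

lemma ibpD: "ibp \<zeta> F G \<Longrightarrow> expectation (\<lambda>w. \<zeta> w * F w) = expectation G"
  unfolding ibp_def by (elim conjE allE[of _ "[]"]) simp

text \<open>
  A centred diagonal quadratic form. Quadratic variations on several grids at once are of
  this kind, with one family of variables that contains the increments on all grids.
\<close>

definition quad :: "'i set \<Rightarrow> ('i \<Rightarrow> 'a \<Rightarrow> real) \<Rightarrow> ('i \<Rightarrow> real) \<Rightarrow> 'a \<Rightarrow> real" where
  "quad K \<xi> l w = (\<Sum>a\<in>K. l a * ((\<xi> a w)\<^sup>2 - expectation (\<lambda>w. (\<xi> a w)\<^sup>2)))"

lemma ibp_mult_quad:
  assumes "\<zeta> \<in> L" "finite K" "\<And>a. a \<in> K \<Longrightarrow> \<xi> a \<in> L" "ibp \<zeta> F G"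
  shows "ibp \<zeta> (\<lambda>w. F w * quad K \<xi> l w)
     (\<lambda>w. G w * quad K \<xi> l w
        + F w * (\<Sum>a\<in>K. 2 * l a * expectation (\<lambda>w. \<zeta> w * \<xi> a w) * \<xi> a w))"
proof -
  define q where "q a = expectation (\<lambda>w. (\<xi> a w)\<^sup>2)" for a
  define cv where "cv a = expectation (\<lambda>w. \<zeta> w * \<xi> a w)" for a
  have "ibp \<zeta> (\<lambda>w. F w * \<xi> a w * \<xi> a w + (- q a) * F w)
     (\<lambda>w. ((G w * \<xi> a w + cv a * F w) * \<xi> a w + cv a * (F w * \<xi> a w)) + (- q a) * G w)"
    if "a \<in> K" for a
    unfolding cv_def using assms that by (intro ibp_lin ibp_mult_L) auto
  from ibp_sum[OF assms(1,2) this, where c=l]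
  have "ibp \<zeta> (\<lambda>w. \<Sum>a\<in>K. l a * (F w * \<xi> a w * \<xi> a w + (- q a) * F w))
   (\<lambda>w. \<Sum>a\<in>K. l a * (((G w * \<xi> a w + cv a * F w) * \<xi> a w + cv a * (F w * \<xi> a w)) + (- q a) * G w))" .
  moreover have "(\<Sum>a\<in>K. l a * (F w * \<xi> a w * \<xi> a w + (- q a) * F w)) = F w * quad K \<xi> l w" for w
    unfolding quad_def q_def[symmetric] sum_distrib_left
    by (intro sum.cong refl) (simp add: algebra_simps power2_eq_square)
  moreover have "(\<Sum>a\<in>K. l a * (((G w * \<xi> a w + cv a * F w) * \<xi> a w + cv a * (F w * \<xi> a w)) + (- q a) * G w))
     = G w * quad K \<xi> l w + F w * (\<Sum>a\<in>K. 2 * l a * cv a * \<xi> a w)" for w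
    unfolding quad_def q_def[symmetric] sum_distrib_left sum.distrib[symmetric]
    by (intro sum.cong refl) (simp add: algebra_simps power2_eq_square)
  ultimately show ?thesis by (simp add: cv_def)
qed

lemma ibp_quad_power:
  assumes "\<zeta> \<in> L" "finite K" "\<And>a. a \<in> K \<Longrightarrow> \<xi> a \<in> L"
  shows "ibp \<zeta> (\<lambda>w. quad K \<xi> l w ^ m)
     (\<lambda>w. real m * quad K \<xi> l w ^ (m - 1)
         * (\<Sum>a\<in>K. 2 * l a * expectation (\<lambda>w. \<zeta> w * \<xi> a w) * \<xi> a w))"
proof (induction m)
  case 0
  then show ?case using ibp_const[OF assms(1), of 1] by simp
next
  case (Suc m)
  define d where "d w = (\<Sum>a\<in>K. 2 * l a * expectation (\<lambda>w. \<zeta> w * \<xi> a w) * \<xi> a w)" for w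
  have "ibp \<zeta> (\<lambda>w. quad K \<xi> l w ^ m * quad K \<xi> l w)
    (\<lambda>w. real m * quad K \<xi> l w ^ (m - 1) * d w * quad K \<xi> l w + quad K \<xi> l w ^ m * d w)"
    unfolding d_def using ibp_mult_quad[OF assms Suc, where l=l] .
  moreover have "real m * quad K \<xi> l w ^ (m - 1) * d w * quad K \<xi> l w + quad K \<xi> l w ^ m * d w
     = real (Suc m) * quad K \<xi> l w ^ m * d w" for w
    by (cases m) (simp_all add: algebra_simps)
  ultimately show ?case by (simp add: d_def mult.commute[of "quad K \<xi> l _"])
qed

lemma quad_all_moments:
  assumes "\<And>a. a \<in> K \<Longrightarrow> \<xi> a \<in> L"
  shows "quad K \<xi> l \<in> all_moments M"
  unfolding quad_def[abs_def]
  by (intro all_moments_closure all_moments_cmult finite_M) (auto intro: L_all_moments assms)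

lemma quad_moment_recursion:
  assumes "\<zeta> \<in> L" "\<eta> \<in> L" "finite K" "\<And>a. a \<in> K \<Longrightarrow> \<xi> a \<in> L"
  shows "expectation (\<lambda>w. \<zeta> w * \<eta> w * quad K \<xi> l w ^ m)
    = expectation (\<lambda>w. \<zeta> w * \<eta> w) * expectation (\<lambda>w. quad K \<xi> l w ^ m)
      + 2 * real m * (\<Sum>a\<in>K. l a * expectation (\<lambda>w. \<zeta> w * \<xi> a w)
           * expectation (\<lambda>w. \<eta> w * \<xi> a w * quad K \<xi> l w ^ (m - 1)))"
proof -
  define W where "W = quad K \<xi> l"
  define cv where "cv a = expectation (\<lambda>w. \<zeta> w * \<xi> a w)" for a
  have mom: "W \<in> all_moments M" "\<zeta> \<in> all_moments M" "\<eta> \<in> all_moments M" "\<And>a. a \<in> K \<Longrightarrow> \<xi> a \<in> all_moments M"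
    using assms by (auto simp: W_def intro: L_all_moments quad_all_moments)
  note mI = integrable_moments all_moments_closure all_moments_cmult mom finite_M
  have "ibp \<zeta> (\<lambda>w. W w ^ m * \<eta> w)
     (\<lambda>w. real m * W w ^ (m - 1) * (\<Sum>a\<in>K. 2 * l a * cv a * \<xi> a w) * \<eta> w
        + expectation (\<lambda>w. \<zeta> w * \<eta> w) * W w ^ m)"
    unfolding W_def cv_def by (intro ibp_mult_L ibp_quad_power assms)
  from ibpD[OF this]
  have "expectation (\<lambda>w. \<zeta> w * (W w ^ m * \<eta> w)) =
     expectation (\<lambda>w. real m * W w ^ (m - 1) * (\<Sum>a\<in>K. 2 * l a * cv a * \<xi> a w) * \<eta> w
        + expectation (\<lambda>w. \<zeta> w * \<eta> w) * W w ^ m)" .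
  also have "\<dots> = expectation (\<lambda>w. (\<Sum>a\<in>K. (2 * real m * l a * cv a) * (\<eta> w * \<xi> a w * W w ^ (m - 1)))
        + expectation (\<lambda>w. \<zeta> w * \<eta> w) * W w ^ m)"
    by (simp add: sum_distrib_left sum_distrib_right mult_ac)
  also have "\<dots> = expectation (\<lambda>w. \<Sum>a\<in>K. (2 * real m * l a * cv a) * (\<eta> w * \<xi> a w * W w ^ (m - 1)))
        + expectation (\<lambda>w. expectation (\<lambda>w. \<zeta> w * \<eta> w) * W w ^ m)"
    by (intro Bochner_Integration.integral_add mI)
  also have "expectation (\<lambda>w. \<Sum>a\<in>K. (2 * real m * l a * cv a) * (\<eta> w * \<xi> a w * W w ^ (m - 1)))
    = (\<Sum>a\<in>K. expectation (\<lambda>w. (2 * real m * l a * cv a) * (\<eta> w * \<xi> a w * W w ^ (m - 1))))"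
    by (intro Bochner_Integration.integral_sum mI)
  also have "\<dots> = 2 * real m * (\<Sum>a\<in>K. l a * cv a * expectation (\<lambda>w. \<eta> w * \<xi> a w * W w ^ (m - 1)))"
    unfolding integral_mult_right_zero sum_distrib_left by (intro sum.cong refl) simp
  also have "expectation (\<lambda>w. expectation (\<lambda>w. \<zeta> w * \<eta> w) * W w ^ m)
    = expectation (\<lambda>w. \<zeta> w * \<eta> w) * expectation (\<lambda>w. W w ^ m)"
    by simp
  also have "expectation (\<lambda>w. \<zeta> w * (W w ^ m * \<eta> w)) = expectation (\<lambda>w. \<zeta> w * \<eta> w * W w ^ m)"
    by (simp add: mult_ac)
  finally show ?thesis
    by (simp add: W_def cv_def)
qed

end

section \<open>Moments of quadratic forms in Gaussian variables\<close>

context gaussian_space begin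

abbreviation gram :: "('i \<Rightarrow> 'a \<Rightarrow> real) \<Rightarrow> 'i \<Rightarrow> 'i \<Rightarrow> real" where
  "gram \<xi> a b \<equiv> expectation (\<lambda>w. \<xi> a w * \<xi> b w)"

abbreviation quad_moment ::
    "'i set \<Rightarrow> ('i \<Rightarrow> 'a \<Rightarrow> real) \<Rightarrow> ('i \<Rightarrow> real) \<Rightarrow> nat \<Rightarrow> real" where
  "quad_moment K \<xi> l m \<equiv> expectation (\<lambda>w. quad K \<xi> l w ^ m)"

text \<open>
  Integration by parts leads from diagonal quadratic forms to forms with a general matrix
  \<open>B\<close>, so the recursion has to be run for their moments against powers of the diagonal form.
\<close>

definition bilinear_moment ::
    "'i set \<Rightarrow> ('i \<Rightarrow> 'a \<Rightarrow> real) \<Rightarrow> ('i \<Rightarrow> real) \<Rightarrow> ('i \<Rightarrow> 'i \<Rightarrow> real) \<Rightarrow> nat \<Rightarrow> real" where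
  "bilinear_moment K \<xi> l B m =
     (\<Sum>a\<in>K. \<Sum>b\<in>K. B a b * expectation (\<lambda>w. \<xi> a w * \<xi> b w * quad K \<xi> l w ^ m))"

text \<open>
  Integration by parts in the second factor: the matrix \<open>B\<close> is replaced by \<open>B D \<Lambda>\<close>, where
  \<open>D\<close> is the covariance matrix and \<open>\<Lambda>\<close> the diagonal matrix of the weights, and the power
  drops by one.
\<close>

lemma bilinear_moment_recursion:
  assumes "finite K" "\<And>a. a \<in> K \<Longrightarrow> \<xi> a \<in> L"
  shows "bilinear_moment K \<xi> l B m = (\<Sum>a\<in>K. \<Sum>b\<in>K. B a b * gram \<xi> a b) * quad_moment K \<xi> l m
     + 2 * real m * bilinear_moment K \<xi> l (\<lambda>a c. \<Sum>b\<in>K. B a b * gram \<xi> b c * l c) (m - 1)"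
proof -
  define e where "e = quad_moment K \<xi> l m"
  define h where "h a c = expectation (\<lambda>w. \<xi> a w * \<xi> c w * quad K \<xi> l w ^ (m - 1))" for a c
  have "bilinear_moment K \<xi> l B m = (\<Sum>a\<in>K. \<Sum>b\<in>K. B a b * gram \<xi> a b * e
      + 2 * real m * (\<Sum>c\<in>K. B a b * gram \<xi> b c * l c * h a c))"
    unfolding bilinear_moment_def
  proof (intro sum.cong refl)
    fix a b assume "a \<in> K" "b \<in> K"
    from quad_moment_recursion[OF assms(2)[OF this(2)] assms(2)[OF this(1)] assms, where l=l and m=m]
    have "expectation (\<lambda>w. \<xi> a w * \<xi> b w * quad K \<xi> l w ^ m)
       = gram \<xi> a b * e + 2 * real m * (\<Sum>c\<in>K. l c * gram \<xi> b c * h a c)"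
      by (simp add: e_def h_def mult.commute)
    then show "B a b * expectation (\<lambda>w. \<xi> a w * \<xi> b w * quad K \<xi> l w ^ m) =
       B a b * gram \<xi> a b * e + 2 * real m * (\<Sum>c\<in>K. B a b * gram \<xi> b c * l c * h a c)"
      by (simp add: algebra_simps sum_distrib_left)
  qed
  also have "\<dots> = (\<Sum>a\<in>K. \<Sum>b\<in>K. B a b * gram \<xi> a b) * e
      + 2 * real m * (\<Sum>a\<in>K. \<Sum>b\<in>K. \<Sum>c\<in>K. B a b * gram \<xi> b c * l c * h a c)"
    by (simp add: sum.distrib sum_distrib_left sum_distrib_right)
  also have "(\<Sum>a\<in>K. \<Sum>b\<in>K. \<Sum>c\<in>K. B a b * gram \<xi> b c * l c * h a c)
     = (\<Sum>a\<in>K. \<Sum>c\<in>K. \<Sum>b\<in>K. B a b * gram \<xi> b c * l c * h a c)"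
    by (intro sum.cong refl sum.swap)
  finally show ?thesis
    by (simp add: bilinear_moment_def e_def h_def sum_distrib_right)
qed

text \<open>
  One factor of the quadratic form is integrated by parts; its trace term is removed by the
  centring, so that only the matrix \<open>\<Lambda> D \<Lambda>\<close> remains.
\<close>

lemma quad_moment_Suc:
  assumes "finite K" "\<And>a. a \<in> K \<Longrightarrow> \<xi> a \<in> L"
  shows "quad_moment K \<xi> l (Suc m)
     = 2 * real m * bilinear_moment K \<xi> l (\<lambda>a c. l a * gram \<xi> a c * l c) (m - 1)"
proof -
  define W where "W = quad K \<xi> l"
  define h where "h a c = expectation (\<lambda>w. \<xi> a w * \<xi> c w * quad K \<xi> l w ^ (m - 1))" for a c
  have mom: "W \<in> all_moments M" "\<And>a. a \<in> K \<Longrightarrow> \<xi> a \<in> all_moments M"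
    using assms by (auto simp: W_def intro: L_all_moments quad_all_moments)
  note mI = integrable_moments all_moments_closure all_moments_cmult mom finite_M
  have "quad_moment K \<xi> l (Suc m) = expectation (\<lambda>w. quad K \<xi> l w * W w ^ m)"
    by (simp add: W_def)
  also have "\<dots> = expectation (\<lambda>w. \<Sum>a\<in>K. l a * (\<xi> a w * \<xi> a w * W w ^ m - gram \<xi> a a * W w ^ m))"
    unfolding quad_def sum_distrib_right power2_eq_square
    by (intro Bochner_Integration.integral_cong refl sum.cong) (simp add: algebra_simps)
  also have "\<dots> = (\<Sum>a\<in>K. l a * (expectation (\<lambda>w. \<xi> a w * \<xi> a w * W w ^ m) - gram \<xi> a a * expectation (\<lambda>w. W w ^ m)))"
  proof (subst Bochner_Integration.integral_sum)
    show "integrable M (\<lambda>w. l a * (\<xi> a w * \<xi> a w * W w ^ m - gram \<xi> a a * W w ^ m))" if "a \<in> K" for a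
      by (intro mI that)
    show "(\<Sum>a\<in>K. expectation (\<lambda>w. l a * (\<xi> a w * \<xi> a w * W w ^ m - gram \<xi> a a * W w ^ m)))
      = (\<Sum>a\<in>K. l a * (expectation (\<lambda>w. \<xi> a w * \<xi> a w * W w ^ m) - gram \<xi> a a * expectation (\<lambda>w. W w ^ m)))"
    proof (intro sum.cong refl)
      fix a assume a: "a \<in> K"
      have "expectation (\<lambda>w. \<xi> a w * \<xi> a w * W w ^ m - gram \<xi> a a * W w ^ m)
        = expectation (\<lambda>w. \<xi> a w * \<xi> a w * W w ^ m) - expectation (\<lambda>w. gram \<xi> a a * W w ^ m)"
        by (intro Bochner_Integration.integral_diff mI a)
      then show "expectation (\<lambda>w. l a * (\<xi> a w * \<xi> a w * W w ^ m - gram \<xi> a a * W w ^ m))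
        = l a * (expectation (\<lambda>w. \<xi> a w * \<xi> a w * W w ^ m) - gram \<xi> a a * expectation (\<lambda>w. W w ^ m))"
        by simp
    qed
  qed
  also have "\<dots> = (\<Sum>a\<in>K. 2 * real m * (\<Sum>c\<in>K. l a * gram \<xi> a c * l c * h a c))"
  proof (intro sum.cong refl)
    fix a assume a: "a \<in> K"
    from quad_moment_recursion[OF assms(2)[OF a] assms(2)[OF a] assms, where l=l and m=m]
    show "l a * (expectation (\<lambda>w. \<xi> a w * \<xi> a w * W w ^ m) - gram \<xi> a a * expectation (\<lambda>w. W w ^ m))
       = 2 * real m * (\<Sum>c\<in>K. l a * gram \<xi> a c * l c * h a c)"
      by (simp add: W_def h_def sum_distrib_left mult_ac)
  qed
  finally show ?thesis
    by (simp add: bilinear_moment_def h_def sum_distrib_left)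
qed

text \<open>
  The size of a family of quadratic forms: \<open>\<alpha>\<close> bounds the weights, \<open>\<delta>\<close> the absolute row sums
  of the covariance matrix, and \<open>c\<close> the product of \<open>\<alpha>\<^sup>2\<close> with the number of variables, which
  has the order of the variance. Row sums are used as the matrix norm because they are
  submultiplicative and easy to compute.
\<close>

definition bounded_quad ::
    "real \<Rightarrow> real \<Rightarrow> real \<Rightarrow> 'i set \<Rightarrow> ('i \<Rightarrow> 'a \<Rightarrow> real) \<Rightarrow> ('i \<Rightarrow> real) \<Rightarrow> bool" where
  "bounded_quad c \<delta> \<alpha> K \<xi> l \<longleftrightarrow> finite K \<and> (\<forall>a\<in>K. \<xi> a \<in> L) \<and> 0 \<le> \<alpha> \<and> \<alpha> \<le> 1 \<and>
     \<alpha>\<^sup>2 * card K \<le> c \<and> (\<forall>a\<in>K. \<bar>l a\<bar> \<le> \<alpha>) \<and> 0 \<le> \<delta> \<and> (\<forall>a\<in>K. (\<Sum>b\<in>K. \<bar>gram \<xi> a b\<bar>) \<le> \<delta>)"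

lemma row_sum_product:
  assumes "bounded_quad c \<delta> \<alpha> K \<xi> l" "\<And>a. a \<in> K \<Longrightarrow> (\<Sum>b\<in>K. \<bar>B a b\<bar>) \<le> \<beta>" "0 \<le> \<beta>" "a \<in> K"
  shows "(\<Sum>d\<in>K. \<bar>\<Sum>b\<in>K. B a b * gram \<xi> b d * l d\<bar>) \<le> \<beta> * \<delta> * \<alpha>"
proof -
  have "(\<Sum>d\<in>K. \<bar>\<Sum>b\<in>K. B a b * gram \<xi> b d * l d\<bar>) \<le> (\<Sum>d\<in>K. \<Sum>b\<in>K. \<bar>B a b\<bar> * (\<bar>gram \<xi> b d\<bar> * \<alpha>))"
  proof (intro sum_mono)
    fix d assume d: "d \<in> K"
    have "\<bar>\<Sum>b\<in>K. B a b * gram \<xi> b d * l d\<bar> \<le> (\<Sum>b\<in>K. \<bar>B a b * gram \<xi> b d * l d\<bar>)" by (rule sum_abs)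
    also have "\<dots> \<le> (\<Sum>b\<in>K. \<bar>B a b\<bar> * (\<bar>gram \<xi> b d\<bar> * \<alpha>))"
      using assms(1) d by (intro sum_mono) (auto simp: abs_mult bounded_quad_def mult.assoc intro!: mult_left_mono)
    finally show "\<bar>\<Sum>b\<in>K. B a b * gram \<xi> b d * l d\<bar> \<le> (\<Sum>b\<in>K. \<bar>B a b\<bar> * (\<bar>gram \<xi> b d\<bar> * \<alpha>))" .
  qed
  also have "\<dots> = (\<Sum>b\<in>K. \<bar>B a b\<bar> * ((\<Sum>d\<in>K. \<bar>gram \<xi> b d\<bar>) * \<alpha>))"
    by (subst sum.swap) (simp add: sum_distrib_left sum_distrib_right)
  also have "\<dots> \<le> (\<Sum>b\<in>K. \<bar>B a b\<bar> * (\<delta> * \<alpha>))"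
    using assms(1) by (intro sum_mono mult_left_mono mult_right_mono) (auto simp: bounded_quad_def)
  also have "\<dots> = (\<Sum>b\<in>K. \<bar>B a b\<bar>) * (\<delta> * \<alpha>)" by (simp add: sum_distrib_right)
  also have "\<dots> \<le> \<beta> * (\<delta> * \<alpha>)"
    using assms by (intro mult_right_mono) (auto simp: bounded_quad_def)
  finally show ?thesis by (simp add: mult.assoc)
qed

lemma row_sum_weighted_gram:
  assumes "bounded_quad c \<delta> \<alpha> K \<xi> l" "a \<in> K"
  shows "(\<Sum>d\<in>K. \<bar>l a * gram \<xi> a d * l d\<bar>) \<le> \<alpha>\<^sup>2 * \<delta>"
proof -
  have "(\<Sum>d\<in>K. \<bar>l a * gram \<xi> a d * l d\<bar>) \<le> (\<Sum>d\<in>K. \<alpha> * \<bar>gram \<xi> a d\<bar> * \<alpha>)"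
    using assms by (intro sum_mono) (auto simp: abs_mult bounded_quad_def intro!: mult_mono)
  also have "\<dots> = \<alpha>\<^sup>2 * (\<Sum>d\<in>K. \<bar>gram \<xi> a d\<bar>)"
    by (simp add: sum_distrib_left power2_eq_square mult_ac)
  also have "\<dots> \<le> \<alpha>\<^sup>2 * \<delta>" using assms by (intro mult_left_mono) (auto simp: bounded_quad_def)
  finally show ?thesis .
qed

text \<open>
  The two recursions are run simultaneously. A matrix with row sums at most \<open>\<beta>\<close> contributes
  at most a constant times the number of variables times \<open>\<beta>\<close>; for \<open>\<Lambda> D \<Lambda>\<close> this is of order
  \<open>\<alpha>\<^sup>2 card K\<close>, hence bounded.
\<close>

lemma quad_moments_bounded:
  assumes "0 \<le> c" "0 \<le> \<delta>"
  shows "\<exists>C\<ge>0. \<forall>\<alpha> (K :: 'i set) \<xi> l. bounded_quad c \<delta> \<alpha> K \<xi> l \<longrightarrow>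
     \<bar>quad_moment K \<xi> l m\<bar> \<le> C \<and>
     (\<forall>B \<beta>. 0 \<le> \<beta> \<longrightarrow> (\<forall>a\<in>K. (\<Sum>b\<in>K. \<bar>B a b\<bar>) \<le> \<beta>) \<longrightarrow>
        \<bar>bilinear_moment K \<xi> l B m\<bar> \<le> C * card K * \<beta>)"
proof (induction m rule: less_induct)
  case (less m)
  have "\<exists>E\<ge>0. \<forall>\<alpha> (K :: 'i set) \<xi> l. bounded_quad c \<delta> \<alpha> K \<xi> l \<longrightarrow> \<bar>quad_moment K \<xi> l m\<bar> \<le> E"
  proof (cases m)
    case 0
    then show ?thesis by (intro exI[of _ 1]) (auto simp: prob_space)
  next
    case (Suc k)
    show ?thesis
    proof (cases k)
      case 0
      show ?thesis
        by (intro exI[of _ 0]) (auto simp: Suc 0 quad_moment_Suc[where m=0, simplified] bounded_quad_def)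
    next
      case (Suc j)
      from less.IH[of j] obtain C :: real where C: "C \<ge> 0" and
        IH: "\<And>\<alpha> (K :: 'i set) \<xi> l B (\<beta>::real). bounded_quad c \<delta> \<alpha> K \<xi> l \<Longrightarrow> 0 \<le> \<beta> \<Longrightarrow>
           (\<forall>a\<in>K. (\<Sum>b\<in>K. \<bar>B a b\<bar>) \<le> \<beta>) \<Longrightarrow> \<bar>bilinear_moment K \<xi> l B j\<bar> \<le> C * card K * \<beta>"
        using \<open>m = Suc k\<close> Suc by auto
      show ?thesis
      proof (intro exI[of _ "2 * real k * (C * c * \<delta>)"] conjI allI impI)
        fix \<alpha> and K :: "'i set" and \<xi> l assume ad: "bounded_quad c \<delta> \<alpha> K \<xi> l"
        then have fin: "finite K" "\<And>a. a \<in> K \<Longrightarrow> \<xi> a \<in> L" and ca: "\<alpha>\<^sup>2 * card K \<le> c"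
          by (auto simp: bounded_quad_def)
        have "\<bar>bilinear_moment K \<xi> l (\<lambda>a c. l a * gram \<xi> a c * l c) j\<bar> \<le> C * card K * (\<alpha>\<^sup>2 * \<delta>)"
          using row_sum_weighted_gram[OF ad] assms by (intro IH[OF ad]) auto
        also have "\<dots> = (C * \<delta>) * (\<alpha>\<^sup>2 * card K)" by simp
        also have "\<dots> \<le> (C * \<delta>) * c" using ca C assms by (intro mult_left_mono) auto
        finally have "\<bar>bilinear_moment K \<xi> l (\<lambda>a c. l a * gram \<xi> a c * l c) j\<bar> \<le> C * c * \<delta>"
          by (simp add: mult_ac)
        then show "\<bar>quad_moment K \<xi> l m\<bar> \<le> 2 * real k * (C * c * \<delta>)"
          using quad_moment_Suc[OF fin, where l=l and m=k] \<open>m = Suc k\<close> Suc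
          by (simp add: abs_mult mult_left_mono)
      qed (use C assms in auto)
    qed
  qed
  then obtain E where E: "E \<ge> 0" and
    bE: "\<And>\<alpha> (K :: 'i set) \<xi> l. bounded_quad c \<delta> \<alpha> K \<xi> l \<Longrightarrow> \<bar>quad_moment K \<xi> l m\<bar> \<le> E" by blast
  have "\<exists>C\<ge>0::real. \<forall>\<alpha> (K :: 'i set) \<xi> l B (\<beta>::real). bounded_quad c \<delta> \<alpha> K \<xi> l \<longrightarrow> 0 \<le> \<beta> \<longrightarrow>
     (\<forall>a\<in>K. (\<Sum>b\<in>K. \<bar>B a b\<bar>) \<le> \<beta>) \<longrightarrow>
     \<bar>2 * real m * bilinear_moment K \<xi> l B (m - 1)\<bar> \<le> C * card K * \<beta>"
  proof (cases m)
    case (Suc k)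
    from less.IH[of k] obtain C :: real where C: "C \<ge> 0" and
      IH: "\<And>\<alpha> (K :: 'i set) \<xi> l B (\<beta>::real). bounded_quad c \<delta> \<alpha> K \<xi> l \<Longrightarrow> 0 \<le> \<beta> \<Longrightarrow>
         (\<forall>a\<in>K. (\<Sum>b\<in>K. \<bar>B a b\<bar>) \<le> \<beta>) \<Longrightarrow> \<bar>bilinear_moment K \<xi> l B k\<bar> \<le> C * card K * \<beta>"
      using Suc by auto
    have "\<bar>2 * real m * bilinear_moment K \<xi> l B k\<bar> \<le> 2 * real m * (C * card K * \<beta>)"
      if "bounded_quad c \<delta> \<alpha> K \<xi> l" "0 \<le> \<beta>" "\<forall>a\<in>K. (\<Sum>b\<in>K. \<bar>B a b\<bar>) \<le> \<beta>"
      for \<alpha> and K :: "'i set" and \<xi> l B \<beta>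
      unfolding abs_mult using IH[OF that] by (intro mult_mono) auto
    then show ?thesis using C
      by (intro exI[of _ "2 * real m * C"]) (auto simp: Suc mult.assoc)
  qed (auto intro!: exI[of _ 0])
  then obtain C :: real where C: "C \<ge> 0" and
    bC: "\<And>\<alpha> (K :: 'i set) \<xi> l B (\<beta>::real). bounded_quad c \<delta> \<alpha> K \<xi> l \<Longrightarrow> 0 \<le> \<beta> \<Longrightarrow>
     (\<forall>a\<in>K. (\<Sum>b\<in>K. \<bar>B a b\<bar>) \<le> \<beta>) \<Longrightarrow>
     \<bar>2 * real m * bilinear_moment K \<xi> l B (m - 1)\<bar> \<le> C * card K * \<beta>" by blast
  have bb: "\<bar>bilinear_moment K \<xi> l B m\<bar> \<le> (\<delta> * E + C * \<delta>) * card K * \<beta>"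
    if ad: "bounded_quad c \<delta> \<alpha> K \<xi> l" and \<beta>: "0 \<le> \<beta>" "\<forall>a\<in>K. (\<Sum>b\<in>K. \<bar>B a b\<bar>) \<le> \<beta>"
    for \<alpha> and K :: "'i set" and \<xi> l B \<beta>
  proof -
    have fin: "finite K" "\<And>a. a \<in> K \<Longrightarrow> \<xi> a \<in> L" and al: "0 \<le> \<alpha>" "\<alpha> \<le> 1"
      using ad by (auto simp: bounded_quad_def)
    have gr: "\<bar>gram \<xi> a b\<bar> \<le> \<delta>" if "a \<in> K" "b \<in> K" for a b
    proof -
      have "\<bar>gram \<xi> a b\<bar> \<le> (\<Sum>b\<in>K. \<bar>gram \<xi> a b\<bar>)"
        using that fin by (intro member_le_sum) auto
      then show ?thesis using ad that by (auto simp: bounded_quad_def)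
    qed
    have "\<bar>\<Sum>a\<in>K. \<Sum>b\<in>K. B a b * gram \<xi> a b\<bar> \<le> (\<Sum>a\<in>K. \<Sum>b\<in>K. \<bar>B a b\<bar> * \<delta>)"
      by (intro order_trans[OF sum_abs] sum_mono) (auto simp: abs_mult intro!: mult_left_mono gr)
    also have "\<dots> \<le> (\<Sum>a\<in>K. \<beta> * \<delta>)"
      unfolding sum_distrib_right[symmetric] using \<beta> assms by (intro sum_mono mult_right_mono) auto
    finally have "\<bar>\<Sum>a\<in>K. \<Sum>b\<in>K. B a b * gram \<xi> a b\<bar> \<le> card K * (\<beta> * \<delta>)" by simp
    then have 1: "\<bar>(\<Sum>a\<in>K. \<Sum>b\<in>K. B a b * gram \<xi> a b) * quad_moment K \<xi> l m\<bar> \<le> card K * (\<beta> * \<delta>) * E"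
      unfolding abs_mult using bE[OF ad] \<beta> assms E by (intro mult_mono) auto
    have "\<bar>2 * real m * bilinear_moment K \<xi> l (\<lambda>a c. \<Sum>b\<in>K. B a b * gram \<xi> b c * l c) (m - 1)\<bar>
       \<le> C * card K * (\<beta> * \<delta> * \<alpha>)"
      using row_sum_product[OF ad, of B \<beta>] \<beta> al assms by (intro bC[OF ad]) auto
    also have "\<dots> \<le> C * card K * (\<beta> * \<delta> * 1)"
      using al C \<beta> assms by (intro mult_left_mono) auto
    finally have 2: "\<bar>2 * real m * bilinear_moment K \<xi> l (\<lambda>a c. \<Sum>b\<in>K. B a b * gram \<xi> b c * l c) (m - 1)\<bar>
       \<le> C * card K * (\<beta> * \<delta>)" by simp
    have "\<bar>bilinear_moment K \<xi> l B m\<bar> \<le> card K * (\<beta> * \<delta>) * E + C * card K * (\<beta> * \<delta>)"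
      by (subst bilinear_moment_recursion[OF fin]) (use 1 2 in linarith)+
    also have "\<dots> = (\<delta> * E + C * \<delta>) * card K * \<beta>" by (simp add: algebra_simps)
    finally show ?thesis .
  qed
  show ?case
  proof (intro exI[of _ "E + (\<delta> * E + C * \<delta>)"] conjI allI impI)
    show "0 \<le> E + (\<delta> * E + C * \<delta>)" using E C assms by auto
  next
    fix \<alpha> and K :: "'i set" and \<xi> l assume ad: "bounded_quad c \<delta> \<alpha> K \<xi> l"
    show "\<bar>quad_moment K \<xi> l m\<bar> \<le> E + (\<delta> * E + C * \<delta>)" using bE[OF ad] E C assms
      by (intro order_trans[OF bE[OF ad]]) auto
    fix B \<beta> assume \<beta>: "0 \<le> (\<beta>::real)" "\<forall>a\<in>K. (\<Sum>b\<in>K. \<bar>B a b\<bar>) \<le> \<beta>"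
    have "(\<delta> * E + C * \<delta>) * card K * \<beta> \<le> (E + (\<delta> * E + C * \<delta>)) * card K * \<beta>"
      using E C \<beta> by (intro mult_right_mono) auto
    then show "\<bar>bilinear_moment K \<xi> l B m\<bar> \<le> (E + (\<delta> * E + C * \<delta>)) * card K * \<beta>"
      using bb[OF ad \<beta>] by linarith
  qed
qed

text \<open>
  Applying the recursion twice, the main term is the trace of \<open>\<Lambda> D \<Lambda> D\<close>, which is half the
  variance. The remainder involves the matrix \<open>\<Lambda> D \<Lambda> D \<Lambda>\<close> with row sums of order \<open>\<alpha>\<^sup>3\<close>, and
  is therefore of order \<open>\<alpha>\<^sup>3 card K\<close>, hence of order \<open>\<alpha>\<close>.
\<close>

lemma quad_moment_approx_recursion:
  assumes "0 \<le> c" "0 \<le> \<delta>"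
  shows "\<exists>C\<ge>0. \<forall>\<alpha> (K :: 'i set) \<xi> l. bounded_quad c \<delta> \<alpha> K \<xi> l \<longrightarrow>
     \<bar>quad_moment K \<xi> l (Suc (Suc m)) - real (Suc m) * quad_moment K \<xi> l 2 * quad_moment K \<xi> l m\<bar> \<le> C * \<alpha>"
proof -
  from quad_moments_bounded[OF assms, where 'i='i and m="m - 1"] obtain C :: real where C: "C \<ge> 0" and
    bC: "\<And>\<alpha> (K :: 'i set) \<xi> l B (\<beta>::real). bounded_quad c \<delta> \<alpha> K \<xi> l \<Longrightarrow> 0 \<le> \<beta> \<Longrightarrow>
     (\<forall>a\<in>K. (\<Sum>b\<in>K. \<bar>B a b\<bar>) \<le> \<beta>) \<Longrightarrow> \<bar>bilinear_moment K \<xi> l B (m - 1)\<bar> \<le> C * card K * \<beta>"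
    by auto
  show ?thesis
  proof (intro exI[of _ "2 * real (Suc m) * (2 * real m) * (C * c * \<delta>\<^sup>2)"] conjI allI impI)
    show "0 \<le> 2 * real (Suc m) * (2 * real m) * (C * c * \<delta>\<^sup>2)" using C assms by auto
    fix \<alpha> and K :: "'i set" and \<xi> l assume ad: "bounded_quad c \<delta> \<alpha> K \<xi> l"
    have fin: "finite K" "\<And>a. a \<in> K \<Longrightarrow> \<xi> a \<in> L" and al: "0 \<le> \<alpha>" "\<alpha> \<le> 1" "\<alpha>\<^sup>2 * card K \<le> c"
      using ad by (auto simp: bounded_quad_def)
    define B where "B = (\<lambda>a c. l a * gram \<xi> a c * l c)"
    define B' where "B' = (\<lambda>a c. \<Sum>b\<in>K. B a b * gram \<xi> b c * l c)"
    define tr where "tr = (\<Sum>a\<in>K. \<Sum>b\<in>K. B a b * gram \<xi> a b)"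
    have two: "quad_moment K \<xi> l 2 = 2 * tr"
      using quad_moment_Suc[OF fin, where l=l and m=1] bilinear_moment_recursion[OF fin, where l=l and B=B and m=0]
      by (simp add: B_def[symmetric] tr_def prob_space numeral_2_eq_2)
    have eq: "quad_moment K \<xi> l (Suc (Suc m)) = 2 * real (Suc m) * (tr * quad_moment K \<xi> l m
        + 2 * real m * bilinear_moment K \<xi> l B' (m - 1))"
      using quad_moment_Suc[OF fin, where l=l and m="Suc m"] bilinear_moment_recursion[OF fin, where l=l and B=B and m=m]
      by (simp add: B_def[symmetric] B'_def[symmetric] tr_def)
    have "\<bar>bilinear_moment K \<xi> l B' (m - 1)\<bar> \<le> C * card K * ((\<alpha>\<^sup>2 * \<delta>) * \<delta> * \<alpha>)"
      unfolding B'_def using assms al row_sum_weighted_gram[OF ad]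
      by (intro bC[OF ad] ballI row_sum_product[OF ad]) (auto simp: B_def)
    also have "\<dots> = (C * \<delta>\<^sup>2 * \<alpha>) * (\<alpha>\<^sup>2 * card K)" by (simp add: power2_eq_square)
    also have "\<dots> \<le> (C * \<delta>\<^sup>2 * \<alpha>) * c" using al C assms by (intro mult_left_mono) auto
    finally have "\<bar>bilinear_moment K \<xi> l B' (m - 1)\<bar> \<le> (C * c * \<delta>\<^sup>2) * \<alpha>" by (simp add: mult_ac)
    then have "2 * real (Suc m) * (2 * real m) * \<bar>bilinear_moment K \<xi> l B' (m - 1)\<bar>
        \<le> 2 * real (Suc m) * (2 * real m) * ((C * c * \<delta>\<^sup>2) * \<alpha>)"
      by (intro mult_left_mono) auto
    moreover have "quad_moment K \<xi> l (Suc (Suc m)) - real (Suc m) * quad_moment K \<xi> l 2 * quad_moment K \<xi> l m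
       = 2 * real (Suc m) * (2 * real m) * bilinear_moment K \<xi> l B' (m - 1)"
      unfolding eq two by (simp add: algebra_simps)
    ultimately show "\<bar>quad_moment K \<xi> l (Suc (Suc m)) - real (Suc m) * quad_moment K \<xi> l 2 * quad_moment K \<xi> l m\<bar>
       \<le> 2 * real (Suc m) * (2 * real m) * (C * c * \<delta>\<^sup>2) * \<alpha>"
      by (simp add: abs_mult mult_ac)
  qed
qed

lemma quad_moments_tendsto:
  fixes K :: "nat \<Rightarrow> 'i set"
  assumes "\<And>n. bounded_quad c \<delta> (\<alpha> n) (K n) (\<xi> n) (l n)" "\<alpha> \<longlonglongrightarrow> 0" "0 \<le> v"
    and v: "(\<lambda>n. quad_moment (K n) (\<xi> n) (l n) 2) \<longlonglongrightarrow> v"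
  shows "(\<lambda>n. quad_moment (K n) (\<xi> n) (l n) k) \<longlonglongrightarrow> gauss_moment k * sqrt v ^ k"
proof (induction k rule: less_induct)
  case (less k)
  have fin: "finite (K n)" "\<And>a. a \<in> K n \<Longrightarrow> \<xi> n a \<in> L" and pos: "0 \<le> \<delta>" "0 \<le> c" for n
    using assms(1)[of n] by (auto simp: bounded_quad_def intro: order_trans[rotated])
  consider "k = 0" | "k = 1" | m where "k = Suc (Suc m)" by (metis One_nat_def not0_implies_Suc)
  then show ?case
  proof cases
    case 1
    then show ?thesis by (simp add: prob_space)
  next
    case 2
    then show ?thesis using quad_moment_Suc[OF fin, where m=0] by simp
  next
    case 3
    obtain C where C: "\<And>\<alpha> (K :: 'i set) \<xi> l. bounded_quad c \<delta> \<alpha> K \<xi> l \<Longrightarrow>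
     \<bar>quad_moment K \<xi> l (Suc (Suc m)) - real (Suc m) * quad_moment K \<xi> l 2 * quad_moment K \<xi> l m\<bar> \<le> C * \<alpha>"
      using quad_moment_approx_recursion[OF pos(2,1), where 'i='i and m=m] by blast
    have "(\<lambda>n. quad_moment (K n) (\<xi> n) (l n) (Suc (Suc m)) -
       real (Suc m) * quad_moment (K n) (\<xi> n) (l n) 2 * quad_moment (K n) (\<xi> n) (l n) m) \<longlonglongrightarrow> 0"
      by (rule Lim_null_comparison[of _ "\<lambda>n. C * \<alpha> n"])
         (use C[OF assms(1)] assms(2) in \<open>auto intro!: tendsto_eq_intros\<close>)
    moreover have "(\<lambda>n. real (Suc m) * quad_moment (K n) (\<xi> n) (l n) 2 * quad_moment (K n) (\<xi> n) (l n) m)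
        \<longlonglongrightarrow> real (Suc m) * v * (gauss_moment m * sqrt v ^ m)"
      by (intro tendsto_intros v less.IH) (simp add: 3)
    ultimately have "(\<lambda>n. quad_moment (K n) (\<xi> n) (l n) (Suc (Suc m)))
        \<longlonglongrightarrow> real (Suc m) * v * (gauss_moment m * sqrt v ^ m)"
      using tendsto_add by fastforce
    moreover have "real (Suc m) * v * (gauss_moment m * sqrt v ^ m) = gauss_moment k * sqrt v ^ k"
      unfolding 3 gauss_moment_Suc_Suc using assms(3) by simp
    ultimately have "(\<lambda>n. quad_moment (K n) (\<xi> n) (l n) (Suc (Suc m))) \<longlonglongrightarrow> gauss_moment k * sqrt v ^ k"
      by (simp only:)
    then show ?thesis by (simp only: 3)
  qed
qed

end

context gaussian_space begin

lemma quad_one: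
  assumes "finite K" "\<And>a. a \<in> K \<Longrightarrow> \<xi> a \<in> L"
  shows "quad K \<xi> (\<lambda>_. 1) w = (\<Sum>a\<in>K. (\<xi> a w)\<^sup>2) - expectation (\<lambda>w. \<Sum>a\<in>K. (\<xi> a w)\<^sup>2)"
proof -
  have "expectation (\<lambda>w. \<Sum>a\<in>K. (\<xi> a w)\<^sup>2) = (\<Sum>a\<in>K. expectation (\<lambda>w. (\<xi> a w)\<^sup>2))"
    by (intro Bochner_Integration.integral_sum integrable_moments all_moments_power L_all_moments assms finite_M)
  then show ?thesis by (simp add: quad_def sum_subtractf)
qed

text \<open>
  For one summand on each side this is \<open>Cov(\<xi>\<^sup>2, \<eta>\<^sup>2) = 2 Cov(\<xi>, \<eta>)\<^sup>2\<close>, the moment recursion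
  for the first power.
\<close>

lemma covariance_sum_squares:
  assumes "finite I" "\<And>a. a \<in> I \<Longrightarrow> \<xi> a \<in> L" "finite J" "\<And>b. b \<in> J \<Longrightarrow> \<eta> b \<in> L"
  shows "covariance M (\<lambda>w. \<Sum>a\<in>I. (\<xi> a w)\<^sup>2) (\<lambda>w. \<Sum>b\<in>J. (\<eta> b w)\<^sup>2)
     = 2 * (\<Sum>a\<in>I. \<Sum>b\<in>J. (expectation (\<lambda>w. \<xi> a w * \<eta> b w))\<^sup>2)"
proof -
  define W where "W = quad J \<eta> (\<lambda>_. 1)"
  have mom: "W \<in> all_moments M" "\<And>a. a \<in> I \<Longrightarrow> \<xi> a \<in> all_moments M"
    using assms by (auto simp: W_def intro: L_all_moments quad_all_moments)
  note mI = integrable_moments all_moments_closure all_moments_cmult mom finite_M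
  have EW: "expectation W = 0"
    using quad_moment_Suc[OF assms(3,4), where l="\<lambda>_. 1" and m=0] by (simp add: W_def)
  have "covariance M (\<lambda>w. \<Sum>a\<in>I. (\<xi> a w)\<^sup>2) (\<lambda>w. \<Sum>b\<in>J. (\<eta> b w)\<^sup>2)
     = expectation (\<lambda>w. quad I \<xi> (\<lambda>_. 1) w * W w)"
    unfolding covariance_def W_def using quad_one[OF assms(1,2)] quad_one[OF assms(3,4)] by simp
  also have "\<dots> = expectation (\<lambda>w. \<Sum>a\<in>I. \<xi> a w * \<xi> a w * W w - gram \<xi> a a * W w)"
    unfolding quad_def[of I] sum_distrib_right
    by (intro Bochner_Integration.integral_cong sum.cong refl) (simp add: power2_eq_square left_diff_distrib)
  also have "\<dots> = (\<Sum>a\<in>I. expectation (\<lambda>w. \<xi> a w * \<xi> a w * W w - gram \<xi> a a * W w))"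
    by (intro Bochner_Integration.integral_sum mI)
  also have "\<dots> = (\<Sum>a\<in>I. expectation (\<lambda>w. \<xi> a w * \<xi> a w * W w) - expectation (\<lambda>w. gram \<xi> a a * W w))"
    by (intro sum.cong refl Bochner_Integration.integral_diff mI) auto
  also have "\<dots> = (\<Sum>a\<in>I. 2 * (\<Sum>b\<in>J. (expectation (\<lambda>w. \<xi> a w * \<eta> b w))\<^sup>2))"
  proof (intro sum.cong refl)
    fix a assume a: "a \<in> I"
    show "expectation (\<lambda>w. \<xi> a w * \<xi> a w * W w) - expectation (\<lambda>w. gram \<xi> a a * W w)
      = 2 * (\<Sum>b\<in>J. (expectation (\<lambda>w. \<xi> a w * \<eta> b w))\<^sup>2)"
      using quad_moment_recursion[where \<xi>=\<eta> and K=J and l="\<lambda>_. 1" and m=1, OF assms(2)[OF a] assms(2)[OF a] assms(3,4)]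
      by (simp add: W_def[symmetric] EW power2_eq_square)
  qed
  finally show ?thesis by (simp add: sum_distrib_left)
qed

lemma expectation_diff2_product:
  assumes "x1 \<in> L" "x2 \<in> L" "x3 \<in> L" "y1 \<in> L" "y2 \<in> L" "y3 \<in> L"
  defines "e \<equiv> \<lambda>x y. expectation (\<lambda>w. x w * y w)"
  shows "expectation (\<lambda>w. (x1 w - 2 * x2 w + x3 w) * (y1 w - 2 * y2 w + y3 w))
     = e x1 y1 - 2 * e x1 y2 + e x1 y3 - 2 * e x2 y1 + 4 * e x2 y2 - 2 * e x2 y3
        + e x3 y1 - 2 * e x3 y2 + e x3 y3"
proof -
  have i: "integrable M (\<lambda>w. x w * y w)" if "x \<in> L" "y \<in> L" for x y
    using that by (intro integrable_moments all_moments_mult L_all_moments)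
  note [simp] = i[OF assms(1) assms(4)] i[OF assms(1) assms(5)] i[OF assms(1) assms(6)]
    i[OF assms(2) assms(4)] i[OF assms(2) assms(5)] i[OF assms(2) assms(6)]
    i[OF assms(3) assms(4)] i[OF assms(3) assms(5)] i[OF assms(3) assms(6)]
  have "expectation (\<lambda>w. (x1 w - 2 * x2 w + x3 w) * (y1 w - 2 * y2 w + y3 w))
    = expectation (\<lambda>w. x1 w * y1 w - 2 * (x1 w * y2 w) + x1 w * y3 w - 2 * (x2 w * y1 w)
       + 4 * (x2 w * y2 w) - 2 * (x2 w * y3 w) + x3 w * y1 w - 2 * (x3 w * y2 w) + x3 w * y3 w)"
    by (simp add: algebra_simps)
  then show ?thesis by (simp add: e_def)
qed

end

section \<open>Convergence to a normal law by moments\<close>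

text \<open>
  The method of moments for a normal limit. Taylor's formula for the characteristic function
  up to order \<open>2p\<close> has a remainder controlled by the moment of order \<open>2p\<close>; for normal
  moments the remainder is a term of an exponential series and tends to \<open>0\<close> as \<open>p\<close> grows.
  This works for \<open>v = 0\<close> as well.
\<close>

lemma (in prob_space) char_tendsto_normal_law:
  assumes X: "\<And>n. X n \<in> all_moments M" and v: "0 \<le> v"
    and lim: "\<And>k. (\<lambda>n. expectation (\<lambda>w. X n w ^ k)) \<longlonglongrightarrow> gauss_moment k * sqrt v ^ k"
  shows "(\<lambda>n. char (distr M borel (X n)) t) \<longlonglongrightarrow> char (normal_law 0 v) t"
proof -
  define s where "s = (t * sqrt v)\<^sup>2 / 2"
  define S where "S n p = (\<Sum>k\<le>2 * p. ((\<i> * t)^k / fact k) * complex_of_real (expectation (\<lambda>w. X n w ^ k)))" for n p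
  define S' where "S' p = (\<Sum>k\<le>2 * p. ((\<i> * t)^k / fact k) * complex_of_real (gauss_moment k * sqrt v ^ k))" for p
  interpret N: real_distribution "normal_law 0 v" by (rule real_distribution_normal_law[OF v])
  have mom: "(LINT x|normal_law 0 v. x ^ k) = gauss_moment k * sqrt v ^ k"
    "integrable (normal_law 0 v) (\<lambda>x. x ^ k)" for k
    using normal_law_moments[OF v, of k] by (auto simp: has_bochner_integral_iff)
  have remainder: "(2 * \<bar>t\<bar> ^ (2 * p) / fact (2 * p)) * (gauss_moment (2 * p) * sqrt v ^ (2 * p)) = 2 * (s ^ p / fact p)" for p
  proof -
    have "\<bar>t\<bar> ^ (2 * p) * sqrt v ^ (2 * p) = (2 * s) ^ p"
      by (simp add: power_mult s_def power_mult_distrib)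
    moreover have "(2 * \<bar>t\<bar> ^ (2 * p) / fact (2 * p)) * (gauss_moment (2 * p) * sqrt v ^ (2 * p))
      = 2 * (\<bar>t\<bar> ^ (2 * p) * sqrt v ^ (2 * p)) / (2 ^ p * fact p)"
      by (simp add: gauss_moment_def field_simps)
    ultimately show ?thesis by (simp add: power_mult_distrib)
  qed
  have N_bd: "cmod (char (normal_law 0 v) t - S' p) \<le> 2 * (s ^ p / fact p)" for p
    using N.char_approx1[of "2 * p" t] unfolding S'_def mom(1)[symmetric] remainder[symmetric]
    by (simp add: mom power_even_abs)
  have X_bd: "cmod (char (distr M borel (X n)) t - S n p) \<le>
     (2 * \<bar>t\<bar> ^ (2 * p) / fact (2 * p)) * expectation (\<lambda>w. X n w ^ (2 * p))" for n p
    using char_approx1'[of "2 * p" "X n" _ t] X[of n] unfolding S_def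
    by (simp add: all_moments_def power_even_abs)
  have S_lim: "(\<lambda>n. S n p) \<longlonglongrightarrow> S' p" for p
    unfolding S_def S'_def by (intro tendsto_sum tendsto_mult tendsto_const tendsto_of_real lim)
  have small: "(\<lambda>p. s ^ p / fact p) \<longlonglongrightarrow> 0"
    using summable_LIMSEQ_zero[OF summable_exp[of s]] by (auto simp: inverse_eq_divide)
  show ?thesis
  proof (rule LIMSEQ_I)
    fix r :: real assume r: "0 < r"
    have "\<forall>\<^sub>F p in sequentially. s ^ p / fact p < r / 8"
      by (rule order_tendstoD(2)[OF small]) (use r in auto)
    then obtain p where p: "s ^ p / fact p < r / 8" by (auto simp: eventually_sequentially)
    have e1: "\<forall>\<^sub>F n in sequentially. cmod (S n p - S' p) < r / 4"
      using tendstoD[OF S_lim[of p], of "r / 4"] r by (simp add: dist_norm)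
    have "(\<lambda>n. (2 * \<bar>t\<bar> ^ (2 * p) / fact (2 * p)) * expectation (\<lambda>w. X n w ^ (2 * p))) \<longlonglongrightarrow> 2 * (s ^ p / fact p)"
      unfolding remainder[symmetric] by (intro tendsto_intros lim)
    then have e2: "\<forall>\<^sub>F n in sequentially.
       (2 * \<bar>t\<bar> ^ (2 * p) / fact (2 * p)) * expectation (\<lambda>w. X n w ^ (2 * p)) < r / 4"
      using p by (elim order_tendstoD(2)) linarith
    from eventually_conj[OF e1 e2] obtain n0 where n0: "\<And>n. n \<ge> n0 \<Longrightarrow> cmod (S n p - S' p) < r / 4 \<and>
       (2 * \<bar>t\<bar> ^ (2 * p) / fact (2 * p)) * expectation (\<lambda>w. X n w ^ (2 * p)) < r / 4"
      by (auto simp: eventually_sequentially)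
    show "\<exists>no. \<forall>n\<ge>no. norm (char (distr M borel (X n)) t - char (normal_law 0 v) t) < r"
    proof (intro exI[of _ n0] allI impI)
      fix n assume "n0 \<le> n"
      note n0 = n0[OF this]
      have eq: "char (distr M borel (X n)) t - char (normal_law 0 v) t =
        ((char (distr M borel (X n)) t - S n p) + (S n p - S' p)) - (char (normal_law 0 v) t - S' p)" by simp
      have "cmod (char (distr M borel (X n)) t - char (normal_law 0 v) t) \<le>
        cmod (char (distr M borel (X n)) t - S n p) + cmod (S n p - S' p) + cmod (char (normal_law 0 v) t - S' p)"
        unfolding eq by (intro order_trans[OF norm_triangle_ineq4] add_right_mono norm_triangle_ineq)
      then show "norm (char (distr M borel (X n)) t - char (normal_law 0 v) t) < r"
        using r n0[THEN conjunct1] n0[THEN conjunct2] X_bd[of n p] N_bd[of p] p by linarith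
    qed
  qed
qed

text \<open>
  The sum of the variables has finite expectation and is therefore almost surely finite.
\<close>

lemma (in prob_space) AE_tendsto_0_of_summable_expectation:
  assumes "\<And>n. integrable M (Z n)" "\<And>n w. 0 \<le> Z n w" "summable b" "\<And>n. expectation (Z n) \<le> b n"
  shows "AE w in M. (\<lambda>n. Z n w :: real) \<longlonglongrightarrow> 0"
proof -
  have [measurable]: "Z n \<in> borel_measurable M" for n using assms(1) by auto
  have b0: "0 \<le> b n" for n by (rule order_trans[OF _ assms(4)]) (simp add: assms(2))
  have "(\<integral>\<^sup>+w. (\<Sum>n. ennreal (Z n w)) \<partial>M) = (\<Sum>n. \<integral>\<^sup>+w. ennreal (Z n w) \<partial>M)"
    by (rule nn_integral_suminf) measurable
  also have "\<dots> = (\<Sum>n. ennreal (expectation (Z n)))"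
    by (intro arg_cong[of _ _ suminf] ext nn_integral_eq_integral assms(1)) (auto simp: assms(2))
  also have "\<dots> \<le> (\<Sum>n. ennreal (b n))"
    by (intro suminf_le ennreal_leI assms(4)) auto
  also have "\<dots> = ennreal (suminf b)"
    using suminf_ennreal2[OF b0 assms(3)] .
  finally have "(\<integral>\<^sup>+w. (\<Sum>n. ennreal (Z n w)) \<partial>M) \<noteq> \<infinity>"
    by (auto simp: top_unique)
  then have "AE w in M. (\<Sum>n. ennreal (Z n w)) \<noteq> \<infinity>"
    by (intro nn_integral_noteq_infinite) measurable
  then show ?thesis
  proof eventually_elim
    case (elim w)
    have "summable (\<lambda>n. Z n w)"
      by (rule summable_suminf_not_top) (use elim assms(2) in auto)
    then show ?case by (rule summable_LIMSEQ_zero)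
  qed
qed

text \<open>
  Slutsky's lemma in the form needed for the delta method.
\<close>

lemma (in prob_space) weak_conv_of_char_and_AE_diff:
  assumes [measurable]: "\<And>n. Y n \<in> borel_measurable M" "\<And>n. W n \<in> borel_measurable M"
    and diff: "AE w in M. (\<lambda>n. Y n w - W n w) \<longlonglongrightarrow> 0"
    and N: "real_distribution N"
    and char: "\<And>t. (\<lambda>n. char (distr M borel (W n)) t) \<longlonglongrightarrow> char N t"
  shows "weak_conv_m (\<lambda>n. distr M borel (Y n)) N"
proof (rule levy_continuity)
  show "real_distribution (distr M borel (Y n))" for n
    by (intro real_distribution_distr) measurable
  fix t
  have ch: "char (distr M borel (V :: 'a \<Rightarrow> real)) t = (CLINT w|M. iexp (t * V w))" if "V \<in> borel_measurable M" for V
    unfolding char_def by (rule integral_distr) (use that in auto)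
  have "(\<lambda>n. CLINT w|M. iexp (t * Y n w) - iexp (t * W n w)) \<longlonglongrightarrow> (CLINT w|M. 0)"
  proof (rule integral_dominated_convergence[where w="\<lambda>_. 2"])
    show "AE w in M. (\<lambda>n. iexp (t * Y n w) - iexp (t * W n w)) \<longlonglongrightarrow> 0"
      using diff
    proof eventually_elim
      case (elim w)
      show ?case
      proof (rule Lim_null_comparison)
        show "\<forall>\<^sub>F n in sequentially. norm (iexp (t * Y n w) - iexp (t * W n w)) \<le> \<bar>t\<bar> * \<bar>Y n w - W n w\<bar>"
        proof (intro always_eventually allI)
          fix n
          have "iexp (t * Y n w) - iexp (t * W n w) = iexp (t * W n w) * (iexp (t * (Y n w - W n w)) - 1)"
            by (simp add: algebra_simps exp_diff)
          then have "norm (iexp (t * Y n w) - iexp (t * W n w)) = norm (iexp (t * (Y n w - W n w)) - 1)"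
            by (simp add: norm_mult)
          also have "\<dots> \<le> \<bar>t * (Y n w - W n w)\<bar>" using iexp_approx1[of "t * (Y n w - W n w)" 0] by simp
          finally show "norm (iexp (t * Y n w) - iexp (t * W n w)) \<le> \<bar>t\<bar> * \<bar>Y n w - W n w\<bar>"
            by (simp add: abs_mult)
        qed
        show "(\<lambda>n. \<bar>t\<bar> * \<bar>Y n w - W n w\<bar>) \<longlonglongrightarrow> 0"
          using tendsto_mult_right_zero[OF tendsto_rabs_zero[OF elim]] .
      qed
    qed
    show "AE w in M. norm (iexp (t * Y n w) - iexp (t * W n w)) \<le> 2" for n
      by (intro AE_I2 order_trans[OF norm_triangle_ineq4]) simp
  qed auto
  moreover have "(CLINT w|M. iexp (t * Y n w) - iexp (t * W n w))
     = char (distr M borel (Y n)) t - char (distr M borel (W n)) t" for n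
    by (simp add: ch) (intro Bochner_Integration.integral_diff integrable_iexp; measurable)
  ultimately have "(\<lambda>n. char (distr M borel (Y n)) t - char (distr M borel (W n)) t) \<longlonglongrightarrow> 0" by simp
  from tendsto_add[OF this char[of t]] show "(\<lambda>n. char (distr M borel (Y n)) t) \<longlonglongrightarrow> char N t" by simp
qed (rule N)

section \<open>Finite differences and the decay of the correlations\<close>

primrec forward_diff :: "real \<Rightarrow> nat \<Rightarrow> (real \<Rightarrow> real) \<Rightarrow> real \<Rightarrow> real" where
  "forward_diff h 0 f x = f x"
| "forward_diff h (Suc n) f x = forward_diff h n f (x + h) - forward_diff h n f x"

lemma forward_diff_has_derivative:
  assumes "\<And>y. 0 < y \<Longrightarrow> (f has_real_derivative f' y) (at y)" "0 < x" "0 \<le> h"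
  shows "(forward_diff h n f has_real_derivative forward_diff h n f' x) (at x)"
  using assms(2)
proof (induction n arbitrary: x)
  case 0
  then show ?case using assms(1) by (simp add: fun_eq_iff[symmetric])
next
  case (Suc n)
  have 1: "(forward_diff h n f has_real_derivative forward_diff h n f' (x + h)) (at (x + h))"
    using Suc assms(3) by (intro Suc.IH) auto
  have "((\<lambda>x. forward_diff h n f (x + h)) has_real_derivative forward_diff h n f' (x + h)) (at x)"
    using DERIV_shift[THEN iffD1, OF 1] by simp
  from DERIV_diff[OF this Suc.IH[OF Suc.prems]] show ?case by simp
qed

text \<open>
  By the mean value theorem one difference may be traded for one derivative; the
  intermediate point only moves to the right.
\<close>

lemma forward_diff_mean_value:
  assumes "\<And>k y. k < n \<Longrightarrow> 0 < y \<Longrightarrow> (F k has_real_derivative F (Suc k) y) (at y)" "0 < x" "0 < h"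
  shows "\<exists>z\<ge>x. forward_diff h n (F 0) x = h ^ n * F n z"
  using assms(1,2)
proof (induction n arbitrary: F x)
  case 0
  then show ?case by auto
next
  case (Suc n)
  have "(forward_diff h n (F 0) has_real_derivative forward_diff h n (F 1) y) (at y)" if "0 < y" for y
    using Suc.prems(1)[of 0] that assms(3) by (intro forward_diff_has_derivative) auto
  then obtain z where z: "x < z" "forward_diff h n (F 0) (x + h) - forward_diff h n (F 0) x = h * forward_diff h n (F 1) z"
    using MVT2[of x "x + h" "forward_diff h n (F 0)" "forward_diff h n (F 1)"] Suc.prems(2) assms(3)
    by (smt (verit, best))
  have "\<exists>z'\<ge>z. forward_diff h n (F (Suc 0)) z = h ^ n * F (Suc n) z'"
    using Suc.IH[of "\<lambda>k. F (Suc k)" z] Suc.prems z by auto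
  then obtain z' where "z' \<ge> z" "forward_diff h n (F 1) z = h ^ n * F (Suc n) z'" by auto
  then show ?case using z by (intro exI[of _ z']) auto
qed

lemma forward_diff_powr_mean_value:
  fixes a :: real
  assumes "0 < x" "0 < h"
  shows "\<exists>z\<ge>x. forward_diff h n (\<lambda>y. y powr a) x = h ^ n * ((\<Prod>i<n. a - real i) * z powr (a - real n))"
proof -
  define F where "F k y = (\<Prod>i<k. a - real i) * y powr (a - real k)" for k y
  have "(F k has_real_derivative F (Suc k) y) (at y)" if "0 < y" for k y
    unfolding F_def using that
    by (auto intro!: derivative_eq_intros simp: algebra_simps)
  moreover have "F 0 = (\<lambda>y. y powr a)" by (simp add: F_def fun_eq_iff)
  ultimately show ?thesis using forward_diff_mean_value[of n F x h] assms by (simp add: F_def)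
qed

lemma rho_hat_eq_forward_diff:
  assumes "2 < x"
  shows "rho_hat H x = - forward_diff 1 4 (\<lambda>y. y powr (2 * H)) (x - 2) / 2"
  using assms by (simp add: rho_hat_def eval_nat_numeral algebra_simps)

lemma rho_hat_even: "rho_hat H (- x) = rho_hat H x"
proof -
  have "\<bar>- x - 2\<bar> = \<bar>x + 2\<bar>" "\<bar>- x + 2\<bar> = \<bar>x - 2\<bar>" "\<bar>- x - 1\<bar> = \<bar>x + 1\<bar>" "\<bar>- x + 1\<bar> = \<bar>x - 1\<bar>" by auto
  then show ?thesis by (simp add: rho_hat_def)
qed

text \<open>
  An increment on the coarse grid is a weighted sum, with weights \<open>1, 2, 1\<close>, of three
  consecutive increments on the fine grid. This reduces the covariances between the grids to
  those on the fine grid.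
\<close>

lemma rho_tilde_eq: "rho_tilde H x = rho_hat H (x + 1) + 2 * rho_hat H x + rho_hat H (x - 1)"
proof -
  have "x + 1 - 2 = x - 1" "x + 1 + 2 = x + 3" "x + 1 - 1 = x" "x + 1 + 1 = x + 2"
    "x - 1 - 2 = x - 3" "x - 1 + 2 = x + 1" "x - 1 - 1 = x - 2" "x - 1 + 1 = x" by auto
  then show ?thesis unfolding rho_hat_def rho_tilde_def by (simp add: field_simps)
qed

text \<open>
  The fourth derivative of \<open>x\<^sup>2\<^sup>H\<close> is in absolute value at most \<open>12 x\<^sup>2\<^sup>H\<^sup>-\<^sup>4\<close>, and
  \<open>2H - 4 < -2\<close>.
\<close>

lemma rho_hat_bound:
  assumes "0 < H" "H < 1" "3 \<le> x"
  shows "\<bar>rho_hat H x\<bar> \<le> 60 / (1 + x\<^sup>2)"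
proof -
  define a where "a = 2 * H"
  obtain z where z: "z \<ge> x - 2" "forward_diff 1 4 (\<lambda>y. y powr a) (x - 2) = (\<Prod>i<4. a - real i) * z powr (a - 4)"
    using forward_diff_powr_mean_value[of "x - 2" 1 4 a] assms by auto
  have "(\<Prod>i<4. a - real i) = a * (a - 1) * (a - 2) * (a - 3)"
    by (simp add: eval_nat_numeral)
  moreover have "\<bar>a\<bar> * \<bar>a - 1\<bar> * \<bar>a - 2\<bar> * \<bar>a - 3\<bar> \<le> 2 * 1 * 2 * 3"
    using assms by (intro mult_mono) (auto simp: a_def)
  ultimately have "\<bar>\<Prod>i<4. a - real i\<bar> \<le> 12" by (simp add: abs_mult)
  moreover have "z powr (a - 4) \<le> 1 / (x - 2)\<^sup>2"
  proof -
    have "z powr (a - 4) \<le> (x - 2) powr (a - 4)" using z assms by (intro powr_mono2') (auto simp: a_def)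
    also have "\<dots> \<le> (x - 2) powr (- 2)" using assms by (intro powr_mono) (auto simp: a_def)
    also have "\<dots> = 1 / (x - 2)\<^sup>2" using assms by (simp add: powr_minus powr_numeral inverse_eq_divide)
    finally show ?thesis .
  qed
  ultimately have "\<bar>forward_diff 1 4 (\<lambda>y. y powr a) (x - 2)\<bar> \<le> 12 * (1 / (x - 2)\<^sup>2)"
    unfolding z(2) abs_mult by (intro mult_mono) auto
  then have "\<bar>rho_hat H x\<bar> \<le> 6 * (1 / (x - 2)\<^sup>2)"
    using rho_hat_eq_forward_diff[of x H] assms by (simp add: a_def)
  (* For x >= 3 one has 10 (x - 2)^2 - (1 + x^2) = (9 x - 13) (x - 3) >= 0. *)
  also have "\<dots> \<le> 60 / (1 + x\<^sup>2)"
  proof -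
    have "0 \<le> (9 * x - 13) * (x - 3)" using assms by (intro mult_nonneg_nonneg) auto
    then have "1 + x\<^sup>2 \<le> 10 * (x - 2)\<^sup>2" by (simp add: power2_eq_square algebra_simps)
    moreover have "0 < 1 + x\<^sup>2" "0 < (x - 2)\<^sup>2" using assms by (auto simp: add_pos_nonneg)
    ultimately show ?thesis by (simp add: field_simps)
  qed
  finally show ?thesis .
qed

definition quad_decay :: "real \<Rightarrow> (int \<Rightarrow> real) \<Rightarrow> bool" where
  "quad_decay C g \<longleftrightarrow> (\<forall>m. \<bar>g m\<bar> \<le> C / (1 + (real_of_int m)\<^sup>2))"

lemma quad_decay_nonneg: "quad_decay C g \<Longrightarrow> 0 \<le> C"
  unfolding quad_decay_def by (drule spec[of _ 0]) auto

lemma rho_hat_decay: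
  assumes "0 < H" "H < 1"
  shows "\<exists>C. quad_decay C (\<lambda>m. rho_hat H (of_int m))"
proof -
  define C where "C = 60 + (\<Sum>m\<in>{-2..2::int}. \<bar>rho_hat H (of_int m)\<bar> * (1 + (real_of_int m)\<^sup>2))"
  have "\<bar>rho_hat H (of_int m)\<bar> \<le> C / (1 + (real_of_int m)\<^sup>2)" for m
  proof (cases "m \<in> {-2..2}")
    case True
    then have "\<bar>rho_hat H (of_int m)\<bar> * (1 + (real_of_int m)\<^sup>2) \<le> C - 60"
      unfolding C_def by (simp add: member_le_sum[of m "{-2..2::int}" "\<lambda>m. \<bar>rho_hat H (of_int m)\<bar> * (1 + (real_of_int m)\<^sup>2)"])
    then show ?thesis by (simp add: pos_le_divide_eq add_pos_nonneg)
  next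
    case False
    have C: "60 \<le> C" unfolding C_def by (simp add: sum_nonneg)
    have "\<bar>rho_hat H (real_of_int m)\<bar> = \<bar>rho_hat H \<bar>real_of_int m\<bar>\<bar>"
      using rho_hat_even[of H "real_of_int m"] by (simp add: abs_if)
    also have "\<dots> \<le> 60 / (1 + (real_of_int m)\<^sup>2)"
      using rho_hat_bound[OF assms, of "\<bar>real_of_int m\<bar>"] False by auto
    also have "\<dots> \<le> C / (1 + (real_of_int m)\<^sup>2)" using C by (intro divide_right_mono) auto
    finally show ?thesis .
  qed
  then show ?thesis by (auto simp: quad_decay_def)
qed

lemma quad_decay_add: "quad_decay C f \<Longrightarrow> quad_decay D g \<Longrightarrow> quad_decay (C + D) (\<lambda>m. f m + g m)"
  unfolding quad_decay_def add_divide_distrib by (meson abs_triangle_ineq add_mono order_trans)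

lemma quad_decay_cmult:
  assumes "quad_decay C f" shows "quad_decay (\<bar>c\<bar> * C) (\<lambda>m. c * f m)"
  unfolding quad_decay_def
proof
  fix m
  have "\<bar>c * f m\<bar> = \<bar>c\<bar> * \<bar>f m\<bar>" by (rule abs_mult)
  also have "\<dots> \<le> \<bar>c\<bar> * (C / (1 + (real_of_int m)\<^sup>2))"
    using assms by (intro mult_left_mono) (auto simp: quad_decay_def)
  finally show "\<bar>c * f m\<bar> \<le> \<bar>c\<bar> * C / (1 + (real_of_int m)\<^sup>2)" by simp
qed

lemma quad_decay_shift:
  assumes "quad_decay C f" "\<bar>i\<bar> \<le> 1" shows "quad_decay (3 * C) (\<lambda>m. f (m + i))"
  unfolding quad_decay_def
proof
  fix m
  have i: "i = -1 \<or> i = 0 \<or> i = 1" using assms(2) by auto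
  (* These squares complete 2 m^2 + 6 m + 5 and 2 m^2 - 6 m + 5, the differences of the two sides of
     the estimate for i = 1 and i = -1. *)
  have "0 \<le> (2 * real_of_int m + 3)\<^sup>2" "0 \<le> (2 * real_of_int m - 3)\<^sup>2" by auto
  then have le: "1 + (real_of_int m)\<^sup>2 \<le> 3 * (1 + (real_of_int (m + i))\<^sup>2)"
    using i by (auto simp: power2_eq_square algebra_simps)
  have "\<bar>f (m + i)\<bar> \<le> C / (1 + (real_of_int (m + i))\<^sup>2)"
    using assms(1) unfolding quad_decay_def by blast
  also have "\<dots> = 3 * C / (3 * (1 + (real_of_int (m + i))\<^sup>2))"
    by (rule mult_divide_mult_cancel_left[symmetric]) simp
  also have "\<dots> \<le> 3 * C / (1 + (real_of_int m)\<^sup>2)"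
    using le quad_decay_nonneg[OF assms(1)] by (intro divide_left_mono) (auto simp: add_pos_nonneg)
  finally show "\<bar>f (m + i)\<bar> \<le> 3 * C / (1 + (real_of_int m)\<^sup>2)" .
qed

lemma rho_tilde_decay:
  assumes "0 < H" "H < 1"
  shows "\<exists>C. quad_decay C (\<lambda>m. rho_tilde H (of_int m))"
proof -
  obtain C where C: "quad_decay C (\<lambda>m. rho_hat H (of_int m))" using rho_hat_decay[OF assms] by auto
  from quad_decay_add[OF quad_decay_add[OF quad_decay_shift[OF C, of 1] quad_decay_cmult[OF C, of 2]] quad_decay_shift[OF C, of "-1"]]
  show ?thesis unfolding rho_tilde_eq by auto
qed

section \<open>Sums along diagonals\<close>

text \<open>
  The bound telescopes, because \<open>1 + k\<^sup>2 \<ge> k (k + 1) / 2\<close>.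
\<close>

lemma sum_inverse_square_nat: "(\<Sum>k=1..n. 1 / (1 + (real k)\<^sup>2)) \<le> 2 - 2 / (real n + 1)"
proof (induction n)
  case (Suc n)
  have "1 / (1 + (real (Suc n))\<^sup>2) \<le> 2 / ((real n + 1) * (real n + 2))"
    by (simp add: field_simps power2_eq_square add_pos_nonneg)
  also have "\<dots> = 2 / (real n + 1) - 2 / (real (Suc n) + 1)" by (simp add: field_simps)
  finally show ?case using Suc by simp
qed simp

lemma sum_inverse_square:
  assumes "finite F" shows "(\<Sum>m\<in>F. 1 / (1 + (real_of_int m)\<^sup>2)) \<le> 5"
proof -
  define w where "w m = 1 / (1 + (real_of_int m)\<^sup>2)" for m
  have w0: "0 \<le> w m" for m by (simp add: w_def)
  obtain N :: nat where N: "F \<subseteq> {- int N..int N}"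
  proof -
    define N where "N = (\<Sum>m\<in>F. nat \<bar>m\<bar>)"
    have "nat \<bar>m\<bar> \<le> N" if "m \<in> F" for m using assms that by (auto simp: N_def intro: member_le_sum)
    then show ?thesis by (intro that[of N]) force
  qed
  have nat: "(\<Sum>k=1..N. w (int k)) \<le> 2"
    using sum_inverse_square_nat[of N] by (simp add: w_def) (smt (verit) divide_nonneg_nonneg of_nat_0_le_iff)
  have "(\<Sum>m\<in>F. w m) \<le> (\<Sum>m\<in>{- int N..int N}. w m)" using N w0 by (intro sum_mono2) auto
  also have "{- int N..int N} = insert 0 (int ` {1..N} \<union> (\<lambda>k. - int k) ` {1..N})"
  proof (intro set_eqI iffI)
    fix m assume m: "m \<in> {- int N..int N}"
    consider "m = 0" | "m > 0" | "m < 0" by linarith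
    then show "m \<in> insert 0 (int ` {1..N} \<union> (\<lambda>k. - int k) ` {1..N})"
    proof cases
      case 2 then have "m = int (nat m)" "nat m \<in> {1..N}" using m by auto
      then show ?thesis by blast
    next
      case 3 then have "m = - int (nat (- m))" "nat (- m) \<in> {1..N}" using m by auto
      then show ?thesis by blast
    qed simp
  qed auto
  also have "(\<Sum>m\<in>insert 0 (int ` {1..N} \<union> (\<lambda>k. - int k) ` {1..N}). w m) =
     w 0 + ((\<Sum>m\<in>int ` {1..N}. w m) + (\<Sum>m\<in>(\<lambda>k. - int k) ` {1..N}. w m))"
    by (subst sum.insert) (auto intro!: sum.union_disjoint)
  also have "\<dots> = w 0 + ((\<Sum>k=1..N. w (int k)) + (\<Sum>k=1..N. w (- int k)))"
    by (subst (1 2) sum.reindex) (auto simp: inj_on_def)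
  also have "(\<Sum>k=1..N. w (- int k)) = (\<Sum>k=1..N. w (int k))" by (simp add: w_def)
  also have "w 0 + ((\<Sum>k=1..N. w (int k)) + (\<Sum>k=1..N. w (int k))) \<le> 5"
    using nat by (simp add: w_def)
  finally show ?thesis by (simp add: w_def)
qed

text \<open>
  Injective images of any finite index set are sums over distinct integers; this covers rows
  and columns of all covariance matrices.
\<close>

lemma quad_decay_sum:
  assumes "quad_decay C g" "finite J" "inj_on \<phi> J"
  shows "(\<Sum>j\<in>J. \<bar>g (\<phi> j)\<bar>) \<le> 5 * C"
proof -
  have "(\<Sum>j\<in>J. \<bar>g (\<phi> j)\<bar>) = (\<Sum>m\<in>\<phi> ` J. \<bar>g m\<bar>)"
    using assms(3) by (simp add: sum.reindex)
  also have "\<dots> \<le> (\<Sum>m\<in>\<phi> ` J. C * (1 / (1 + (real_of_int m)\<^sup>2)))"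
    using assms(1) by (intro sum_mono) (auto simp: quad_decay_def)
  also have "\<dots> = C * (\<Sum>m\<in>\<phi> ` J. 1 / (1 + (real_of_int m)\<^sup>2))" by (simp add: sum_distrib_left)
  also have "\<dots> \<le> C * 5"
    using assms(2) quad_decay_nonneg[OF assms(1)] by (intro mult_left_mono sum_inverse_square) auto
  finally show ?thesis by simp
qed

lemma quad_decay_square_summable:
  assumes "quad_decay C g" shows "(\<lambda>m. (g m)\<^sup>2) summable_on A"
proof -
  have C: "0 \<le> C" using quad_decay_nonneg[OF assms] .
  have "(\<lambda>m. (g m)\<^sup>2) summable_on UNIV"
  proof (rule nonneg_bdd_above_summable_on)
    show "bdd_above (sum (\<lambda>m. (g m)\<^sup>2) ` {F. F \<subseteq> UNIV \<and> finite F})"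
    proof (rule bdd_aboveI2)
      fix F assume "F \<in> {F. F \<subseteq> (UNIV :: int set) \<and> finite F}"
      have "(\<Sum>m\<in>F. (g m)\<^sup>2) \<le> (\<Sum>m\<in>F. C * \<bar>g m\<bar>)"
      proof (intro sum_mono)
        fix m
        have "\<bar>g m\<bar> \<le> C / (1 + (real_of_int m)\<^sup>2)" using assms by (simp add: quad_decay_def)
        also have "\<dots> \<le> C / 1" using C by (intro divide_left_mono) (auto simp: add_pos_nonneg)
        finally have "\<bar>g m\<bar> * \<bar>g m\<bar> \<le> C * \<bar>g m\<bar>" by (intro mult_right_mono) auto
        then show "(g m)\<^sup>2 \<le> C * \<bar>g m\<bar>" by (simp add: power2_eq_square)
      qed
      also have "\<dots> = C * (\<Sum>m\<in>F. \<bar>g (id m)\<bar>)" by (simp add: sum_distrib_left)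
      also have "\<dots> \<le> C * (5 * C)"
        using \<open>F \<in> _\<close> C by (intro mult_left_mono quad_decay_sum[OF assms]) auto
      finally show "(\<Sum>m\<in>F. (g m)\<^sup>2) \<le> C * (5 * C)" .
    qed
  qed simp
  then show ?thesis by (rule summable_on_subset) simp
qed

text \<open>
  In row \<open>j\<close> the differences \<open>c j - k\<close> run through an interval of integers, and those
  outside it have absolute value at least \<open>j\<close> or at least \<open>n - j\<close>. The terms with \<open>c j + k\<close>
  are small, as \<open>c j + k \<ge> j\<close>. The resulting errors are summable over \<open>j\<close>, uniformly in \<open>n\<close>.
\<close>

lemma toeplitz_row:
  assumes g: "quad_decay C g" and \<epsilon>: "\<bar>\<epsilon>\<bar> \<le> 1" and c: "1 \<le> c" and j: "1 \<le> j" "j < n"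
  shows "\<bar>(\<Sum>k=1..c * n - 1. (g (int (c * j) - int k) + \<epsilon> * g (int (c * j) + int k))\<^sup>2) - (\<Sum>\<^sub>\<infinity>m. (g m)\<^sup>2)\<bar>
     \<le> 20 * C\<^sup>2 * (1 / (1 + (real j)\<^sup>2)) + 5 * C\<^sup>2 * (1 / (1 + (real (n - j))\<^sup>2))"
proof -
  define w where "w x = 1 / (1 + (real x)\<^sup>2)" for x :: nat
  have C: "0 \<le> C" using quad_decay_nonneg[OF g] .
  have decay: "\<bar>g m\<bar> \<le> C * w i" if "int i \<le> \<bar>m\<bar>" for m i
  proof -
    have "(real i)\<^sup>2 \<le> (real_of_int m)\<^sup>2"
      by (metis that abs_le_square_iff abs_of_nat of_int_abs of_int_le_iff of_int_of_nat_eq)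
    then have "C / (1 + (real_of_int m)\<^sup>2) \<le> C / (1 + (real i)\<^sup>2)"
      using C by (intro divide_left_mono) (auto simp: add_pos_nonneg)
    then show ?thesis using g by (simp add: quad_decay_def w_def) (metis order_trans)
  qed
  define K where "K = {1..c * n - 1}"
  define A where "A = (\<lambda>k. int (c * j) - int k) ` K"
  have [simp]: "finite K" by (simp add: K_def)
  have fA: "finite A" by (simp add: A_def)
  have injm: "inj_on (\<lambda>k. int (c * j) - int k) K" and injp: "inj_on (\<lambda>k. int (c * j) + int k) K"
    by (auto simp: inj_on_def)
  have cj: "j \<le> c * j" "c * j \<le> c * n" using c j by auto
  have cnj: "c * n - c * j \<ge> n - j" using c j
    by (metis diff_mult_distrib2 le_square mult.commute mult_le_mono1 mult_1)
  have far: "int j \<le> \<bar>m\<bar> \<or> int (n - j) \<le> \<bar>m\<bar>" if m: "m \<notin> A" for m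
  proof (rule ccontr)
    assume a: "\<not> ?thesis"
    define k where "k = nat (int (c * j) - m)"
    have "int j \<le> int (c * j)" using cj(1) of_nat_le_iff by blast
    moreover have "int (n - j) \<le> int (c * n) - int (c * j)" using cnj cj(2) by linarith
    ultimately have "m < int (c * j)" "int (c * j) - m < int (c * n)" using a by linarith+
    then have "0 < k" "k < c * n" "m = int (c * j) - int k"
      unfolding k_def by (simp_all add: nat_less_iff del: of_nat_mult)
    then have "k \<in> K" "m = int (c * j) - int k" by (auto simp: K_def)
    then show False using m by (auto simp: A_def)
  qed
  have split: "(\<Sum>\<^sub>\<infinity>m. (g m)\<^sup>2) = (\<Sum>\<^sub>\<infinity>m\<in>A. (g m)\<^sup>2) + (\<Sum>\<^sub>\<infinity>m\<in>-A. (g m)\<^sup>2)"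
    using infsum_Un_disjoint[OF quad_decay_square_summable[OF g] quad_decay_square_summable[OF g], of A "-A"]
    by simp
  have inA: "(\<Sum>\<^sub>\<infinity>m\<in>A. (g m)\<^sup>2) = (\<Sum>k\<in>K. (g (int (c * j) - int k))\<^sup>2)"
    using fA injm by (simp add: A_def sum.reindex)
  have out0: "0 \<le> (\<Sum>\<^sub>\<infinity>m\<in>-A. (g m)\<^sup>2)" by (intro infsum_nonneg) auto
  have out: "(\<Sum>\<^sub>\<infinity>m\<in>-A. (g m)\<^sup>2) \<le> 5 * C\<^sup>2 * (w j + w (n - j))"
  proof (rule infsum_le_finite_sums)
    fix F assume F: "finite F" "F \<subseteq> - A"
    have "(\<Sum>m\<in>F. (g m)\<^sup>2) \<le> (\<Sum>m\<in>F. (C * (w j + w (n - j))) * \<bar>g m\<bar>)"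
    proof (intro sum_mono)
      fix m assume "m \<in> F"
      then have "\<bar>g m\<bar> \<le> C * w j \<or> \<bar>g m\<bar> \<le> C * w (n - j)" using far[of m] F decay by blast
      moreover have "0 \<le> C * w j" "0 \<le> C * w (n - j)" using C by (auto simp: w_def)
      ultimately have "\<bar>g m\<bar> \<le> C * (w j + w (n - j))" by (auto simp: distrib_left)
      then have "\<bar>g m\<bar> * \<bar>g m\<bar> \<le> (C * (w j + w (n - j))) * \<bar>g m\<bar>" by (intro mult_right_mono) auto
      then show "(g m)\<^sup>2 \<le> (C * (w j + w (n - j))) * \<bar>g m\<bar>" by (simp add: power2_eq_square)
    qed
    also have "\<dots> = (C * (w j + w (n - j))) * (\<Sum>m\<in>F. \<bar>g (id m)\<bar>)" by (simp add: sum_distrib_left)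
    also have "\<dots> \<le> (C * (w j + w (n - j))) * (5 * C)"
      using F C by (intro mult_left_mono quad_decay_sum[OF g]) (auto simp: w_def)
    finally show "(\<Sum>m\<in>F. (g m)\<^sup>2) \<le> 5 * C\<^sup>2 * (w j + w (n - j))"
      by (simp add: power2_eq_square mult_ac)
  qed (rule quad_decay_square_summable[OF g])
  have cross: "\<bar>(\<Sum>k\<in>K. (g (int (c * j) - int k) + \<epsilon> * g (int (c * j) + int k))\<^sup>2) - (\<Sum>k\<in>K. (g (int (c * j) - int k))\<^sup>2)\<bar>
     \<le> 15 * C\<^sup>2 * w j"
  proof -
    have "\<bar>(\<Sum>k\<in>K. (g (int (c * j) - int k) + \<epsilon> * g (int (c * j) + int k))\<^sup>2) - (\<Sum>k\<in>K. (g (int (c * j) - int k))\<^sup>2)\<bar>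
      = \<bar>\<Sum>k\<in>K. (\<epsilon> * g (int (c * j) + int k)) * (2 * g (int (c * j) - int k) + \<epsilon> * g (int (c * j) + int k))\<bar>"
      unfolding sum_subtractf[symmetric]
      by (intro arg_cong[of _ _ abs] sum.cong refl) (simp add: power2_eq_square algebra_simps)
    also have "\<dots> \<le> (\<Sum>k\<in>K. (C * w j) * (2 * \<bar>g (int (c * j) - int k)\<bar> + \<bar>g (int (c * j) + int k)\<bar>))"
    proof (rule order_trans[OF sum_abs], rule sum_mono)
      fix k
      let ?x = "g (int (c * j) - int k)" and ?y = "g (int (c * j) + int k)"
      have e: "\<bar>\<epsilon> * ?y\<bar> \<le> \<bar>?y\<bar>" unfolding abs_mult using \<epsilon> by (intro mult_left_le_one_le) auto
      have "int j \<le> int (c * j)" using cj(1) of_nat_le_iff by blast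
      then have "\<bar>?y\<bar> \<le> C * w j" by (intro decay) linarith
      then have "\<bar>\<epsilon> * ?y\<bar> \<le> C * w j" using e by linarith
      moreover have "\<bar>2 * ?x + \<epsilon> * ?y\<bar> \<le> 2 * \<bar>?x\<bar> + \<bar>?y\<bar>" using e by linarith
      ultimately show "\<bar>(\<epsilon> * ?y) * (2 * ?x + \<epsilon> * ?y)\<bar> \<le> (C * w j) * (2 * \<bar>?x\<bar> + \<bar>?y\<bar>)"
        unfolding abs_mult[of "\<epsilon> * ?y"] by (intro mult_mono) auto
    qed
    also have "\<dots> = (C * w j) * (2 * (\<Sum>k\<in>K. \<bar>g (int (c * j) - int k)\<bar>) + (\<Sum>k\<in>K. \<bar>g (int (c * j) + int k)\<bar>))"
      by (simp add: sum_distrib_left[symmetric] sum.distrib)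
    also have "\<dots> \<le> (C * w j) * (2 * (5 * C) + 5 * C)"
      using C by (intro mult_left_mono add_mono quad_decay_sum[OF g] injm injp) (auto simp: w_def)
    finally show ?thesis by (simp add: power2_eq_square mult_ac)
  qed
  show ?thesis
    using cross out out0 inA split unfolding K_def[symmetric] w_def[symmetric]
    by (simp add: algebra_simps)
qed

text \<open>
  The total error of the rows is bounded in \<open>n\<close> and is divided by \<open>n\<close>.
\<close>

lemma toeplitz_limit:
  assumes g: "quad_decay C g" and \<epsilon>: "\<bar>\<epsilon>\<bar> \<le> 1" and c: "1 \<le> c"
  shows "(\<lambda>n. (\<Sum>j=1..n - 1. \<Sum>k=1..c * n - 1. (g (int (c * j) - int k) + \<epsilon> * g (int (c * j) + int k))\<^sup>2) / real n)
     \<longlonglongrightarrow> (\<Sum>\<^sub>\<infinity>m. (g m)\<^sup>2)"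
proof -
  define G where "G = (\<Sum>\<^sub>\<infinity>m. (g m)\<^sup>2)"
  define R where "R n j = (\<Sum>k=1..c * n - 1. (g (int (c * j) - int k) + \<epsilon> * g (int (c * j) + int k))\<^sup>2)" for n j
  define w where "w x = 1 / (1 + (real x)\<^sup>2)" for x :: nat
  have G0: "0 \<le> G" unfolding G_def by (intro infsum_nonneg) auto
  have sw: "(\<Sum>j=1..n. w j) \<le> 2" for n
    using sum_inverse_square_nat[of n] unfolding w_def by (smt (verit) divide_nonneg_nonneg of_nat_0_le_iff)
  have bd: "\<bar>(\<Sum>j=1..n - 1. R n j) / real n - G\<bar> \<le> (50 * C\<^sup>2 + G) / real n" if n: "1 \<le> n" for n
  proof -
    have "\<bar>(\<Sum>j=1..n - 1. R n j - G)\<bar> \<le> (\<Sum>j=1..n - 1. 20 * C\<^sup>2 * w j + 5 * C\<^sup>2 * w (n - j))"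
      unfolding R_def G_def w_def
      by (intro order_trans[OF sum_abs] sum_mono toeplitz_row[OF g \<epsilon> c]) auto
    also have "\<dots> = 20 * C\<^sup>2 * (\<Sum>j=1..n - 1. w j) + 5 * C\<^sup>2 * (\<Sum>j=1..n - 1. w (n - j))"
      by (simp add: sum.distrib sum_distrib_left)
    also have "(\<Sum>j=1..n - 1. w (n - j)) = (\<Sum>j=1..n - 1. w j)"
      by (rule sum.reindex_bij_witness[of _ "\<lambda>j. n - j" "\<lambda>j. n - j"]) auto
    also have "20 * C\<^sup>2 * (\<Sum>j=1..n - 1. w j) + 5 * C\<^sup>2 * (\<Sum>j=1..n - 1. w j) \<le> 20 * C\<^sup>2 * 2 + 5 * C\<^sup>2 * 2"
      by (intro add_mono mult_left_mono sw) auto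
    finally have 1: "\<bar>(\<Sum>j=1..n - 1. R n j - G)\<bar> \<le> 50 * C\<^sup>2" by simp
    have "(\<Sum>j=1..n - 1. R n j) - real n * G = (\<Sum>j=1..n - 1. R n j - G) - G"
      using n by (simp add: sum_subtractf of_nat_diff algebra_simps)
    then have "\<bar>(\<Sum>j=1..n - 1. R n j) - real n * G\<bar> \<le> 50 * C\<^sup>2 + G" using 1 G0 by linarith
    moreover have "(\<Sum>j=1..n - 1. R n j) / real n - G = ((\<Sum>j=1..n - 1. R n j) - real n * G) / real n"
      using n by (simp add: field_simps)
    ultimately show ?thesis by (simp add: divide_right_mono)
  qed
  have "(\<lambda>n. (\<Sum>j=1..n - 1. R n j) / real n - G) \<longlonglongrightarrow> 0"
    by (rule Lim_null_comparison[OF _ lim_const_over_n[of "50 * C\<^sup>2 + G"]])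
       (use bd in \<open>auto simp: eventually_sequentially intro!: exI[of _ 1]\<close>)
  then show ?thesis unfolding R_def G_def by (simp add: LIM_zero_iff)
qed

section \<open>Second order increments of fractional processes\<close>

text \<open>
  A common frame for the two processes to be compared: \<open>\<epsilon> = 1\<close> is sub-fractional and \<open>\<epsilon> = 0\<close>
  is fractional Brownian motion. The function \<open>u\<close> is annihilated by second differences, so
  the covariances of the increments differ only in the coefficient \<open>\<epsilon>\<close> of a summable term.
\<close>

locale fractional_process = gaussian_space M L for M :: "'a measure" and L +
  fixes X :: "real \<Rightarrow> 'a \<Rightarrow> real" and T H \<epsilon> :: real and u :: "real \<Rightarrow> real"
  assumes T_pos: "0 < T" and H_pos: "0 < H" and H_less: "H < 1" and eps: "\<bar>\<epsilon>\<bar> \<le> 1"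
    and X_L: "t \<in> {0..T} \<Longrightarrow> X t \<in> L"
    and cov_X: "s \<in> {0..T} \<Longrightarrow> t \<in> {0..T} \<Longrightarrow> expectation (\<lambda>w. X s w * X t w) =
       u s + u t - \<bar>s - t\<bar> powr (2 * H) / 2 - \<epsilon> / 2 * (s + t) powr (2 * H)"
begin

abbreviation incr :: "nat \<Rightarrow> nat \<Rightarrow> 'a \<Rightarrow> real" where
  "incr N k \<equiv> normalized_diff2 T H N k X"

definition norm_const :: real where "norm_const = 4 - 2 powr (2 * H)"

lemma norm_const_pos: "0 < norm_const"
proof -
  have "2 powr (2 * H) < 2 powr 2" using H_less by (intro powr_less_mono) auto
  then show ?thesis by (simp add: norm_const_def)
qed

lemma grid_point: "1 \<le> k \<Longrightarrow> k \<le> N - 1 \<Longrightarrow> x \<in> {-1, 0, 1} \<Longrightarrow> (real k + x) / real N * T \<in> {0..T}"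
  for k N :: nat and x :: real
proof -
  assume k: "1 \<le> k" "k \<le> N - 1" and x: "x \<in> {-1, 0, 1}"
  have "0 \<le> real k + x" "real k + x \<le> real N" using k x by auto
  then have "0 \<le> (real k + x) / real N" "(real k + x) / real N \<le> 1" using k by (auto simp: divide_simps)
  then have "0 \<le> (real k + x) / real N * T" "(real k + x) / real N * T \<le> 1 * T"
    using T_pos by (auto intro!: mult_right_mono simp del: times_divide_eq_left mult_1)
  then show ?thesis by (simp only: atLeastAtMost_iff mult_1)
qed

lemma diff2_L:
  assumes "1 \<le> k" "k \<le> N - 1" shows "diff2 T N k X \<in> L"
proof -
  have p: "X ((real k + 1) / real N * T) \<in> L" "X (real k / real N * T) \<in> L" "X ((real k - 1) / real N * T) \<in> L"
    using grid_point[OF assms, of 1] grid_point[OF assms, of 0] grid_point[OF assms, of "-1"]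
    by (auto intro!: X_L)
  have "(\<lambda>w. 1 * (1 * X ((real k + 1) / real N * T) w + (-2) * X (real k / real N * T) w)
      + 1 * X ((real k - 1) / real N * T) w) \<in> L"
    by (intro lin_L p)
  then show ?thesis by (simp add: diff2_def[abs_def])
qed

lemma normalized_diff2_L:
  assumes "1 \<le> k" "k \<le> N - 1" shows "incr N k \<in> L"
  using lin_L[OF diff2_L[OF assms] diff2_L[OF assms], of "1 / (sqrt (4 - 2 powr (2 * H)) * (T / real N) powr H)" 0]
  by (simp add: normalized_diff2_def[abs_def])

text \<open>
  All terms with \<open>u\<close> cancel, and the rest is the fourth difference of \<open>\<bar>x\<bar>\<^sup>2\<^sup>H\<close> at \<open>j - k\<close>
  and at \<open>j + k\<close>.
\<close>

lemma diff2_product_same: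
  assumes j: "1 \<le> j" "j \<le> N - 1" and k: "1 \<le> k" "k \<le> N - 1"
  shows "expectation (\<lambda>w. diff2 T N j X w * diff2 T N k X w)
     = (T / real N) powr (2 * H) * (rho_hat H (real j - real k) + \<epsilon> * rho_hat H (real j + real k))"
proof -
  define d where "d = T / real N"
  define D where "D = d powr (2 * H)"
  have d: "0 < d" using j T_pos by (simp add: d_def)
  define U where "U x = u (x / real N * T)" for x
  define e where "e x y = expectation (\<lambda>w. X (x / real N * T) w * X (y / real N * T) w)" for x y
  define p where "p x = \<bar>x\<bar> powr (2 * H)" for x :: real
  have e: "e (real j + x) (real k + y) = U (real j + x) + U (real k + y)
      - D * p (real j - real k + (x - y)) / 2 - \<epsilon> / 2 * (D * p (real j + real k + (x + y)))"
    if x: "x \<in> {-1, 0, 1}" and y: "y \<in> {-1, 0, 1}" for x y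
  proof -
    have 1: "(real j + x) / real N * T - (real k + y) / real N * T = d * (real j - real k + (x - y))"
      by (simp add: d_def algebra_simps diff_divide_distrib add_divide_distrib)
    have 2: "(real j + x) / real N * T + (real k + y) / real N * T = d * (real j + real k + (x + y))"
      by (simp add: d_def algebra_simps diff_divide_distrib add_divide_distrib)
    have 3: "0 \<le> real j + real k + (x + y)" using j k x y by auto
    have "\<bar>d * z\<bar> powr (2 * H) = D * p z" for z
      using d by (simp add: D_def p_def abs_mult powr_mult)
    moreover have "(d * (real j + real k + (x + y))) powr (2 * H) = D * p (real j + real k + (x + y))"
      using d 3 by (simp add: D_def p_def powr_mult)
    ultimately show ?thesis unfolding e_def cov_X[OF grid_point[OF j x] grid_point[OF k y]] 1 2 by (simp add: U_def)
  qed
  have pts: "X ((real j + 1) / real N * T) \<in> L" "X (real j / real N * T) \<in> L" "X ((real j - 1) / real N * T) \<in> L"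
     "X ((real k + 1) / real N * T) \<in> L" "X (real k / real N * T) \<in> L" "X ((real k - 1) / real N * T) \<in> L"
    using grid_point[OF j, of 1] grid_point[OF j, of 0] grid_point[OF j, of "-1"]
      grid_point[OF k, of 1] grid_point[OF k, of 0] grid_point[OF k, of "-1"]
    by (auto intro!: X_L)
  have ee: "e (real j + 1) (real k + 1) = U (real j + 1) + U (real k + 1) - D * p (real j - real k) / 2 - \<epsilon> / 2 * (D * p (real j + real k + 2))"
    "e (real j + 1) (real k) = U (real j + 1) + U (real k) - D * p (real j - real k + 1) / 2 - \<epsilon> / 2 * (D * p (real j + real k + 1))"
    "e (real j + 1) (real k - 1) = U (real j + 1) + U (real k - 1) - D * p (real j - real k + 2) / 2 - \<epsilon> / 2 * (D * p (real j + real k))"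
    "e (real j) (real k + 1) = U (real j) + U (real k + 1) - D * p (real j - real k - 1) / 2 - \<epsilon> / 2 * (D * p (real j + real k + 1))"
    "e (real j) (real k) = U (real j) + U (real k) - D * p (real j - real k) / 2 - \<epsilon> / 2 * (D * p (real j + real k))"
    "e (real j) (real k - 1) = U (real j) + U (real k - 1) - D * p (real j - real k + 1) / 2 - \<epsilon> / 2 * (D * p (real j + real k - 1))"
    "e (real j - 1) (real k + 1) = U (real j - 1) + U (real k + 1) - D * p (real j - real k - 2) / 2 - \<epsilon> / 2 * (D * p (real j + real k))"
    "e (real j - 1) (real k) = U (real j - 1) + U (real k) - D * p (real j - real k - 1) / 2 - \<epsilon> / 2 * (D * p (real j + real k - 1))"
    "e (real j - 1) (real k - 1) = U (real j - 1) + U (real k - 1) - D * p (real j - real k) / 2 - \<epsilon> / 2 * (D * p (real j + real k - 2))"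
    using e[of 1 1] e[of 1 0] e[of 1 "-1"] e[of 0 1] e[of 0 0] e[of 0 "-1"] e[of "-1" 1] e[of "-1" 0] e[of "-1" "-1"]
    by simp_all
  have "expectation (\<lambda>w. diff2 T N j X w * diff2 T N k X w) =
      e (real j + 1) (real k + 1) - 2 * e (real j + 1) (real k) + e (real j + 1) (real k - 1)
      - 2 * e (real j) (real k + 1) + 4 * e (real j) (real k) - 2 * e (real j) (real k - 1)
      + e (real j - 1) (real k + 1) - 2 * e (real j - 1) (real k) + e (real j - 1) (real k - 1)"
    unfolding diff2_def e_def by (rule expectation_diff2_product[OF pts])
  also have "\<dots> = D * (rho_hat H (real j - real k) + \<epsilon> * rho_hat H (real j + real k))"
    unfolding ee rho_hat_def p_def[symmetric] by (simp add: field_simps)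
  finally show ?thesis by (simp add: D_def d_def)
qed

lemma diff2_refine:
  assumes "1 \<le> k" "k \<le> n - 1"
  shows "diff2 T n k X w = diff2 T (2 * n) (2 * k + 1) X w + 2 * diff2 T (2 * n) (2 * k) X w
     + diff2 T (2 * n) (2 * k - 1) X w"
proof -
  have n: "real n \<noteq> 0" using assms by auto
  have p: "(real (2 * k + 1) + 1) / real (2 * n) = (real k + 1) / real n"
    "(real (2 * k + 1) - 1) / real (2 * n) = real k / real n"
    "real (2 * k) / real (2 * n) = real k / real n"
    "(real (2 * k) + 1) / real (2 * n) = real (2 * k + 1) / real (2 * n)"
    "(real (2 * k) - 1) / real (2 * n) = real (2 * k - 1) / real (2 * n)"
    "(real (2 * k - 1) + 1) / real (2 * n) = real k / real n"
    "(real (2 * k - 1) - 1) / real (2 * n) = (real k - 1) / real n"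
    using n assms by (auto simp: field_simps of_nat_diff)
  show ?thesis unfolding diff2_def p by simp
qed

lemma diff2_product_cross:
  assumes j: "1 \<le> j" "j \<le> n - 1" and k: "1 \<le> k" "k \<le> 2 * n - 1"
  shows "expectation (\<lambda>w. diff2 T n j X w * diff2 T (2 * n) k X w)
     = (T / real (2 * n)) powr (2 * H)
        * (rho_tilde H (2 * real j - real k) + \<epsilon> * rho_tilde H (2 * real j + real k))"
proof -
  have J: "1 \<le> 2 * j + 1" "2 * j + 1 \<le> 2 * n - 1" "1 \<le> 2 * j" "2 * j \<le> 2 * n - 1" "1 \<le> 2 * j - 1" "2 * j - 1 \<le> 2 * n - 1"
    using j by auto
  let ?d = "\<lambda>i. diff2 T (2 * n) i X"
  define D where "D = (T / real (2 * n)) powr (2 * H)"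
  have r: "real (2 * j + 1) = 2 * real j + 1" "real (2 * j) = 2 * real j" "real (2 * j - 1) = 2 * real j - 1"
    using j by (auto simp: of_nat_diff)
  have i: "integrable M (\<lambda>w. ?d i w * ?d k w)" if "1 \<le> i" "i \<le> 2 * n - 1" for i
    by (intro integrable_moments all_moments_mult L_all_moments diff2_L that k)
  have "expectation (\<lambda>w. diff2 T n j X w * ?d k w) =
     expectation (\<lambda>w. ?d (2 * j + 1) w * ?d k w + 2 * (?d (2 * j) w * ?d k w) + ?d (2 * j - 1) w * ?d k w)"
    unfolding diff2_refine[OF j] by (simp add: algebra_simps)
  also have "\<dots> = expectation (\<lambda>w. ?d (2 * j + 1) w * ?d k w) + 2 * expectation (\<lambda>w. ?d (2 * j) w * ?d k w)
      + expectation (\<lambda>w. ?d (2 * j - 1) w * ?d k w)"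
    using i[OF J(1,2)] i[OF J(3,4)] i[OF J(5,6)] by simp
  also have "\<dots> = D * (rho_hat H (2 * real j + 1 - real k) + \<epsilon> * rho_hat H (2 * real j + 1 + real k))
     + 2 * (D * (rho_hat H (2 * real j - real k) + \<epsilon> * rho_hat H (2 * real j + real k)))
     + D * (rho_hat H (2 * real j - 1 - real k) + \<epsilon> * rho_hat H (2 * real j - 1 + real k))"
    unfolding diff2_product_same[OF J(1,2) k] diff2_product_same[OF J(3,4) k] diff2_product_same[OF J(5,6) k]
    unfolding r D_def ..
  also have "\<dots> = D * (rho_tilde H (2 * real j - real k) + \<epsilon> * rho_tilde H (2 * real j + real k))"
    unfolding rho_tilde_eq by (simp add: algebra_simps)
  finally show ?thesis by (simp add: D_def)
qed

text \<open>
  The covariances of the normalised increments: \<open>same_corr\<close> for two increments on one grid,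
  \<open>cross_corr\<close> for one on each of the two grids.
\<close>

definition same_corr :: "int \<Rightarrow> real" where "same_corr m = rho_hat H (of_int m) / norm_const"
definition cross_corr :: "int \<Rightarrow> real" where "cross_corr m = rho_tilde H (of_int m) / (2 powr H * norm_const)"

lemma moment_same:
  assumes j: "1 \<le> j" "j \<le> N - 1" and k: "1 \<le> k" "k \<le> N - 1"
  shows "expectation (\<lambda>w. incr N j w * incr N k w)
     = same_corr (int j - int k) + \<epsilon> * same_corr (int j + int k)"
proof -
  define d where "d = T / real N"
  have d: "0 < d" using j T_pos by (simp add: d_def)
  have dd: "d powr H * d powr H = d powr (2 * H)" by (simp add: powr_add[symmetric])
  have sq: "(sqrt norm_const * d powr H) * (sqrt norm_const * d powr H) = norm_const * d powr (2 * H)"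
    using norm_const_pos by (simp add: dd[symmetric])
  have "expectation (\<lambda>w. incr N j w * incr N k w)
     = expectation (\<lambda>w. diff2 T N j X w * diff2 T N k X w / (norm_const * d powr (2 * H)))"
    unfolding normalized_diff2_def norm_const_def[symmetric] d_def[symmetric] times_divide_times_eq sq ..
  also have "\<dots> = (d powr (2 * H) * (rho_hat H (real j - real k) + \<epsilon> * rho_hat H (real j + real k))) / (norm_const * d powr (2 * H))"
    unfolding integral_divide_zero diff2_product_same[OF assms] d_def ..
  also have "\<dots> = (rho_hat H (real j - real k) + \<epsilon> * rho_hat H (real j + real k)) / norm_const"
    using d by simp
  finally show ?thesis by (simp add: same_corr_def add_divide_distrib)
qed

lemma moment_cross:
  assumes j: "1 \<le> j" "j \<le> n - 1" and k: "1 \<le> k" "k \<le> 2 * n - 1"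
  shows "expectation (\<lambda>w. incr n j w * incr (2 * n) k w)
     = cross_corr (int (2 * j) - int k) + \<epsilon> * cross_corr (int (2 * j) + int k)"
proof -
  define d where "d = T / real (2 * n)"
  have d: "0 < d" using j T_pos by (simp add: d_def)
  have d2: "T / real n = 2 * d" by (simp add: d_def)
  have dd: "d powr H * d powr H = d powr (2 * H)" by (simp add: powr_add[symmetric])
  have sq: "(sqrt norm_const * (2 * d) powr H) * (sqrt norm_const * d powr H) = (2 powr H * norm_const) * d powr (2 * H)"
    using norm_const_pos d by (simp add: dd[symmetric] powr_mult)
  have "expectation (\<lambda>w. incr n j w * incr (2 * n) k w)
     = expectation (\<lambda>w. diff2 T n j X w * diff2 T (2 * n) k X w / ((2 powr H * norm_const) * d powr (2 * H)))"
    unfolding normalized_diff2_def norm_const_def[symmetric] d_def[symmetric] d2 times_divide_times_eq sq ..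
  also have "\<dots> = (d powr (2 * H) * (rho_tilde H (2 * real j - real k) + \<epsilon> * rho_tilde H (2 * real j + real k)))
      / ((2 powr H * norm_const) * d powr (2 * H))"
    unfolding integral_divide_zero diff2_product_cross[OF assms] d_def ..
  also have "\<dots> = (rho_tilde H (2 * real j - real k) + \<epsilon> * rho_tilde H (2 * real j + real k)) / (2 powr H * norm_const)"
    using d by simp
  finally show ?thesis by (simp add: cross_corr_def add_divide_distrib)
qed

lemma same_corr_0: "same_corr 0 = 1"
  using norm_const_pos by (simp add: same_corr_def rho_hat_def norm_const_def)

lemma corr_decay: "\<exists>K. quad_decay K same_corr \<and> quad_decay K cross_corr"
proof -
  obtain C1 where C1: "quad_decay C1 same_corr"
    using rho_hat_decay[OF H_pos H_less] quad_decay_cmult[of _ _ "1 / norm_const"] by (auto simp: same_corr_def[abs_def])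
  obtain C2 where C2: "quad_decay C2 cross_corr"
    using rho_tilde_decay[OF H_pos H_less] quad_decay_cmult[of _ _ "1 / (2 powr H * norm_const)"] by (auto simp: cross_corr_def[abs_def])
  have "C1 / (1 + (real_of_int m)\<^sup>2) \<le> max C1 C2 / (1 + (real_of_int m)\<^sup>2)"
    "C2 / (1 + (real_of_int m)\<^sup>2) \<le> max C1 C2 / (1 + (real_of_int m)\<^sup>2)" for m
    by (auto intro!: divide_right_mono)
  then have "quad_decay (max C1 C2) same_corr \<and> quad_decay (max C1 C2) cross_corr"
    using C1 C2 unfolding quad_decay_def by (blast intro: order_trans)
  then show ?thesis ..
qed

text \<open>
  One constant for both functions, fixed so that the bounds of the following lemmas can be
  stated uniformly in the grid.
\<close>

definition decay_const :: real where "decay_const = (SOME K. quad_decay K same_corr \<and> quad_decay K cross_corr)"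

lemma same_corr_decay: "quad_decay decay_const same_corr" and cross_corr_decay: "quad_decay decay_const cross_corr"
  using someI_ex[OF corr_decay] by (auto simp: decay_const_def)

lemma decay_const_nonneg: "0 \<le> decay_const" using quad_decay_nonneg[OF same_corr_decay] .

lemma decay_pair_sum:
  assumes "quad_decay decay_const g" "finite J" "inj_on \<phi> J" "inj_on \<psi> J"
  shows "(\<Sum>j\<in>J. \<bar>g (\<phi> j) + \<epsilon> * g (\<psi> j)\<bar>) \<le> 10 * decay_const"
proof -
  have "(\<Sum>j\<in>J. \<bar>g (\<phi> j) + \<epsilon> * g (\<psi> j)\<bar>) \<le> (\<Sum>j\<in>J. \<bar>g (\<phi> j)\<bar> + \<bar>g (\<psi> j)\<bar>)"
  proof (intro sum_mono)
    fix j
    have "\<bar>\<epsilon> * g (\<psi> j)\<bar> \<le> \<bar>g (\<psi> j)\<bar>" unfolding abs_mult using eps by (intro mult_left_le_one_le) auto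
    then show "\<bar>g (\<phi> j) + \<epsilon> * g (\<psi> j)\<bar> \<le> \<bar>g (\<phi> j)\<bar> + \<bar>g (\<psi> j)\<bar>" by linarith
  qed
  also have "\<dots> \<le> 5 * decay_const + 5 * decay_const"
    unfolding sum.distrib using assms by (intro add_mono quad_decay_sum)
  finally show ?thesis by simp
qed

lemma same_level_sum:
  assumes "1 \<le> k" "k \<le> N - 1"
  shows "(\<Sum>j=1..N - 1. \<bar>expectation (\<lambda>w. incr N k w * incr N j w)\<bar>) \<le> 10 * decay_const"
proof -
  have "(\<Sum>j=1..N - 1. \<bar>expectation (\<lambda>w. incr N k w * incr N j w)\<bar>)
     = (\<Sum>j=1..N - 1. \<bar>same_corr (int k - int j) + \<epsilon> * same_corr (int k + int j)\<bar>)"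
    by (intro sum.cong refl arg_cong[of _ _ abs] moment_same) (use assms in auto)
  also have "\<dots> \<le> 10 * decay_const"
    by (intro decay_pair_sum[OF same_corr_decay]) (auto simp: inj_on_def)
  finally show ?thesis .
qed

lemma max_column_sum_bounded: "max_column_sum M T H N X \<le> 10 * decay_const"
  unfolding max_column_sum_def diff2_moment_def
proof (rule Max.boundedI)
  fix x assume "x \<in> insert 0 ((\<lambda>k. \<Sum>j = 1..N - 1. \<bar>expectation (\<lambda>w. incr N j w * incr N k w)\<bar>) ` {1..N - 1})"
  then show "x \<le> 10 * decay_const" using same_level_sum decay_const_nonneg by (auto simp: mult.commute)
qed auto

lemma expectation_quad_var2:
  "expectation (quad_var2 T H N X) = real (N - 1) + \<epsilon> * (\<Sum>k=1..N - 1. same_corr (int (2 * k)))"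
proof -
  have "expectation (quad_var2 T H N X) = (\<Sum>k=1..N - 1. expectation (\<lambda>w. (incr N k w)\<^sup>2))"
    unfolding quad_var2_def[abs_def]
    by (intro Bochner_Integration.integral_sum integrable_moments all_moments_power L_all_moments normalized_diff2_L finite_M) auto
  also have "\<dots> = (\<Sum>k=1..N - 1. 1 + \<epsilon> * same_corr (int (2 * k)))"
  proof (intro sum.cong refl)
    fix k assume "k \<in> {1..N - 1}"
    then show "expectation (\<lambda>w. (incr N k w)\<^sup>2) = 1 + \<epsilon> * same_corr (int (2 * k))"
      using moment_same[of k N k] same_corr_0 by (simp add: power2_eq_square)
  qed
  finally show ?thesis by (simp add: sum.distrib sum_distrib_left)
qed

text \<open>
  There are \<open>N - 1\<close> summands of mean \<open>1 + O(k\<^sup>-\<^sup>2)\<close>.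
\<close>

lemma expectation_quad_var2_bound:
  assumes "1 \<le> N" shows "\<bar>expectation (quad_var2 T H N X) / real N - 1\<bar> \<le> (1 + 5 * decay_const) / real N"
proof -
  have "\<bar>\<Sum>k=1..N - 1. same_corr (int (2 * k))\<bar> \<le> 5 * decay_const"
    by (intro order_trans[OF sum_abs] quad_decay_sum[OF same_corr_decay]) (auto simp: inj_on_def)
  then have "\<bar>\<epsilon> * (\<Sum>k=1..N - 1. same_corr (int (2 * k)))\<bar> \<le> 1 * (5 * decay_const)"
    unfolding abs_mult using eps by (intro mult_mono) auto
  then have "\<bar>expectation (quad_var2 T H N X) - real N\<bar> \<le> 1 + 5 * decay_const"
    unfolding expectation_quad_var2 using assms by (simp add: of_nat_diff)
  moreover have "expectation (quad_var2 T H N X) / real N - 1 = (expectation (quad_var2 T H N X) - real N) / real N"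
    using assms by (simp add: field_simps)
  ultimately show ?thesis by (simp add: divide_right_mono)
qed

lemma expectation_quad_var2_limit:
  assumes "1 \<le> i"
  shows "(\<lambda>n. sqrt (real n) * (expectation (quad_var2 T H (i * n) X) / real (i * n) - 1)) \<longlonglongrightarrow> 0"
proof (rule Lim_null_comparison)
  show "\<forall>\<^sub>F n in sequentially. norm (sqrt (real n) * (expectation (quad_var2 T H (i * n) X) / real (i * n) - 1))
      \<le> (1 + 5 * decay_const) * (1 / sqrt (real n))"
    unfolding eventually_sequentially
  proof (intro exI allI impI)
    fix n :: nat assume n: "1 \<le> n"
    have "\<bar>expectation (quad_var2 T H (i * n) X) / real (i * n) - 1\<bar> \<le> (1 + 5 * decay_const) / real (i * n)"
      using n assms by (intro expectation_quad_var2_bound) auto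
    also have "\<dots> \<le> (1 + 5 * decay_const) / real n" using n assms decay_const_nonneg by (intro divide_left_mono) auto
    finally have "norm (sqrt (real n) * (expectation (quad_var2 T H (i * n) X) / real (i * n) - 1))
       \<le> sqrt (real n) * ((1 + 5 * decay_const) / real n)"
      unfolding norm_mult by (intro mult_mono) auto
    also have "\<dots> = (1 + 5 * decay_const) * (1 / sqrt (real n))" using n by (simp add: field_simps)
    finally show "norm (sqrt (real n) * (expectation (quad_var2 T H (i * n) X) / real (i * n) - 1))
      \<le> (1 + 5 * decay_const) * (1 / sqrt (real n))" .
  qed
  have "(\<lambda>n. 1 / sqrt (real n)) \<longlonglongrightarrow> 0"
    using tendsto_real_sqrt[OF lim_1_over_n[where 'a=real]] by (simp add: real_sqrt_divide)
  then show "(\<lambda>n. (1 + 5 * decay_const) * (1 / sqrt (real n))) \<longlonglongrightarrow> 0" by (rule tendsto_mult_right_zero)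
qed

definition same_limit :: real where "same_limit = (\<Sum>\<^sub>\<infinity>m. (same_corr m)\<^sup>2)"
definition cross_limit :: real where "cross_limit = (\<Sum>\<^sub>\<infinity>m. (cross_corr m)\<^sup>2)"

lemma covariance_quad_var2:
  "covariance M (\<lambda>w. quad_var2 T H N X w / a) (\<lambda>w. quad_var2 T H N' X w / b) =
     2 * (\<Sum>j=1..N - 1. \<Sum>k=1..N' - 1.
       (expectation (\<lambda>w. incr N j w * incr N' k w))\<^sup>2) / (a * b)"
proof -
  have "covariance M (\<lambda>w. quad_var2 T H N X w / a) (\<lambda>w. quad_var2 T H N' X w / b) =
     covariance M (quad_var2 T H N X) (quad_var2 T H N' X) / (a * b)"
    unfolding covariance_def
    by (simp add: diff_divide_distrib[symmetric])
  then show ?thesis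
    unfolding quad_var2_def[abs_def]
    by (subst (asm) covariance_sum_squares) (auto intro: normalized_diff2_L)
qed

definition cov_limit :: "nat \<Rightarrow> nat \<Rightarrow> real" where
  "cov_limit i j = (if i = j then 2 * same_limit / real i else cross_limit)"

lemma covariance_limit:
  assumes "i \<in> {1, 2}" "j \<in> {1, 2}"
  shows "(\<lambda>n. 1 / real n * covariance M (\<lambda>w. quad_var2 T H (i * n) X w / real i)
             (\<lambda>w. quad_var2 T H (j * n) X w / real j)) \<longlonglongrightarrow> cov_limit i j"
proof -
  define S1 where "S1 n = (\<Sum>j=1..n - 1. \<Sum>k=1..n - 1. (same_corr (int j - int k) + \<epsilon> * same_corr (int j + int k))\<^sup>2)" for n
  define S2 where "S2 n = (\<Sum>j=1..n - 1. \<Sum>k=1..2 * n - 1. (cross_corr (int (2 * j) - int k) + \<epsilon> * cross_corr (int (2 * j) + int k))\<^sup>2)" for n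
  have S1: "(\<lambda>n. S1 n / real n) \<longlonglongrightarrow> same_limit"
    using toeplitz_limit[OF same_corr_decay eps, of 1] by (simp add: S1_def same_limit_def)
  have S1': "(\<lambda>n. S1 (2 * n) / real (2 * n)) \<longlonglongrightarrow> same_limit"
    using LIMSEQ_subseq_LIMSEQ[OF S1, of "\<lambda>n. 2 * n"] by (simp add: strict_mono_def o_def)
  have S2: "(\<lambda>n. S2 n / real n) \<longlonglongrightarrow> cross_limit"
    using toeplitz_limit[OF cross_corr_decay eps, of 2] by (simp add: S2_def cross_limit_def)
  have same: "covariance M (\<lambda>w. quad_var2 T H N X w / a) (\<lambda>w. quad_var2 T H N X w / b) = 2 * S1 N / (a * b)" for N a b
    unfolding covariance_quad_var2 S1_def by (intro arg_cong2[of _ _ _ _ "(/)"] arg_cong2[of _ _ _ _ "(*)"] sum.cong refl)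
      (simp add: moment_same)
  have cross: "covariance M (\<lambda>w. quad_var2 T H n X w / a) (\<lambda>w. quad_var2 T H (2 * n) X w / b) = 2 * S2 n / (a * b)" for n a b
    unfolding covariance_quad_var2 S2_def by (intro arg_cong2[of _ _ _ _ "(/)"] arg_cong2[of _ _ _ _ "(*)"] sum.cong refl)
      (simp add: moment_cross del: of_nat_mult)
  have sym: "covariance M U V = covariance M V U" for U V
    by (simp add: covariance_def mult.commute)
  consider "i = 1" "j = 1" | "i = 2" "j = 2" | "i = 1" "j = 2" | "i = 2" "j = 1" using assms by auto
  then show ?thesis
  proof cases
    case 1
    then show ?thesis using tendsto_mult_left[OF S1, of 2] same[of _ 1 1] by (simp add: cov_limit_def)
  next
    case 2
    have "(\<lambda>n. 1 / real n * (2 * S1 (2 * n) / (real 2 * real 2))) = (\<lambda>n. S1 (2 * n) / real (2 * n))"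
      by (simp add: fun_eq_iff)
    then show ?thesis unfolding 2 same using S1' by (simp only: cov_limit_def) simp
  next
    case 3
    then show ?thesis using S2 cross[of _ 1 2] by (simp add: cov_limit_def)
  next
    case 4
    then show ?thesis using S2 cross[of _ 1 2] by (subst sym) (simp add: cov_limit_def)
  qed
qed

end

section \<open>Strong consistency and asymptotic normality of the estimator\<close>

text \<open>
  Relates the one-sided series in \<open>Sigma11\<close> to a sum over all integers.
\<close>

lemma infsum_int_even:
  fixes f :: "int \<Rightarrow> real"
  assumes "f summable_on UNIV" "\<And>m. f (- m) = f m"
  shows "(\<Sum>\<^sub>\<infinity>m. f m) = f 0 + 2 * (\<Sum>j. f (int (Suc j)))"
proof -
  define P where "P = range (\<lambda>j. int (Suc j))"
  define Q where "Q = range (\<lambda>j. - int (Suc j))"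
  have inj: "inj (\<lambda>j. int (Suc j))" "inj (\<lambda>j. - int (Suc j))" by (auto simp: inj_on_def)
  have s: "f summable_on A" for A using assms(1) by (rule summable_on_subset) simp
  have U: "(UNIV :: int set) = {0} \<union> (P \<union> Q)"
  proof (intro set_eqI iffI)
    fix m :: int
    consider "m = 0" | "m = int (Suc (nat (m - 1)))" | "m = - int (Suc (nat (- m - 1)))" by linarith
    then show "m \<in> {0} \<union> (P \<union> Q)" unfolding P_def Q_def by cases blast+
  qed simp
  have "(\<lambda>j. f (int (Suc j))) summable_on UNIV"
    using summable_on_reindex[OF inj(1), of f] s by (simp add: o_def)
  then have sums: "(\<Sum>\<^sub>\<infinity>j. f (int (Suc j))) = (\<Sum>j. f (int (Suc j)))"
    using has_sum_imp_sums has_sum_infsum sums_unique by metis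
  have "infsum f UNIV = infsum f {0} + infsum f (P \<union> Q)"
    unfolding U by (intro infsum_Un_disjoint s) (auto simp: P_def Q_def)
  also have "infsum f (P \<union> Q) = infsum f P + infsum f Q"
    by (intro infsum_Un_disjoint s) (auto simp: P_def Q_def)
  also have "infsum f P = (\<Sum>\<^sub>\<infinity>j. f (int (Suc j)))"
    unfolding P_def using infsum_reindex[OF inj(1), of f] by (simp add: o_def)
  also have "infsum f Q = (\<Sum>\<^sub>\<infinity>j. f (int (Suc j)))"
    unfolding Q_def using infsum_reindex[OF inj(2), of f] assms(2) by (simp add: o_def del: of_nat_Suc)
  finally show ?thesis unfolding sums by simp
qed

context fractional_process begin

lemma Sigma11_eq: "Sigma11 H = 2 * same_limit"
proof -
  have "same_limit = (same_corr 0)\<^sup>2 + 2 * (\<Sum>j. (same_corr (int (Suc j)))\<^sup>2)"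
    unfolding same_limit_def
    by (rule infsum_int_even[OF quad_decay_square_summable[OF same_corr_decay]])
       (simp add: same_corr_def rho_hat_even)
  also have "(\<Sum>j. (same_corr (int (Suc j)))\<^sup>2) = (\<Sum>j. (1 / norm_const\<^sup>2) * (rho_hat H (real (Suc j)))\<^sup>2)"
    by (simp add: same_corr_def power_divide)
  also have "\<dots> = (1 / norm_const\<^sup>2) * (\<Sum>j. (rho_hat H (real (Suc j)))\<^sup>2)"
  proof (rule suminf_mult)
    have "(\<lambda>j. (same_corr (int (Suc j)))\<^sup>2) summable_on UNIV"
      using summable_on_reindex[of "\<lambda>j. int (Suc j)" UNIV "\<lambda>m. (same_corr m)\<^sup>2"] quad_decay_square_summable[OF same_corr_decay]
      by (simp add: o_def inj_on_def)
    then have "summable (\<lambda>j. (same_corr (int (Suc j)))\<^sup>2)"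
      using has_sum_imp_sums has_sum_infsum sums_summable by blast
    then have "summable (\<lambda>j. (1 / norm_const\<^sup>2) * (rho_hat H (real (Suc j)))\<^sup>2)"
      by (simp add: same_corr_def power_divide)
    then show "summable (\<lambda>j. (rho_hat H (real (Suc j)))\<^sup>2)"
      using norm_const_pos by (subst (asm) summable_cmult_iff) auto
  qed
  finally show ?thesis by (simp add: Sigma11_def norm_const_def same_corr_0)
qed

lemma Sigma12_eq: "Sigma12 H = cross_limit"
proof -
  have "(2 powr H)\<^sup>2 = (2::real) powr (2 * H)" by (simp add: power2_eq_square powr_add[symmetric])
  then have "cross_limit = (\<Sum>\<^sub>\<infinity>m. (1 / (2 powr (2 * H) * norm_const\<^sup>2)) * (rho_tilde H (of_int m))\<^sup>2)"
    by (simp add: cross_limit_def cross_corr_def power_divide power_mult_distrib)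
  also have "\<dots> = (1 / (2 powr (2 * H) * norm_const\<^sup>2)) * (\<Sum>\<^sub>\<infinity>m::int. (rho_tilde H (of_int m))\<^sup>2)"
    by (rule infsum_cmult_right')
  finally show ?thesis by (simp add: Sigma12_def norm_const_def)
qed

text \<open>
  The increments on both grids as one family: the index \<open>(i, k)\<close> stands for the \<open>k\<close>-th
  increment on the grid with \<open>i n\<close> intervals.
\<close>

definition level_index :: "nat \<Rightarrow> (nat \<times> nat) set" where
  "level_index n = (SIGMA i:{1, 2}. {1..i * n - 1})"

definition level_incr :: "nat \<Rightarrow> nat \<times> nat \<Rightarrow> 'a \<Rightarrow> real" where
  "level_incr n = (\<lambda>(i, k). incr (i * n) k)"

definition level_weight :: "real \<Rightarrow> real \<Rightarrow> nat \<Rightarrow> nat \<times> nat \<Rightarrow> real" where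
  "level_weight c1 c2 n = (\<lambda>(i, k). (if i = 1 then c1 else c2) / sqrt (real n))"

definition centered_var :: "nat \<Rightarrow> 'a \<Rightarrow> real" where
  "centered_var N w = quad_var2 T H N X w - expectation (quad_var2 T H N X)"

lemma sum_level_index:
  "(\<Sum>p\<in>level_index n. f p) = (\<Sum>k=1..n - 1. f (1, k)) + (\<Sum>k=1..2 * n - 1. f (2, k))" for f :: "nat \<times> nat \<Rightarrow> real"
  using sum.Sigma[of "{1, 2}" "\<lambda>i. {1..i * n - 1}" "\<lambda>i k. f (i, k)"] by (simp add: level_index_def)

lemma finite_level_index: "finite (level_index n)" by (auto simp: level_index_def)

lemma level_incr_L: "p \<in> level_index n \<Longrightarrow> level_incr n p \<in> L"
  unfolding level_index_def level_incr_def by (auto intro!: normalized_diff2_L)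

text \<open>
  Any combination of the two centred quadratic variations is one diagonal quadratic form of
  size \<open>1/\<surd>n\<close>.
\<close>

lemma quad_level:
  "quad (level_index n) (level_incr n) (level_weight c1 c2 n) w
     = (c1 * centered_var n w + c2 * centered_var (2 * n) w) / sqrt (real n)"
proof -
  have E: "expectation (quad_var2 T H N X) = (\<Sum>k=1..N - 1. expectation (\<lambda>w. (incr N k w)\<^sup>2))" for N
    unfolding quad_var2_def[abs_def]
    by (intro Bochner_Integration.integral_sum integrable_moments all_moments_power L_all_moments normalized_diff2_L finite_M) auto
  show ?thesis
    unfolding quad_def sum_level_index centered_var_def E
    by (simp add: level_incr_def level_weight_def quad_var2_def sum_subtractf[symmetric]
        sum_divide_distrib sum_distrib_left add_divide_distrib)
qed

lemma level_row_sum: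
  assumes "p \<in> level_index n"
  shows "(\<Sum>r\<in>level_index n. \<bar>gram (level_incr n) p r\<bar>) \<le> 20 * decay_const"
proof -
  obtain i k where p: "p = (i, k)" and i: "i = 1 \<or> i = 2" and k: "1 \<le> k" "k \<le> i * n - 1"
    using assms by (auto simp: level_index_def)
  let ?nd = "normalized_diff2 T H"
  show ?thesis
  proof (cases "i = 1")
    case True
    have "(\<Sum>l=1..2 * n - 1. \<bar>expectation (\<lambda>w. ?nd n k X w * ?nd (2 * n) l X w)\<bar>)
      = (\<Sum>l=1..2 * n - 1. \<bar>cross_corr (int (2 * k) - int l) + \<epsilon> * cross_corr (int (2 * k) + int l)\<bar>)"
      by (intro sum.cong refl arg_cong[of _ _ abs] moment_cross) (use k True in auto)
    also have "\<dots> \<le> 10 * decay_const" by (intro decay_pair_sum[OF cross_corr_decay]) (auto simp: inj_on_def)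
    finally show ?thesis
      using same_level_sum[of k n] k True unfolding sum_level_index p by (simp add: level_incr_def)
  next
    case False
    then have i: "i = 2" using i by simp
    have "(\<Sum>l=1..n - 1. \<bar>expectation (\<lambda>w. ?nd (2 * n) k X w * ?nd n l X w)\<bar>)
      = (\<Sum>l=1..n - 1. \<bar>cross_corr (int (2 * l) - int k) + \<epsilon> * cross_corr (int (2 * l) + int k)\<bar>)"
      unfolding mult.commute[of "?nd (2 * n) k X _"]
      by (intro sum.cong refl arg_cong[of _ _ abs] moment_cross) (use k i in auto)
    also have "\<dots> \<le> 10 * decay_const" by (intro decay_pair_sum[OF cross_corr_decay]) (auto simp: inj_on_def)
    finally show ?thesis
      using same_level_sum[of k "2 * n"] k i unfolding sum_level_index p by (simp add: level_incr_def)
  qed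
qed

lemma bounded_quad_level:
  assumes "\<bar>c1\<bar> \<le> 1" "\<bar>c2\<bar> \<le> 1"
  shows "bounded_quad 3 (20 * decay_const) (1 / sqrt (real n)) (level_index n) (level_incr n) (level_weight c1 c2 n)"
proof -
  have "real (card (level_index n)) = (\<Sum>p\<in>level_index n. 1)" by simp
  also have "\<dots> \<le> 3 * real n" unfolding sum_level_index by simp
  finally have card: "real (card (level_index n)) \<le> 3 * real n" .
  have "(1 / sqrt (real n))\<^sup>2 * card (level_index n) \<le> 3"
    using card by (cases "n = 0") (auto simp: power_divide divide_simps)
  moreover have "1 / sqrt (real n) \<le> 1" by (cases "n = 0") auto
  moreover have "\<bar>level_weight c1 c2 n p\<bar> \<le> 1 / sqrt (real n)" for p
    using assms by (auto simp: level_weight_def intro!: divide_right_mono split: prod.split)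
  ultimately show ?thesis
    using finite_level_index level_incr_L level_row_sum decay_const_nonneg
    unfolding bounded_quad_def by auto
qed

lemma centered_var_moments: "centered_var N \<in> all_moments M"
  unfolding centered_var_def[abs_def] quad_var2_def[abs_def]
  by (intro all_moments_closure finite_M L_all_moments normalized_diff2_L) auto

lemma eighth_moment_bounded:
  assumes "i \<in> {1, 2}"
  shows "\<exists>B. \<forall>n. expectation (\<lambda>w. (centered_var (i * n) w / sqrt (real n)) ^ 8) \<le> B"
proof -
  define c1 c2 :: real where "c1 = (if i = 1 then 1 else 0)" and "c2 = (if i = 2 then 1 else 0)"
  have "\<bar>c1\<bar> \<le> 1" "\<bar>c2\<bar> \<le> 1" by (auto simp: c1_def c2_def)
  note b = bounded_quad_level[OF this]
  have e: "quad (level_index n) (level_incr n) (level_weight c1 c2 n) w = centered_var (i * n) w / sqrt (real n)" for n w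
    unfolding quad_level using assms by (auto simp: c1_def c2_def)
  obtain B where "\<And>\<alpha> (K :: (nat \<times> nat) set) \<xi> l. bounded_quad 3 (20 * decay_const) \<alpha> K \<xi> l \<Longrightarrow> \<bar>quad_moment K \<xi> l 8\<bar> \<le> B"
    using quad_moments_bounded[of 3 "20 * decay_const", where 'i="nat \<times> nat" and m=8] decay_const_nonneg by (simp del: power_numeral) blast
  from this[OF b] show ?thesis unfolding e by (intro exI[of _ B]) (auto dest: abs_le_D1)
qed

text \<open>
  The \<open>p\<close>-th power of the expression has expectation \<open>O(n\<^sup>-\<^sup>p\<^sup>/\<^sup>2)\<close>, which is not summable
  for \<open>p = 1\<close> and \<open>p = 2\<close>. The fourth power is taken, since then bounded eighth moments give
  a summable sequence.
\<close>

lemma AE_scaled_square_tendsto: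
  assumes "i \<in> {1, 2}"
  shows "AE w in M. (\<lambda>n. sqrt (real n) * (centered_var (i * n) w / real (i * n))\<^sup>2) \<longlonglongrightarrow> 0"
proof -
  obtain B where B: "\<And>n. expectation (\<lambda>w. (centered_var (i * n) w / sqrt (real n)) ^ 8) \<le> B"
    using eighth_moment_bounded[OF assms] by auto
  define Z where "Z n w = (1 / (real n)\<^sup>2) * (centered_var (i * n) w / sqrt (real n)) ^ 8" for n w
  have "(\<lambda>w. (centered_var (i * n) w * (1 / sqrt (real n))) ^ 8) \<in> all_moments M" for n
    by (intro all_moments_closure centered_var_moments finite_M)
  then have int: "integrable M (\<lambda>w. (centered_var (i * n) w / sqrt (real n)) ^ 8)" for n
    using integrable_moments by simp
  have "AE w in M. (\<lambda>n. Z n w) \<longlonglongrightarrow> 0"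
  proof (rule AE_tendsto_0_of_summable_expectation)
    show "integrable M (Z n)" for n unfolding Z_def[abs_def] using int by simp
    show "0 \<le> Z n w" for n w by (simp add: Z_def zero_le_even_power)
    show "expectation (Z n) \<le> (1 / (real n)\<^sup>2) * B" for n
      unfolding Z_def[abs_def] integral_mult_right_zero by (intro mult_left_mono B) auto
    show "summable (\<lambda>n. (1 / (real n)\<^sup>2) * B)"
      using inverse_power_summable[of 2, where 'a=real] by (intro summable_mult2) (simp add: inverse_eq_divide)
  qed
  then show ?thesis
  proof eventually_elim
    case (elim w)
    have "(\<lambda>n. root 4 (Z n w)) \<longlonglongrightarrow> root 4 0" by (intro tendsto_real_root elim)
    then have "(\<lambda>n. root 4 (Z n w)) \<longlonglongrightarrow> 0" by simp
    then have "(\<lambda>n. (1 / (real i)\<^sup>2) * root 4 (Z n w)) \<longlonglongrightarrow> 0" by (rule tendsto_mult_right_zero)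
    moreover have "(1 / (real i)\<^sup>2) * root 4 (Z n w) = sqrt (real n) * (centered_var (i * n) w / real (i * n))\<^sup>2" for n
    proof (cases "n = 0")
      case False
      define s where "s = sqrt (real n)"
      have s: "0 < s" "real n = s * s" using False by (auto simp: s_def)
      define x where "x = centered_var (i * n) w"
      have "Z n w = (x\<^sup>2 / (s * s * s)) ^ 4"
        unfolding Z_def x_def[symmetric] s_def[symmetric] unfolding s(2) using s(1)
        by (simp add: divide_simps)
      then have R: "root 4 (Z n w) = x\<^sup>2 / (s * s * s)"
        using s(1) by (simp add: real_root_power_cancel)
      have S: "sqrt (real n) * (centered_var (i * n) w / real (i * n))\<^sup>2 = s * (x / (real i * (s * s)))\<^sup>2"
        using s(2) by (simp add: x_def s_def)
      have "i \<noteq> 0" using assms by auto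
      then show ?thesis unfolding R S using s(1) by (simp add: power2_eq_square field_simps)
    qed (simp add: Z_def)
    ultimately show ?case by simp
  qed
qed

abbreviation level_diff :: "nat \<Rightarrow> 'a \<Rightarrow> real" where
  "level_diff n \<equiv> quad (level_index n) (level_incr n) (level_weight 1 (- 1 / 2) n)"

text \<open>
  The weights \<open>1\<close> and \<open>-1/2\<close> are those of the difference of the means \<open>V\<^sub>n/n - V\<^sub>2\<^sub>n/(2n)\<close>,
  to which the estimator is linearised.
\<close>

lemma variance_limit:
  "(\<lambda>n. quad_moment (level_index n) (level_incr n) (level_weight 1 (- 1 / 2) n) 2) \<longlonglongrightarrow> sigma_sq H"
proof -
  define c where "c i j n = 1 / real n * covariance M (\<lambda>w. quad_var2 T H (i * n) X w / real i)
             (\<lambda>w. quad_var2 T H (j * n) X w / real j)" for i j n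
  have lim: "(\<lambda>n. c 1 1 n + c 2 2 n - 2 * c 1 2 n) \<longlonglongrightarrow> cov_limit 1 1 + cov_limit 2 2 - 2 * cov_limit 1 2"
    unfolding c_def by (intro tendsto_intros covariance_limit) auto
  have c: "c i j n = 1 / real n * expectation (\<lambda>w. (centered_var (i * n) w / real i) * (centered_var (j * n) w / real j))" for i j n
    unfolding c_def covariance_def centered_var_def by (simp add: diff_divide_distrib)
  have eq: "quad_moment (level_index n) (level_incr n) (level_weight 1 (- 1 / 2) n) 2 = c 1 1 n + c 2 2 n - 2 * c 1 2 n" for n
  proof -
    define x where "x = centered_var n"
    define y where "y = (\<lambda>w. centered_var (2 * n) w / 2)"
    have my: "y \<in> all_moments M" using all_moments_cmult[OF finite_M centered_var_moments, of "1/2" "2 * n"] by (simp add: y_def)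
    have mx: "x \<in> all_moments M" by (simp add: x_def centered_var_moments)
    have [simp]: "integrable M (\<lambda>w. x w * x w)" "integrable M (\<lambda>w. x w * y w)" "integrable M (\<lambda>w. y w * y w)"
      by (intro integrable_moments all_moments_mult mx my)+
    have "quad_moment (level_index n) (level_incr n) (level_weight 1 (- 1 / 2) n) 2
       = expectation (\<lambda>w. (1 / real n) * (x w * x w + y w * y w - 2 * (x w * y w)))"
      unfolding quad_level
      by (intro Bochner_Integration.integral_cong refl)
         (simp add: x_def y_def power_divide power2_eq_square field_simps)
    also have "\<dots> = (1 / real n) * (expectation (\<lambda>w. x w * x w) + expectation (\<lambda>w. y w * y w) - 2 * expectation (\<lambda>w. x w * y w))"
      by simp
    also have "\<dots> = c 1 1 n + c 2 2 n - 2 * c 1 2 n"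
      unfolding c by (simp add: x_def y_def algebra_simps)
    finally show ?thesis .
  qed
  have "cov_limit 1 1 + cov_limit 2 2 - 2 * cov_limit 1 2 = sigma_sq H"
    by (simp add: cov_limit_def sigma_sq_def Sigma11_eq Sigma12_eq)
  then show ?thesis using lim unfolding eq by simp
qed

lemma sigma_sq_nonneg: "0 \<le> sigma_sq H"
  by (rule tendsto_lowerbound[OF variance_limit]) (auto intro!: always_eventually)

lemma char_level_limit:
  "(\<lambda>n. char (distr M borel (level_diff n)) t)
     \<longlonglongrightarrow> char (normal_law 0 (sigma_sq H)) t"
proof (rule char_tendsto_normal_law)
  show "level_diff n \<in> all_moments M" for n
    by (intro quad_all_moments level_incr_L)
  have "(\<lambda>n. 1 / sqrt (real n)) \<longlonglongrightarrow> 0"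
    using tendsto_real_sqrt[OF lim_1_over_n[where 'a=real]] by (simp add: real_sqrt_divide)
  then show "(\<lambda>n. quad_moment (level_index n) (level_incr n) (level_weight 1 (- 1 / 2) n) k)
      \<longlonglongrightarrow> gauss_moment k * sqrt (sigma_sq H) ^ k" for k
    by (intro quad_moments_tendsto[OF bounded_quad_level _ sigma_sq_nonneg variance_limit]) auto
qed (rule sigma_sq_nonneg)

definition mean_var :: "nat \<Rightarrow> nat \<Rightarrow> 'a \<Rightarrow> real" where
  "mean_var i n w = quad_var2 T H (i * n) X w / real (i * n)"

lemma AE_mean_var:
  assumes "i \<in> {1, 2}"
  shows "AE w in M. (\<lambda>n. sqrt (real n) * (mean_var i n w - 1)\<^sup>2) \<longlonglongrightarrow> 0 \<and> (\<lambda>n. mean_var i n w) \<longlonglongrightarrow> 1"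
  using AE_scaled_square_tendsto[OF assms]
proof eventually_elim
  case (elim w)
  define m where "m n = expectation (quad_var2 T H (i * n) X) / real (i * n) - 1" for n
  define y where "y n = centered_var (i * n) w / real (i * n)" for n
  have sm: "(\<lambda>n. sqrt (real n) * m n) \<longlonglongrightarrow> 0"
    unfolding m_def using assms by (intro expectation_quad_var2_limit) auto
  have sq_ge: "1 \<le> sqrt (real n)" if "1 \<le> n" for n using that by simp
  have m0: "(\<lambda>n. sqrt (real n) * (m n)\<^sup>2) \<longlonglongrightarrow> 0"
  proof (rule Lim_null_comparison)
    show "(\<lambda>n. (sqrt (real n) * m n) * (sqrt (real n) * m n)) \<longlonglongrightarrow> 0"
      using tendsto_mult[OF sm sm] by simp
    show "\<forall>\<^sub>F n in sequentially. norm (sqrt (real n) * (m n)\<^sup>2) \<le> (sqrt (real n) * m n) * (sqrt (real n) * m n)"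
    proof (rule eventually_sequentiallyI[of 1])
      fix n :: nat assume n: "1 \<le> n"
      have "sqrt (real n) * 1 * (m n)\<^sup>2 \<le> sqrt (real n) * sqrt (real n) * (m n)\<^sup>2"
        using sq_ge[OF n] by (intro mult_right_mono mult_left_mono) auto
      also have "\<dots> = (sqrt (real n) * m n) * (sqrt (real n) * m n)"
        by (simp only: power2_eq_square mult_ac)
      finally show "norm (sqrt (real n) * (m n)\<^sup>2) \<le> (sqrt (real n) * m n) * (sqrt (real n) * m n)"
        by (simp only: real_norm_def abs_mult abs_power2 real_sqrt_abs2 abs_of_nonneg[OF real_sqrt_ge_zero[OF of_nat_0_le_iff]] mult_1_right)
    qed
  qed
  have dec: "mean_var i n w - 1 = y n + m n" for n
    unfolding mean_var_def y_def m_def centered_var_def by (simp add: diff_divide_distrib)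
  have main: "(\<lambda>n. sqrt (real n) * (mean_var i n w - 1)\<^sup>2) \<longlonglongrightarrow> 0"
  proof (rule Lim_null_comparison)
    show "(\<lambda>n. 2 * (sqrt (real n) * (y n)\<^sup>2) + 2 * (sqrt (real n) * (m n)\<^sup>2)) \<longlonglongrightarrow> 0"
      using tendsto_add[OF tendsto_mult_right_zero[OF elim[folded y_def], of 2] tendsto_mult_right_zero[OF m0, of 2]]
      by simp
    show "\<forall>\<^sub>F n in sequentially. norm (sqrt (real n) * (mean_var i n w - 1)\<^sup>2)
       \<le> 2 * (sqrt (real n) * (y n)\<^sup>2) + 2 * (sqrt (real n) * (m n)\<^sup>2)"
    proof (intro always_eventually allI)
      fix n
      have "0 \<le> (y n - m n)\<^sup>2" by simp
      then have "(y n + m n)\<^sup>2 \<le> 2 * (y n)\<^sup>2 + 2 * (m n)\<^sup>2" unfolding power2_diff power2_sum by linarith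
      then have "sqrt (real n) * (y n + m n)\<^sup>2 \<le> sqrt (real n) * (2 * (y n)\<^sup>2 + 2 * (m n)\<^sup>2)" by (intro mult_left_mono) auto
      then show "norm (sqrt (real n) * (mean_var i n w - 1)\<^sup>2)
         \<le> 2 * (sqrt (real n) * (y n)\<^sup>2) + 2 * (sqrt (real n) * (m n)\<^sup>2)"
        unfolding dec by (simp add: algebra_simps)
    qed
  qed
  have "(\<lambda>n. (mean_var i n w - 1)\<^sup>2) \<longlonglongrightarrow> 0"
  proof (rule Lim_null_comparison[OF _ main])
    show "\<forall>\<^sub>F n in sequentially. norm ((mean_var i n w - 1)\<^sup>2) \<le> sqrt (real n) * (mean_var i n w - 1)\<^sup>2"
    proof (rule eventually_sequentiallyI[of 1])
      fix n :: nat assume n: "1 \<le> n"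
      have "1 * (mean_var i n w - 1)\<^sup>2 \<le> sqrt (real n) * (mean_var i n w - 1)\<^sup>2"
        using sq_ge[OF n] by (intro mult_right_mono) auto
      then show "norm ((mean_var i n w - 1)\<^sup>2) \<le> sqrt (real n) * (mean_var i n w - 1)\<^sup>2" by simp
    qed
  qed
  then have "(\<lambda>n. mean_var i n w - 1) \<longlonglongrightarrow> 0" by (simp add: tendsto_power_zero power_tendsto_0_iff)
  then have "(\<lambda>n. mean_var i n w) \<longlonglongrightarrow> 1" by (simp add: LIM_zero_iff)
  with main show ?case by simp
qed

lemma sum_diff2_squares:
  assumes "1 \<le> N"
  shows "(\<Sum>k=1..N - 1. (diff2 T N k X w)\<^sup>2) = norm_const * (T / real N) powr (2 * H) * quad_var2 T H N X w"
proof -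
  define d where "d = T / real N"
  have d: "0 < d" using assms T_pos by (simp add: d_def)
  have dd: "(d powr H)\<^sup>2 = d powr (2 * H)" by (simp add: power2_eq_square powr_add[symmetric])
  have "(diff2 T N k X w)\<^sup>2 = norm_const * d powr (2 * H) * (incr N k w)\<^sup>2" for k
    unfolding normalized_diff2_def norm_const_def[symmetric] d_def[symmetric]
    using norm_const_pos d by (simp add: power_divide power_mult_distrib dd)
  then show ?thesis by (simp add: quad_var2_def sum_distrib_left d_def)
qed

text \<open>
  The ratio of the two sums of squares is \<open>2\<^sup>1\<^sup>-\<^sup>2\<^sup>H\<close> times the ratio of the normalised
  variations, so the normalisation by \<open>H\<close> becomes the additive constant \<open>H\<close>.
\<close>

lemma gamma_hat_eq:
  assumes "1 \<le> n" "0 < mean_var 1 n w" "0 < mean_var 2 n w"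
  shows "gamma_hat T X n w = H + (ln (mean_var 1 n w) - ln (mean_var 2 n w)) / (2 * ln 2)"
proof -
  define d where "d = T / real (2 * n)"
  have d: "0 < d" using assms T_pos by (simp add: d_def)
  have d2: "T / real n = 2 * d" by (simp add: d_def)
  define a b where "a = mean_var 2 n w" and "b = mean_var 1 n w"
  have pos: "0 < a" "0 < b" using assms by (auto simp: a_def b_def)
  have V: "quad_var2 T H (2 * n) X w = 2 * real n * a" "quad_var2 T H n X w = real n * b"
    using assms(1) by (auto simp: a_def b_def mean_var_def)
  have "(\<Sum>k = 1..2 * n - 1. (diff2 T (2 * n) k X w)\<^sup>2) / (\<Sum>k = 1..n - 1. (diff2 T n k X w)\<^sup>2)
    = (norm_const * d powr (2 * H) * (2 * real n * a)) / (norm_const * (2 * d) powr (2 * H) * (real n * b))"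
    using assms(1) by (subst (1 2) sum_diff2_squares) (auto simp: V d_def[symmetric] d2 simp del: of_nat_mult)
  also have "\<dots> = 2 * a / (2 powr (2 * H) * b)"
    using d norm_const_pos assms(1) by (simp add: powr_mult)
  finally have "ln ((\<Sum>k = 1..2 * n - 1. (diff2 T (2 * n) k X w)\<^sup>2) / (\<Sum>k = 1..n - 1. (diff2 T n k X w)\<^sup>2))
     = ln 2 + ln a - (2 * H * ln 2 + ln b)"
    using pos by (simp add: ln_div ln_mult ln_powr)
  then show ?thesis unfolding gamma_hat_def a_def[symmetric] b_def[symmetric]
    by (simp add: field_simps)
qed

lemma AE_gamma_hat: "AE w in M. (\<lambda>n. gamma_hat T X n w) \<longlonglongrightarrow> H"
  using AE_mean_var[OF insertI1] AE_mean_var[OF insertI2[OF singletonI]]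
proof eventually_elim
  case (elim w)
  have lim: "(\<lambda>n. H + (ln (mean_var 1 n w) - ln (mean_var 2 n w)) / (2 * ln 2)) \<longlonglongrightarrow> H + (ln 1 - ln 1) / (2 * ln 2)"
    using elim by (intro tendsto_intros) auto
  have "\<forall>\<^sub>F n in sequentially. 0 < mean_var 1 n w" "\<forall>\<^sub>F n in sequentially. 0 < mean_var 2 n w"
    using elim by (auto intro: order_tendstoD(1)[where y=1])
  then have "\<forall>\<^sub>F n in sequentially. H + (ln (mean_var 1 n w) - ln (mean_var 2 n w)) / (2 * ln 2) = gamma_hat T X n w"
    using eventually_ge_at_top[of 1] by eventually_elim (simp add: gamma_hat_eq)
  from Lim_transform_eventually[OF lim this] show ?case by simp
qed

lemma gamma_hat_measurable: "gamma_hat T X n \<in> borel_measurable M"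
proof -
  have [measurable]: "diff2 T N k X \<in> borel_measurable M" if "k \<in> {1..N - 1}" for N k
    using that by (intro measurable_L diff2_L) auto
  show ?thesis unfolding gamma_hat_def[abs_def] by measurable
qed

text \<open>
  The delta method: \<open>\<bar>ln x - (x - 1)\<bar> \<le> 2 (x - 1)\<^sup>2\<close> near \<open>1\<close>, and \<open>\<surd>n\<close> times the squared
  errors vanishes almost surely. Centring at the expectations instead of at \<open>1\<close> changes the
  statistic by a null sequence.
\<close>

lemma AE_linearization:
  "AE w in M. (\<lambda>n. 2 * ln 2 * sqrt (real n) * (gamma_hat T X n w - H)
      - level_diff n w) \<longlonglongrightarrow> 0"
  using AE_mean_var[OF insertI1] AE_mean_var[OF insertI2[OF singletonI]]
proof eventually_elim
  case (elim w)
  define r where "r x = ln x - (x - 1)" for x :: real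
  define m where "m i n = sqrt (real n) * (expectation (quad_var2 T H (i * n) X) / real (i * n) - 1)" for i n
  have m: "m i \<longlonglongrightarrow> 0" if "1 \<le> i" for i
    unfolding m_def using expectation_quad_var2_limit[OF that] .
  have r: "(\<lambda>n. sqrt (real n) * r (mean_var i n w)) \<longlonglongrightarrow> 0" if i: "i \<in> {1, 2}" for i
  proof -
    have a: "(\<lambda>n. sqrt (real n) * (mean_var i n w - 1)\<^sup>2) \<longlonglongrightarrow> 0" and b: "(\<lambda>n. mean_var i n w) \<longlonglongrightarrow> 1"
      using elim i by auto
    show ?thesis
    proof (rule Lim_null_comparison)
      show "(\<lambda>n. 2 * (sqrt (real n) * (mean_var i n w - 1)\<^sup>2)) \<longlonglongrightarrow> 0"
        using a by (rule tendsto_mult_right_zero)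
      have "\<forall>\<^sub>F n in sequentially. dist (mean_var i n w) 1 < 1 / 2" by (rule tendstoD[OF b]) simp
      then show "\<forall>\<^sub>F n in sequentially. norm (sqrt (real n) * r (mean_var i n w)) \<le> 2 * (sqrt (real n) * (mean_var i n w - 1)\<^sup>2)"
      proof eventually_elim
        case (elim n)
        have "\<bar>r (mean_var i n w)\<bar> \<le> 2 * (mean_var i n w - 1)\<^sup>2"
          using abs_ln_one_plus_x_minus_x_bound[of "mean_var i n w - 1"] elim by (simp add: r_def dist_real_def)
        then have "sqrt (real n) * \<bar>r (mean_var i n w)\<bar> \<le> sqrt (real n) * (2 * (mean_var i n w - 1)\<^sup>2)"
          by (intro mult_left_mono) auto
        then show ?case by (simp add: abs_mult)
      qed
    qed
  qed
  have lim: "(\<lambda>n. sqrt (real n) * r (mean_var 1 n w) - sqrt (real n) * r (mean_var 2 n w) + m 1 n - m 2 n) \<longlonglongrightarrow> 0 - 0 + 0 - 0"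
    by (intro tendsto_intros r m) auto
  have "\<forall>\<^sub>F n in sequentially. 0 < mean_var 1 n w" "\<forall>\<^sub>F n in sequentially. 0 < mean_var 2 n w"
    using elim by (auto intro: order_tendstoD(1)[where y=1])
  then have "\<forall>\<^sub>F n in sequentially.
     sqrt (real n) * r (mean_var 1 n w) - sqrt (real n) * r (mean_var 2 n w) + m 1 n - m 2 n
     = 2 * ln 2 * sqrt (real n) * (gamma_hat T X n w - H)
      - level_diff n w"
    using eventually_ge_at_top[of 1]
  proof eventually_elim
    case (elim n)
    define s where "s = sqrt (real n)"
    have s: "0 < s" "real n = s * s" using elim by (auto simp: s_def)
    have "2 * ln 2 * s * (gamma_hat T X n w - H) = s * (ln (mean_var 1 n w) - ln (mean_var 2 n w))"
      using elim by (simp add: gamma_hat_eq)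
    moreover have "level_diff n w
       = s * (mean_var 1 n w - 1) - s * (mean_var 2 n w - 1) - m 1 n + m 2 n"
      unfolding quad_level mean_var_def m_def centered_var_def s_def[symmetric]
      using s by (simp add: field_simps)
    ultimately show ?case unfolding s_def[symmetric] r_def by (simp add: algebra_simps)
  qed
  from Lim_transform_eventually[OF lim this] show ?case by simp
qed

lemma gamma_hat_clt:
  "weak_conv_m (\<lambda>n. distr M borel (\<lambda>w. 2 * ln 2 * sqrt (real n) * (gamma_hat T X n w - H)))
     (normal_law 0 (sigma_sq H))"
proof (rule weak_conv_of_char_and_AE_diff[OF _ _ AE_linearization real_distribution_normal_law[OF sigma_sq_nonneg] char_level_limit])
  show "(\<lambda>w. 2 * ln 2 * sqrt (real n) * (gamma_hat T X n w - H)) \<in> borel_measurable M" for n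
    using gamma_hat_measurable[of n] by measurable
  show "level_diff n \<in> borel_measurable M" for n
    by (intro all_moments_measurable quad_all_moments level_incr_L)
qed

end

section \<open>Functions in the class Psi\<close>

lemma nn_integral_lebesgue_scale:
  assumes [measurable]: "g \<in> borel_measurable lebesgue" and a: "0 < (a::real)"
  shows "(\<integral>\<^sup>+c. g (a * c) \<partial>lebesgue) = ennreal (1 / a) * (\<integral>\<^sup>+y. g y \<partial>lebesgue)"
proof -
  have "(\<integral>\<^sup>+y. g y \<partial>lebesgue) = ennreal a * (\<integral>\<^sup>+c. g (a * c) \<partial>lebesgue)"
    using nn_integral_real_affine_lebesgue[OF assms(1), of a 0] a by simp
  then show ?thesis
    using a by (simp add: mult.assoc[symmetric] ennreal_mult[symmetric])
qed

text \<open>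
  Halving the argument eventually multiplies \<open>f\<close> by nearly \<open>1/2\<close>, in particular by less than
  \<open>3/4\<close>.
\<close>

lemma regularly_varying_dyadic:
  assumes rv: "regularly_varying_at_zero T 1 f" and T: "0 < T"
  shows "\<exists>\<delta>>0. \<forall>y. 0 < y \<and> y < \<delta> \<longrightarrow> (\<lambda>k. f ((1 / 2) ^ k * y)) \<longlonglongrightarrow> 0"
proof -
  have pos: "0 < f x" if "0 < x" "x < T" for x using rv that by (auto simp: regularly_varying_at_zero_def)
  have "((\<lambda>h. f ((1 / 2) * h) / f h) \<longlongrightarrow> (1 / 2) powr 1) (at_right 0)"
    using rv unfolding regularly_varying_at_zero_def by (elim conjE allE[of _ "1 / 2"]) simp
  then have "\<forall>\<^sub>F h in at_right 0. f ((1 / 2) * h) / f h < 3 / 4"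
    by (rule order_tendstoD(2)) simp
  then obtain \<delta>0 where \<delta>0: "0 < \<delta>0" "\<And>h. 0 < h \<Longrightarrow> h < \<delta>0 \<Longrightarrow> f ((1 / 2) * h) / f h < 3 / 4"
    unfolding eventually_at_right_field by auto
  define \<delta> where "\<delta> = min \<delta>0 T"
  have half: "f (h / 2) \<le> (3 / 4) * f h" if "0 < h" "h < \<delta>" for h
    using \<delta>0(2)[of h] pos[of h] that by (simp add: \<delta>_def pos_divide_less_eq)
  have "(\<lambda>k. f ((1 / 2) ^ k * y)) \<longlonglongrightarrow> 0" if y: "0 < y" "y < \<delta>" for y
  proof (rule Lim_null_comparison)
    have inr: "0 < (1 / 2) ^ k * y" "(1 / 2) ^ k * y < \<delta>" for k
    proof -
      have "(1 / 2) ^ k * y \<le> 1 * y" using y by (intro mult_right_mono power_le_one) auto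
      then show "(1 / 2) ^ k * y < \<delta>" using y by linarith
    qed (use y in auto)
    have "f ((1 / 2) ^ k * y) \<le> (3 / 4) ^ k * f y" for k
    proof (induction k)
      case (Suc k)
      have "f ((1 / 2) ^ Suc k * y) = f (((1 / 2) ^ k * y) / 2)" by simp
      also have "\<dots> \<le> (3 / 4) * f ((1 / 2) ^ k * y)" by (rule half[OF inr])
      also have "\<dots> \<le> (3 / 4) * ((3 / 4) ^ k * f y)" using Suc by simp
      finally show ?case by simp
    qed simp
    moreover have "0 < f ((1 / 2) ^ k * y)" for k using pos[of "(1 / 2) ^ k * y"] inr[of k] by (simp add: \<delta>_def)
    ultimately show "\<forall>\<^sub>F k in sequentially. norm (f ((1 / 2) ^ k * y)) \<le> (3 / 4) ^ k * f y"
      by (intro always_eventually allI) (simp add: abs_of_pos)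
    show "(\<lambda>k. (3 / 4) ^ k * f y) \<longlonglongrightarrow> 0"
      by (intro tendsto_mult_left_zero LIMSEQ_power_zero) simp
  qed
  then show ?thesis using \<delta>0 T by (intro exI[of _ \<delta>]) (auto simp: \<delta>_def)
qed

text \<open>
  The convergence along \<open>y/2\<^sup>k\<close> is uniform in \<open>y\<close> only by the uniform convergence theorem
  for regularly varying functions, of which this is a weak form. If \<open>f(h\<^sub>m) \<ge> \<epsilon>\<close> along
  \<open>h\<^sub>m \<rightarrow> 0\<close>, then by regular variation and dominated convergence the averages of \<open>min 1 f\<close>
  over \<open>[h\<^sub>m, 2h\<^sub>m]\<close> stay away from \<open>0\<close>. But after rescaling by a power of \<open>2\<close> such an
  average is dominated by an average of \<open>min 1 (f(y/2\<^sup>k))\<close> over a fixed interval, which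
  tends to \<open>0\<close> by dominated convergence.
\<close>

lemma regularly_varying_tendsto_0:
  assumes rv: "regularly_varying_at_zero T 1 f" and T: "0 < T"
  shows "(f \<longlongrightarrow> 0) (at_right 0)"
proof (rule ccontr)
  assume not: "\<not> (f \<longlongrightarrow> 0) (at_right 0)"
  have pos: "0 < f x" if "0 < x" "x < T" for x using rv that by (auto simp: regularly_varying_at_zero_def)
  obtain \<delta> where \<delta>: "0 < \<delta>" "\<And>y. 0 < y \<Longrightarrow> y < \<delta> \<Longrightarrow> (\<lambda>k. f ((1 / 2) ^ k * y)) \<longlonglongrightarrow> 0"
    using regularly_varying_dyadic[OF assms] by auto
  (* The interval [h0 / 2, 2 * h0] has to lie below both \<delta> and T. *)
  define h0 where "h0 = min \<delta> T / 4"
  have h0: "0 < h0" "2 * h0 < \<delta>" "2 * h0 < T" using \<delta>(1) T by (auto simp: h0_def)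
  define F where "F x = (if x \<in> {0<..<T} then f x else 0)" for x
  have F_meas: "F \<in> borel_measurable lebesgue"
    unfolding F_def[abs_def] using rv
    by (intro borel_measurable_if_I) (auto simp: regularly_varying_at_zero_def)
  have Ff: "F x = f x" if "0 < x" "x < T" for x using that by (simp add: F_def)
  have F0: "0 \<le> F x" for x using pos[of x] by (auto simp: F_def intro: less_imp_le)
  define \<phi> where "\<phi> x = min 1 (ennreal (F x))" for x
  have \<phi>_meas[measurable]: "\<phi> \<in> borel_measurable lebesgue"
    unfolding \<phi>_def[abs_def] using F_meas by measurable
  have scale: "(\<lambda>x. a * x) \<in> lebesgue \<rightarrow>\<^sub>M lebesgue" for a :: real
    using lebesgue_measurable_scaling[where 'a=real, of a] by (simp add: real_scaleR_def[abs_def])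
  define \<Phi> where "\<Phi> k = (\<integral>\<^sup>+y. \<phi> ((1 / 2) ^ k * y) * indicator {h0 / 2..2 * h0} y \<partial>lebesgue)" for k
  have \<Phi>: "\<Phi> \<longlonglongrightarrow> 0"
  proof -
    have "\<Phi> \<longlonglongrightarrow> (\<integral>\<^sup>+(y::real). 0 \<partial>lebesgue)"
      unfolding \<Phi>_def[abs_def]
    proof (rule nn_integral_dominated_convergence[where w="indicator {h0 / 2..2 * h0}"])
      show "(\<integral>\<^sup>+y. indicator {h0 / 2..2 * h0} y \<partial>lebesgue) < \<infinity>"
        by (subst nn_integral_indicator) (auto simp: emeasure_lborel_Icc_eq)
      show "AE y in lebesgue. \<phi> ((1 / 2) ^ k * y) * indicator {h0 / 2..2 * h0} y \<le> indicator {h0 / 2..2 * h0} y" for k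
        by (intro AE_I2) (auto simp: \<phi>_def indicator_def)
      show "AE y in lebesgue. (\<lambda>k. \<phi> ((1 / 2) ^ k * y) * indicator {h0 / 2..2 * h0} y) \<longlonglongrightarrow> 0"
      proof (intro AE_I2)
        fix y :: real
        show "(\<lambda>k. \<phi> ((1 / 2) ^ k * y) * indicator {h0 / 2..2 * h0} y) \<longlonglongrightarrow> 0"
        proof (cases "y \<in> {h0 / 2..2 * h0}")
          case True
          then have y: "0 < y" "y < \<delta>" "y < T" using h0 by auto
          have "(1 / 2) ^ k * y < T" for k
          proof -
            have "(1 / 2) ^ k * y \<le> 1 * y" using y by (intro mult_right_mono power_le_one) auto
            then show ?thesis using y by linarith
          qed
          then have "F ((1 / 2) ^ k * y) = f ((1 / 2) ^ k * y)" for k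
            using y by (intro Ff) auto
          then have "(\<lambda>k. ennreal (F ((1 / 2) ^ k * y))) \<longlonglongrightarrow> ennreal 0"
            using \<delta>(2)[OF y(1,2)] by (intro tendsto_ennrealI) simp
          then have "(\<lambda>k. min 1 (ennreal (F ((1 / 2) ^ k * y)))) \<longlonglongrightarrow> min 1 (ennreal 0)"
            by (intro tendsto_min tendsto_const)
          then show ?thesis using True by (simp add: \<phi>_def)
        qed simp
      qed
      show "(\<lambda>y. \<phi> ((1 / 2) ^ k * y) * indicator {h0 / 2..2 * h0} y) \<in> borel_measurable lebesgue" for k
        using measurable_compose[OF scale[of "(1 / 2) ^ k"] \<phi>_meas]
        by (intro borel_measurable_times_ennreal borel_measurable_indicator) auto
    qed (auto intro!: borel_measurable_indicator)
    then show ?thesis by simp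
  qed
  from not obtain \<epsilon> where \<epsilon>: "0 < \<epsilon>" "\<not> (\<forall>\<^sub>F h in at_right 0. dist (f h) 0 < \<epsilon>)"
    unfolding tendsto_iff by auto
  (* With e <= 1 the factor e can be pulled out of min 1 f. *)
  define e where "e = min 1 \<epsilon>"
  have e: "0 < e" "e \<le> 1" "e \<le> \<epsilon>" using \<epsilon> by (auto simp: e_def)
  have "\<exists>h. 0 < h \<and> h < h0 * (1 / 2) ^ m \<and> \<epsilon> \<le> f h" for m
  proof -
    have "0 < h0 * (1 / 2) ^ m" "h0 * (1 / 2) ^ m \<le> h0 * 1" using h0 by (auto intro!: mult_left_mono power_le_one)
    then have "\<exists>h. 0 < h \<and> h < h0 * (1 / 2) ^ m \<and> \<not> dist (f h) 0 < \<epsilon>"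
      using \<epsilon>(2) unfolding eventually_at_right_field by blast
    then obtain h where h: "0 < h" "h < h0 * (1 / 2) ^ m" "\<not> dist (f h) 0 < \<epsilon>" by blast
    moreover have "h < T" using h(2) \<open>h0 * (1 / 2) ^ m \<le> h0 * 1\<close> h0 by linarith
    then have "0 < f h" using h(1) by (intro pos)
    ultimately show ?thesis by (intro exI[of _ h]) auto
  qed
  then obtain h where h: "\<And>m. 0 < h m" "\<And>m. h m < h0 * (1 / 2) ^ m" "\<And>m. \<epsilon> \<le> f (h m)" by metis
  have hh0: "h m < h0" for m
  proof -
    have "h0 * (1 / 2) ^ m \<le> h0 * 1" using h0 by (intro mult_left_mono power_le_one) auto
    then show ?thesis using h(2)[of m] by linarith
  qed
  have "h \<longlonglongrightarrow> 0"
  proof (rule Lim_null_comparison)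
    show "(\<lambda>m. h0 * (1 / 2) ^ m) \<longlonglongrightarrow> 0" by (intro tendsto_mult_right_zero LIMSEQ_power_zero) simp
    show "\<forall>\<^sub>F m in sequentially. norm (h m) \<le> h0 * (1 / 2) ^ m"
      using h by (intro always_eventually) (auto intro: less_imp_le simp: abs_of_pos)
  qed
  moreover have "h m \<in> {0<..} \<and> h m \<noteq> 0" for m using h(1)[of m] by simp
  ultimately have h_lim: "filterlim h (at_right 0) sequentially"
    by (simp add: filterlim_at)
  define A where "A m = (\<integral>\<^sup>+c. \<phi> (h m * c) * indicator {1..2} c \<partial>lebesgue)" for m
  (* The averages over [h m, 2 * h m] are bounded away from 0. *)
  define g where "g m c = min 1 (ennreal (F (h m * c) / f (h m)))" for m c
  have g_meas: "(\<lambda>c. g m c * indicator {1..2} c) \<in> borel_measurable lebesgue" for m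
  proof -
    have "(\<lambda>x. min 1 (ennreal (x / f (h m)))) \<in> borel_measurable borel" by measurable
    from measurable_compose[OF measurable_compose[OF scale[of "h m"] F_meas] this]
    show ?thesis unfolding g_def
      by (intro borel_measurable_times_ennreal borel_measurable_indicator) auto
  qed
  have "(\<lambda>m. \<integral>\<^sup>+c. g m c * indicator {1..2} c \<partial>lebesgue) \<longlonglongrightarrow> (\<integral>\<^sup>+(c::real). indicator {1..2} c \<partial>lebesgue)"
  proof (rule nn_integral_dominated_convergence[where w="indicator {1..2}"])
    show "(\<integral>\<^sup>+(c::real). indicator {1..2} c \<partial>lebesgue) < \<infinity>" by (subst nn_integral_indicator) auto
    show "AE c in lebesgue. g m c * indicator {1..2} c \<le> indicator {1..2} c" for m
      by (intro AE_I2) (auto simp: g_def indicator_def)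
    show "AE c in lebesgue. (\<lambda>m. g m c * indicator {1..2} c) \<longlonglongrightarrow> indicator {1..2::real} c"
    proof (intro AE_I2)
      fix c :: real
      show "(\<lambda>m. g m c * indicator {1..2} c) \<longlonglongrightarrow> indicator {1..2} c"
      proof (cases "c \<in> {1..2}")
        case True
        have "((\<lambda>x. f (c * x) / f x) \<longlongrightarrow> c powr 1) (at_right 0)"
          using rv True by (auto simp: regularly_varying_at_zero_def)
        from filterlim_compose[OF this h_lim] have "(\<lambda>m. f (c * h m) / f (h m)) \<longlonglongrightarrow> c" using True by simp
        moreover have "F (h m * c) = f (c * h m)" for m
        proof -
          have "h m * c \<le> h m * 2" using True h(1)[of m] by (intro mult_left_mono) auto
          then have "h m * c < T" using hh0[of m] h0 by linarith
          then show ?thesis using h(1)[of m] True by (subst Ff) (auto simp: mult.commute)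
        qed
        ultimately have "(\<lambda>m. ennreal (F (h m * c) / f (h m))) \<longlonglongrightarrow> ennreal c" by (intro tendsto_ennrealI) simp
        then have "(\<lambda>m. g m c) \<longlonglongrightarrow> min 1 (ennreal c)" unfolding g_def by (intro tendsto_min tendsto_const)
        moreover have "min 1 (ennreal c) = 1" using True by (simp add: min_def)
        ultimately show ?thesis using True by simp
      qed simp
    qed
  qed (use g_meas in \<open>auto intro!: borel_measurable_indicator\<close>)
  moreover have "(\<integral>\<^sup>+(c::real). indicator {1..2} c \<partial>lebesgue) = 1"
    by (subst nn_integral_indicator) auto
  ultimately have glim: "(\<lambda>m. ennreal e * (\<integral>\<^sup>+c. g m c * indicator {1..2} c \<partial>lebesgue)) \<longlonglongrightarrow> ennreal e * 1"
    by (intro ennreal_tendsto_cmult) auto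
  have low: "ennreal e * (\<integral>\<^sup>+c. g m c * indicator {1..2} c \<partial>lebesgue) \<le> A m" for m
  proof -
    have "ennreal e * (\<integral>\<^sup>+c. g m c * indicator {1..2} c \<partial>lebesgue)
       = (\<integral>\<^sup>+c. ennreal e * (g m c * indicator {1..2} c) \<partial>lebesgue)"
      by (intro nn_integral_cmult[symmetric] g_meas)
    also have "\<dots> \<le> A m" unfolding A_def
    proof (intro nn_integral_mono)
      fix c
      have fh: "0 < f (h m)" "e \<le> f (h m)" using h(3)[of m] \<epsilon> e by auto
      have "e * F (h m * c) \<le> f (h m) * F (h m * c)" using fh F0 by (intro mult_right_mono)
      then have "e * (F (h m * c) / f (h m)) \<le> F (h m * c)"
        using fh by (simp add: pos_divide_le_eq mult.commute)
      then have "ennreal e * ennreal (F (h m * c) / f (h m)) \<le> ennreal (F (h m * c))"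
        using e F0 fh by (simp add: ennreal_mult[symmetric] ennreal_leI)
      moreover have "ennreal e * 1 \<le> 1" using e by (simp add: ennreal_le_1)
      moreover have "ennreal e * g m c \<le> ennreal e * ennreal (F (h m * c) / f (h m))"
        "ennreal e * g m c \<le> ennreal e * 1"
        unfolding g_def by (intro mult_left_mono; simp)+
      ultimately have "ennreal e * g m c \<le> \<phi> (h m * c)"
        unfolding \<phi>_def by (intro min.boundedI) (blast intro: order_trans)+
      then show "ennreal e * (g m c * indicator {1..2} c) \<le> \<phi> (h m * c) * indicator {1..2} c"
        by (simp add: mult.assoc[symmetric] mult_right_mono)
    qed
    finally show ?thesis .
  qed
  (* Rescaling h m by a power of 2 moves it into [h0 / 2, h0]; the interval [h m, 2 * h m] then lies
     in the fixed interval [h0 / 2, 2 * h0]. *)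
  have up: "\<exists>k\<ge>m. A m \<le> ennreal (2 / h0) * \<Phi> k" for m
  proof -
    have "\<exists>k. h0 < 2 ^ Suc k * h m"
    proof -
      obtain k where "h0 / h m < 2 ^ k" using real_arch_pow[of 2 "h0 / h m"] by auto
      then have "h0 < 2 ^ k * h m" using h(1)[of m] by (simp add: pos_divide_less_eq)
      moreover have "2 ^ k * h m \<le> 2 ^ Suc k * h m" using h(1)[of m] by (intro mult_right_mono) auto
      ultimately show ?thesis by (intro exI[of _ k]) linarith
    qed
    define k where "k = (LEAST k. h0 < 2 ^ Suc k * h m)"
    have k1: "h0 < 2 ^ Suc k * h m" unfolding k_def by (rule LeastI_ex) fact
    have k2: "2 ^ k * h m \<le> h0"
    proof (cases k)
      case 0 then show ?thesis using hh0[of m] by simp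
    next
      case (Suc k')
      then have "\<not> h0 < 2 ^ Suc k' * h m" using not_less_Least[of k' "\<lambda>k. h0 < 2 ^ Suc k * h m"] by (simp add: k_def)
      then show ?thesis using Suc by simp
    qed
    define h' where "h' = 2 ^ k * h m"
    have h': "h0 / 2 < h'" "h' \<le> h0" "h m = (1 / 2) ^ k * h'" using k1 k2 by (auto simp: h'_def power_one_over)
    have "m \<le> k"
    proof (rule ccontr)
      assume "\<not> m \<le> k"
      then have "Suc k \<le> m" by simp
      then have "(2::real) ^ Suc k \<le> 2 ^ m" by (intro power_increasing) auto
      then have "2 ^ Suc k * h m \<le> 2 ^ m * h m" using h(1)[of m] by (intro mult_right_mono) auto
      also have "\<dots> < 2 ^ m * (h0 * (1 / 2) ^ m)" using h(2)[of m] by (intro mult_strict_left_mono) auto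
      also have "\<dots> = h0" by (simp add: power_one_over)
      finally show False using k1 by simp
    qed
    moreover have "A m \<le> ennreal (2 / h0) * \<Phi> k"
    proof -
      have pos': "0 < h'" using h' h0 by linarith
      have "A m = (\<integral>\<^sup>+c. \<phi> ((1 / 2) ^ k * (h' * c)) * indicator {h'..2 * h'} (h' * c) \<partial>lebesgue)"
        unfolding A_def h'(3) using pos'
        by (intro nn_integral_cong) (auto simp: indicator_def mult.assoc)
      also have "\<dots> = ennreal (1 / h') * (\<integral>\<^sup>+y. \<phi> ((1 / 2) ^ k * y) * indicator {h'..2 * h'} y \<partial>lebesgue)"
      proof (rule nn_integral_lebesgue_scale[where g="\<lambda>y. \<phi> ((1 / 2) ^ k * y) * indicator {h'..2 * h'} y", OF _ pos'])
        show "(\<lambda>y. \<phi> ((1 / 2) ^ k * y) * indicator {h'..2 * h'} y) \<in> borel_measurable lebesgue"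
          using measurable_compose[OF scale[of "(1 / 2) ^ k"] \<phi>_meas]
          by (intro borel_measurable_times_ennreal borel_measurable_indicator) auto
      qed
      also have "\<dots> \<le> ennreal (2 / h0) * \<Phi> k"
        unfolding \<Phi>_def
      proof (rule mult_mono)
        have "1 / h' \<le> 2 / h0" using h' h0 pos' by (simp add: field_simps)
        then show "ennreal (1 / h') \<le> ennreal (2 / h0)" by (rule ennreal_leI)
        show "(\<integral>\<^sup>+y. \<phi> ((1 / 2) ^ k * y) * indicator {h'..2 * h'} y \<partial>lebesgue)
           \<le> (\<integral>\<^sup>+y. \<phi> ((1 / 2) ^ k * y) * indicator {h0 / 2..2 * h0} y \<partial>lebesgue)"
          using h' by (intro nn_integral_mono mult_left_mono) (auto simp: indicator_def)
      qed auto
      finally show ?thesis .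
    qed
    ultimately show ?thesis by blast
  qed
  then obtain k where k: "\<And>m. m \<le> k m" "\<And>m. A m \<le> ennreal (2 / h0) * \<Phi> (k m)" by metis
  have "filterlim k at_top sequentially"
    by (rule filterlim_at_top_mono[OF filterlim_ident]) (use k(1) in auto)
  from filterlim_compose[OF \<Phi> this] have "(\<lambda>m. ennreal (2 / h0) * \<Phi> (k m)) \<longlonglongrightarrow> ennreal (2 / h0) * 0"
    by (intro ennreal_tendsto_cmult) auto
  then have "ennreal e * 1 \<le> ennreal (2 / h0) * 0"
    by (rule LIMSEQ_le[OF glim]) (use low k(2) in \<open>blast intro: order_trans\<close>)
  then show False using e by simp
qed

lemma Psi_eventually:
  assumes "\<phi> \<in> Psi T" "0 < T"
  shows "\<forall>\<^sub>F h in at_right 0. 0 < h \<and> h < T \<and> 0 < \<phi> h \<and> \<phi> h \<le> T - h"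
    "((\<lambda>h. h / \<phi> h) \<longlongrightarrow> 0) (at_right 0)"
proof -
  have rv: "regularly_varying_at_zero T 1 \<phi>" and top: "filterlim (\<lambda>h. \<phi> h / h) at_top (at_right 0)"
    using assms by (auto simp: Psi_def)
  have "\<forall>\<^sub>F h in at_right 0. \<phi> h < T / 2"
    by (rule order_tendstoD(2)[OF regularly_varying_tendsto_0[OF rv assms(2)]]) (use assms(2) in simp)
  moreover have "\<forall>\<^sub>F h in at_right (0::real). 0 < h \<and> h < T / 2"
    unfolding eventually_at_right_field using assms(2) by (intro exI[of _ "T / 2"]) auto
  ultimately show "\<forall>\<^sub>F h in at_right 0. 0 < h \<and> h < T \<and> 0 < \<phi> h \<and> \<phi> h \<le> T - h"
    by eventually_elim (use rv in \<open>auto simp: regularly_varying_at_zero_def\<close>)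
  have "((\<lambda>h. inverse (\<phi> h / h)) \<longlongrightarrow> 0) (at_right 0)"
    by (rule tendsto_inverse_0_at_top[OF top])
  then show "((\<lambda>h. h / \<phi> h) \<longlongrightarrow> 0) (at_right 0)" by simp
qed

section \<open>Critical exponents\<close>

lemma powr_tendsto_0_at_right:
  "0 < p \<Longrightarrow> ((\<lambda>h::real. h powr p) \<longlongrightarrow> 0) (at_right 0)"
  by (rule tendsto_zero_powrI[where b=p])
     (auto intro!: tendsto_eq_intros simp: eventually_at_right_field intro: exI[of _ 1])

lemma powr_ge_1: "0 < h \<Longrightarrow> h < 1 \<Longrightarrow> p \<le> 0 \<Longrightarrow> 1 \<le> (h::real) powr p"
  using powr_mono'[of p 0 h] by simp

text \<open>
  If the ratios are squeezed between multiples of \<open>h\<^sup>g\<^sup>-\<^sup>H\<close>, then they tend to \<open>0\<close> exactly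
  for \<open>g > H\<close> and to \<open>\<infinity>\<close> exactly for \<open>g < H\<close>.
\<close>

lemma critical_exponent:
  fixes r :: "real \<Rightarrow> real \<Rightarrow> ereal"
  assumes H: "0 < H" and c: "0 < c"
    and bd: "\<And>g. \<forall>\<^sub>F h in at_right 0. ereal (c * h powr (g - H)) \<le> r g h \<and> r g h \<le> ereal (D * h powr (g - H))"
  shows "Inf {ereal g | g. 0 < g \<and> (r g \<longlongrightarrow> 0) (at_right 0)} = ereal H"
    and "Sup {ereal g | g. 0 < g \<and> (r g \<longlongrightarrow> \<infinity>) (at_right 0)} = ereal H"
proof -
  have small: "\<forall>\<^sub>F h in at_right (0::real). 0 < h \<and> h < 1"
    unfolding eventually_at_right_field by (intro exI[of _ 1]) auto
  have zero: "(r g \<longlongrightarrow> 0) (at_right 0) \<longleftrightarrow> H < g" for g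
  proof
    assume g: "H < g"
    have l: "((\<lambda>h. ereal (a * h powr (g - H))) \<longlongrightarrow> 0) (at_right 0)" for a
      using tendsto_mult_right_zero[OF powr_tendsto_0_at_right[of "g - H"], of a] g
      by (simp add: zero_ereal_def)
    show "(r g \<longlongrightarrow> 0) (at_right 0)"
      by (rule tendsto_sandwich[OF _ _ l[of c] l[of D]]) (use bd[of g] in \<open>auto elim: eventually_mono\<close>)
  next
    assume lim: "(r g \<longlongrightarrow> 0) (at_right 0)"
    show "H < g"
    proof (rule ccontr)
      assume g: "\<not> H < g"
      have "\<forall>\<^sub>F h in at_right 0. ereal c \<le> r g h"
        using bd[of g] small
      proof eventually_elim
        case (elim h)
        have "c * 1 \<le> c * h powr (g - H)" using g c elim by (intro mult_left_mono powr_ge_1) auto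
        then show ?case using elim by (metis ereal_less_eq(3) mult_1_right order_trans)
      qed
      then have "ereal c \<le> 0" using lim by (intro tendsto_lowerbound[OF lim]) auto
      then show False using c by simp
    qed
  qed
  have infty: "(r g \<longlongrightarrow> \<infinity>) (at_right 0) \<longleftrightarrow> g < H" for g
  proof
    assume g: "g < H"
    have "filterlim (\<lambda>h::real. h powr (g - H)) at_top (at_right 0)"
    proof -
      have "filterlim (\<lambda>h::real. inverse (h powr (H - g))) at_top (at_right 0)"
        using g by (intro filterlim_inverse_at_top powr_tendsto_0_at_right)
          (auto simp: eventually_at_right_field intro!: exI[of _ 1])
      moreover have "\<forall>\<^sub>F h in at_right (0::real). inverse (h powr (H - g)) = h powr (g - H)"
        by (intro always_eventually) (simp add: powr_minus[symmetric])
      ultimately show ?thesis using filterlim_cong by fast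
    qed
    then have "filterlim (\<lambda>h::real. c * h powr (g - H)) at_top (at_right 0)"
      using c by (intro filterlim_tendsto_pos_mult_at_top[OF tendsto_const])
    then have "((\<lambda>h. ereal (c * h powr (g - H))) \<longlongrightarrow> \<infinity>) (at_right 0)"
      by (simp add: tendsto_PInfty_eq_at_top)
    then have l: "\<forall>\<^sub>F h in at_right 0. ereal x < ereal (c * h powr (g - H))" for x
      unfolding tendsto_PInfty by blast
    show "(r g \<longlongrightarrow> \<infinity>) (at_right 0)"
      unfolding tendsto_PInfty
    proof
      fix x
      show "\<forall>\<^sub>F h in at_right 0. ereal x < r g h"
        using l[of x] bd[of g] by eventually_elim (blast intro: less_le_trans)
    qed
  next
    assume lim: "(r g \<longlongrightarrow> \<infinity>) (at_right 0)"
    show "g < H"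
    proof (rule ccontr)
      assume g: "\<not> g < H"
      have "\<forall>\<^sub>F h in at_right 0. r g h \<le> ereal \<bar>D\<bar>"
        using bd[of g] small
      proof eventually_elim
        case (elim h)
        have "h powr (g - H) \<le> 1" using g elim by (intro powr_le1) auto
        then have "D * h powr (g - H) \<le> \<bar>D\<bar> * 1" by (intro mult_mono) auto
        then show ?case using elim by (metis ereal_less_eq(3) mult_1_right order_trans)
      qed
      then have "\<infinity> \<le> ereal \<bar>D\<bar>" using lim by (intro tendsto_upperbound[OF lim]) auto
      then show False by simp
    qed
  qed
  show "Inf {ereal g | g. 0 < g \<and> (r g \<longlongrightarrow> 0) (at_right 0)} = ereal H"
    unfolding zero
  proof (rule antisym)
    show "ereal H \<le> Inf {ereal g |g. 0 < g \<and> H < g}" by (rule Inf_greatest) auto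
    show "Inf {ereal g |g. 0 < g \<and> H < g} \<le> ereal H"
    proof (rule ereal_le_epsilon2)
      fix e :: real assume "0 < e"
      then show "Inf {ereal g |g. 0 < g \<and> H < g} \<le> ereal H + ereal e"
        using H by (auto intro!: Inf_lower)
    qed
  qed
  show "Sup {ereal g | g. 0 < g \<and> (r g \<longlongrightarrow> \<infinity>) (at_right 0)} = ereal H"
    unfolding infty
  proof (rule antisym)
    show "Sup {ereal g |g. 0 < g \<and> g < H} \<le> ereal H" by (rule Sup_least) auto
    show "ereal H \<le> Sup {ereal g |g. 0 < g \<and> g < H}"
    proof (rule dense_le)
      fix x assume x: "x < ereal H"
      define y where "y = max (H / 2) (real_of_ereal x)"
      have "x \<le> ereal y" by (cases x) (use x in \<open>auto simp: y_def\<close>)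
      moreover have "0 < y" using H by (simp add: y_def)
      moreover have "y < H" by (cases x) (use x H in \<open>auto simp: y_def\<close>)
      ultimately show "x \<le> Sup {ereal g |g. 0 < g \<and> g < H}" by (intro Sup_upper2[of "ereal y"]) auto
    qed
  qed
qed

section \<open>Sub-fractional and fractional Brownian motion as fractional processes\<close>

lemma normal_law_mean:
  assumes "0 \<le> v"
  shows "has_bochner_integral (normal_law m v) (\<lambda>x. x) m"
proof (cases "v = 0")
  case True
  have "has_bochner_integral (return borel m) (\<lambda>_. m) m"
    using prob_space.prob_space[OF prob_space_return[of m borel]] prob_space_return[of m borel]
    by (auto simp: has_bochner_integral_iff prob_space_def intro: finite_measure.integrable_const)
  moreover have "AE x in return borel m. x = m" by (subst AE_return) auto
  ultimately have "has_bochner_integral (return borel m) (\<lambda>x. x) m"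
    by (subst has_bochner_integral_cong_AE[of _ _ "\<lambda>_. m"]) auto
  then show ?thesis using True by (simp add: normal_law_def)
next
  case False
  then have "0 < sqrt v" using assms by simp
  from normal_moment_nz_1[OF this, of m] show ?thesis using False
    by (auto simp: normal_law_def intro!: has_bochner_integral_density)
qed

definition process_span :: "real \<Rightarrow> (real \<Rightarrow> 'a \<Rightarrow> real) \<Rightarrow> ('a \<Rightarrow> real) set" where
  "process_span T X = {\<lambda>w. \<Sum>t\<in>I. c t * X t w | I c. finite I \<and> I \<subseteq> {0..T}}"

lemma process_in_span: "t \<in> {0..T} \<Longrightarrow> X t \<in> process_span T X"
  unfolding process_span_def by (intro CollectI exI[of _ "{t}"] exI[of _ "\<lambda>_. 1"]) auto

text \<open>
  A linear combination of the centred process is normal by definition, and its mean is the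
  combination of the means.
\<close>

lemma gaussian_space_of_process:
  assumes "prob_space M" and G: "centered_gaussian_process M T X"
  shows "gaussian_space M (process_span T X)"
proof -
  interpret prob_space M by fact
  have meas: "X t \<in> borel_measurable M" if "t \<in> {0..T}" for t
    using G that by (auto simp: centered_gaussian_process_def gaussian_process_def)
  have law: "\<exists>m v. 0 \<le> v \<and> distr M borel (\<lambda>w. \<Sum>t\<in>I. c t * X t w) = normal_law m v"
    if "finite I" "I \<subseteq> {0..T}" for I c
    using G that by (auto simp: centered_gaussian_process_def gaussian_process_def)
  have mean: "integrable M (\<lambda>w. \<Sum>t\<in>I. c t * X t w) \<and> expectation (\<lambda>w. \<Sum>t\<in>I. c t * X t w) = m"
    if "finite I" "I \<subseteq> {0..T}" "0 \<le> v" "distr M borel (\<lambda>w. \<Sum>t\<in>I. c t * X t w) = normal_law m v" for I c m v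
  proof -
    have [measurable]: "(\<lambda>w. \<Sum>t\<in>I. c t * X t w) \<in> borel_measurable M"
      using that(2) meas by (intro borel_measurable_sum borel_measurable_times) auto
    show ?thesis
      using normal_law_mean[OF that(3), of m] unfolding that(4)[symmetric]
      by (simp add: has_bochner_integral_iff integrable_distr_eq integral_distr)
  qed
  have X: "integrable M (X t)" "expectation (X t) = 0" if t: "t \<in> {0..T}" for t
  proof -
    obtain m v where "0 \<le> v" "distr M borel (\<lambda>w. \<Sum>s\<in>{t}. 1 * X s w) = normal_law m v"
      using law[of "{t}" "\<lambda>_. 1"] t by auto
    from mean[OF _ _ this] t show "integrable M (X t)" by simp
    show "expectation (X t) = 0" using G t by (auto simp: centered_gaussian_process_def)
  qed
  show ?thesis
  proof
    fix \<eta> assume "\<eta> \<in> process_span T X"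
    then obtain I c where I: "\<eta> = (\<lambda>w. \<Sum>t\<in>I. c t * X t w)" "finite I" "I \<subseteq> {0..T}"
      by (auto simp: process_span_def)
    show "\<eta> \<in> borel_measurable M"
      unfolding I(1) using I(3) meas by (intro borel_measurable_sum borel_measurable_times) auto
    obtain m v where mv: "0 \<le> v" "distr M borel \<eta> = normal_law m v" using law[OF I(2,3), of c] I(1) by auto
    have "expectation \<eta> = (\<Sum>t\<in>I. c t * expectation (X t))"
      unfolding I(1) using I X by (subst Bochner_Integration.integral_sum) auto
    also have "\<dots> = 0" using I X by (intro sum.neutral) auto
    finally have "m = 0" using mean[OF I(2,3) mv(1), of c m] mv(2) I(1) by simp
    then show "\<exists>v\<ge>0. distr M borel \<eta> = normal_law 0 v" using mv by auto
  next
    fix \<eta> \<zeta> :: "'a \<Rightarrow> real" and a b :: real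
    assume "\<eta> \<in> process_span T X" "\<zeta> \<in> process_span T X"
    then obtain I c J d where I: "\<eta> = (\<lambda>w. \<Sum>t\<in>I. c t * X t w)" "finite I" "I \<subseteq> {0..T}"
      and J: "\<zeta> = (\<lambda>w. \<Sum>t\<in>J. d t * X t w)" "finite J" "J \<subseteq> {0..T}"
      by (auto simp: process_span_def)
    define e where "e t = a * (if t \<in> I then c t else 0) + b * (if t \<in> J then d t else 0)" for t
    have "a * \<eta> w + b * \<zeta> w = (\<Sum>t\<in>I \<union> J. e t * X t w)" for w
    proof -
      have "\<eta> w = (\<Sum>t\<in>I \<union> J. (if t \<in> I then c t else 0) * X t w)"
        unfolding I(1) using I(2) J(2) by (intro sum.mono_neutral_cong_left) auto
      moreover have "\<zeta> w = (\<Sum>t\<in>I \<union> J. (if t \<in> J then d t else 0) * X t w)"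
        unfolding J(1) using I(2) J(2) by (intro sum.mono_neutral_cong_left) auto
      ultimately show ?thesis
        by (simp add: e_def sum_distrib_left sum.distrib[symmetric] distrib_right mult.assoc)
    qed
    then show "(\<lambda>w. a * \<eta> w + b * \<zeta> w) \<in> process_span T X"
      unfolding process_span_def using I J by (intro CollectI exI[of _ "I \<union> J"] exI[of _ e]) auto
  qed
qed

lemma fractional_process_subfbm:
  assumes "prob_space M" "0 < T" "0 < H" "H < 1" and S: "sub_fractional_brownian_motion M T H S"
  shows "fractional_process M (process_span T S) S T H 1 (\<lambda>s. s powr (2 * H))"
proof -
  have G: "centered_gaussian_process M T S" using S by (simp add: sub_fractional_brownian_motion_def)
  interpret gaussian_space M "process_span T S" by (rule gaussian_space_of_process[OF assms(1) G])
  show ?thesis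
  proof
    fix s t assume s: "s \<in> {0..T}" and t: "t \<in> {0..T}"
    have "covariance M (S s) (S t) = expectation (\<lambda>w. S s w * S t w)"
      by (simp add: covariance_def expectation_L[OF process_in_span[OF s]] expectation_L[OF process_in_span[OF t]])
    then show "expectation (\<lambda>w. S s w * S t w) =
       s powr (2 * H) + t powr (2 * H) - \<bar>s - t\<bar> powr (2 * H) / 2 - 1 / 2 * (s + t) powr (2 * H)"
      using S s t by (simp add: sub_fractional_brownian_motion_def subfbm_cov_def add_divide_distrib)
  qed (use assms process_in_span in auto)
qed

lemma fractional_process_fbm:
  assumes "prob_space M" "0 < T" "0 < H" "H < 1" and B: "fractional_brownian_motion M T H B"
  shows "fractional_process M (process_span T B) B T H 0 (\<lambda>s. s powr (2 * H) / 2)"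
proof -
  have G: "centered_gaussian_process M T B" using B by (simp add: fractional_brownian_motion_def)
  interpret gaussian_space M "process_span T B" by (rule gaussian_space_of_process[OF assms(1) G])
  show ?thesis
  proof
    fix s t assume s: "s \<in> {0..T}" and t: "t \<in> {0..T}"
    have "expectation (\<lambda>w. B s w * B t w) = 1 / 2 * (s powr (2 * H) + t powr (2 * H) - \<bar>s - t\<bar> powr (2 * H))"
      using B s t by (simp add: fractional_brownian_motion_def)
    then show "expectation (\<lambda>w. B s w * B t w) =
       s powr (2 * H) / 2 + t powr (2 * H) / 2 - \<bar>s - t\<bar> powr (2 * H) / 2 - 0 / 2 * (s + t) powr (2 * H)"
      by simp
  qed (use assms process_in_span in auto)
qed

lemma (in fractional_process) zero_mean: "zero_mean_process M T X"
proof -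
  have "X t \<in> borel_measurable M \<and> integrable M (\<lambda>w. (X t w)\<^sup>2) \<and> expectation (X t) = 0" if "t \<in> {0..T}" for t
    using measurable_L[OF X_L[OF that]] expectation_L[OF X_L[OF that]] L_all_moments[OF X_L[OF that]]
    by (auto simp: all_moments_def)
  then show ?thesis by (auto simp: zero_mean_process_def)
qed

section \<open>Orey index and condition (C2) of sub-fractional Brownian motion\<close>

locale subfbm = fractional_process M L X T H 1 "\<lambda>s. s powr (2 * H)" for M :: "'a measure" and L X T H
begin

text \<open>
  With \<open>s\<close>, \<open>s + h/2\<close>, \<open>s + h\<close> as nodes, the terms of the covariance other than \<open>h\<^sup>2\<^sup>H\<close> are
  a multiple of the second difference of \<open>x\<^sup>2\<^sup>H\<close> with step \<open>h/2\<close>.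
\<close>

lemma incr_variance:
  assumes "0 \<le> s" "0 < h" "s + h \<le> T"
  shows "expectation (\<lambda>w. (X (s + h) w - X s w)\<^sup>2)
     = h powr (2 * H) - 2 powr (2 * H) / 2 * forward_diff (h / 2) 2 (\<lambda>y. y powr (2 * H)) s"
proof -
  have s: "s \<in> {0..T}" and t: "s + h \<in> {0..T}" using assms by auto
  have i: "integrable M (\<lambda>w. x w * y w)" if "x \<in> L" "y \<in> L" for x y
    using that by (intro integrable_moments all_moments_mult L_all_moments)
  note [simp] = i[OF X_L[OF s] X_L[OF s]] i[OF X_L[OF s] X_L[OF t]] i[OF X_L[OF t] X_L[OF t]]
  have p: "(2 * x) powr (2 * H) = 2 powr (2 * H) * x powr (2 * H)" if "0 \<le> x" for x
    using that by (simp add: powr_mult)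
  have "expectation (\<lambda>w. (X (s + h) w - X s w)\<^sup>2) =
      expectation (\<lambda>w. X (s + h) w * X (s + h) w + X s w * X s w - 2 * (X s w * X (s + h) w))"
    by (simp add: power2_eq_square algebra_simps)
  also have "\<dots> = expectation (\<lambda>w. X (s + h) w * X (s + h) w) + expectation (\<lambda>w. X s w * X s w)
      - 2 * expectation (\<lambda>w. X s w * X (s + h) w)"
    by simp
  also have "\<dots> = h powr (2 * H) - 2 powr (2 * H) / 2 * (s powr (2 * H) + (s + h) powr (2 * H))
      + (2 * (s + h / 2)) powr (2 * H)"
    unfolding cov_X[OF s s] cov_X[OF t t] cov_X[OF s t]
    using assms p[of s] p[of "s + h"] by (simp add: algebra_simps)
  also have "(2 * (s + h / 2)) powr (2 * H) = 2 powr (2 * H) * (s + h / 2) powr (2 * H)"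
    using assms by (intro p) auto
  finally show ?thesis by (simp add: numeral_2_eq_2 algebra_simps)
qed

text \<open>
  The standard deviation of an increment relative to that of fractional Brownian motion.
\<close>

definition rel_sd :: "real \<Rightarrow> real \<Rightarrow> real" where
  "rel_sd s h = incr_sd M X s (s + h) / h powr H"

lemma incr_sd_eq: "0 < h \<Longrightarrow> incr_sd M X s (s + h) = h powr H * rel_sd s h"
  by (simp add: rel_sd_def)

lemma rel_sd_nonneg: "0 \<le> rel_sd s h"
  by (simp add: rel_sd_def incr_sd_def)

lemma rel_sd_square:
  assumes "0 < h"
  shows "(rel_sd s h)\<^sup>2 = expectation (\<lambda>w. (X (s + h) w - X s w)\<^sup>2) / h powr (2 * H)"
proof -
  have "(h powr H)\<^sup>2 = h powr (2 * H)" by (simp add: power2_eq_square powr_add[symmetric])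
  then show ?thesis by (simp add: rel_sd_def incr_sd_def power_divide)
qed

lemma rel_sd_zero:
  assumes "0 < h" "h \<le> T" shows "rel_sd 0 h = sqrt (2 - 2 powr (2 * H) / 2)"
proof -
  have f: "forward_diff (h / 2) 2 (\<lambda>y. y powr (2 * H)) 0 = h powr (2 * H) - 2 * (h / 2) powr (2 * H)"
    using H_pos by (simp add: numeral_2_eq_2)
  have "expectation (\<lambda>w. (X (0 + h) w - X 0 w)\<^sup>2)
      = h powr (2 * H) * (1 - 2 powr (2 * H) / 2) + 2 powr (2 * H) * (h / 2) powr (2 * H)"
    using incr_variance[of 0 h] assms unfolding f by (simp add: algebra_simps)
  moreover have "2 powr (2 * H) * (h / 2) powr (2 * H) = h powr (2 * H)"
    using assms by (simp add: powr_mult[symmetric])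
  ultimately have "expectation (\<lambda>w. (X (0 + h) w - X 0 w)\<^sup>2) = h powr (2 * H) * (2 - 2 powr (2 * H) / 2)"
    by (simp add: algebra_simps)
  then have "(rel_sd 0 h)\<^sup>2 = 2 - 2 powr (2 * H) / 2"
    unfolding rel_sd_square[OF assms(1)] using assms by simp
  then show ?thesis using rel_sd_nonneg[of 0 h] by (metis real_sqrt_unique)
qed

text \<open>
  The second derivative of \<open>x\<^sup>2\<^sup>H\<close> is in absolute value at most \<open>2 s\<^sup>2\<^sup>H\<^sup>-\<^sup>2\<close> on \<open>x \<ge> s\<close>.
  Passing from the variance to its square root does not increase the distance to \<open>1\<close>.
\<close>

lemma rel_sd_close:
  assumes "0 < s" "0 < h" "s + h \<le> T"
  shows "\<bar>rel_sd s h - 1\<bar> \<le> (h / s) powr (2 - 2 * H)"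
proof -
  define a where "a = 2 * H"
  have a: "0 < a" "a < 2" using H_pos H_less by (auto simp: a_def)
  obtain z where z: "z \<ge> s" "forward_diff (h / 2) 2 (\<lambda>y. y powr a) s = (h / 2)\<^sup>2 * ((\<Prod>i<2. a - real i) * z powr (a - 2))"
    using forward_diff_powr_mean_value[of s "h / 2" 2 a] assms by auto
  have p2: "(\<Prod>i<2. a - real i) = a * (a - 1)" by (simp add: numeral_2_eq_2)
  have "\<bar>a\<bar> * \<bar>a - 1\<bar> \<le> 2 * 1" using a by (intro mult_mono) auto
  moreover have "z powr (a - 2) \<le> s powr (a - 2)" using z assms a by (intro powr_mono2') auto
  ultimately have "\<bar>forward_diff (h / 2) 2 (\<lambda>y. y powr a) s\<bar> \<le> (h / 2)\<^sup>2 * (2 * s powr (a - 2))"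
    unfolding z(2) p2 abs_mult by (auto intro!: mult_mono simp: abs_mult[symmetric])
  moreover have "(2::real) powr a / 2 \<le> 2"
    using powr_mono[of a 2 2] a by simp
  ultimately have "\<bar>2 powr a / 2 * forward_diff (h / 2) 2 (\<lambda>y. y powr a) s\<bar> \<le> 2 * ((h / 2)\<^sup>2 * (2 * s powr (a - 2)))"
    unfolding abs_mult by (intro mult_mono) auto
  also have "\<dots> = h\<^sup>2 * s powr (a - 2)" by (simp add: power2_eq_square)
  finally have bd: "\<bar>2 powr a / 2 * forward_diff (h / 2) 2 (\<lambda>y. y powr a) s\<bar> \<le> h\<^sup>2 * s powr (a - 2)" .
  have "\<bar>(rel_sd s h)\<^sup>2 - 1\<bar> = \<bar>2 powr a / 2 * forward_diff (h / 2) 2 (\<lambda>y. y powr a) s\<bar> / h powr a"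
  proof -
    have "(rel_sd s h)\<^sup>2 - 1 = - (2 powr a / 2 * forward_diff (h / 2) 2 (\<lambda>y. y powr a) s) / h powr a"
      unfolding rel_sd_square[OF assms(2)] using incr_variance[of s h] assms
      by (simp add: a_def diff_divide_distrib)
    then show ?thesis using assms by (simp only: abs_divide abs_minus_cancel) simp
  qed
  also have "\<dots> \<le> h\<^sup>2 * s powr (a - 2) / h powr a" by (intro divide_right_mono bd) auto
  also have "\<dots> = (h / s) powr (2 - a)"
    using assms by (simp add: powr_diff powr_divide powr_numeral field_simps)
  finally have 1: "\<bar>(rel_sd s h)\<^sup>2 - 1\<bar> \<le> (h / s) powr (2 - a)" .
  have "\<bar>rel_sd s h - 1\<bar> * 1 \<le> \<bar>rel_sd s h - 1\<bar> * (rel_sd s h + 1)"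
    using rel_sd_nonneg[of s h] by (intro mult_left_mono) auto
  also have "\<dots> = \<bar>(rel_sd s h)\<^sup>2 - 1\<bar>"
  proof -
    have "(rel_sd s h)\<^sup>2 - 1 = (rel_sd s h - 1) * (rel_sd s h + 1)"
      by (simp add: power2_eq_square algebra_simps)
    then show ?thesis using rel_sd_nonneg[of s h] by (simp add: abs_mult)
  qed
  finally show ?thesis using 1 by (simp add: a_def)
qed

text \<open>
  Close to the origin, for \<open>s < h\<close>, the bound \<open>10 h\<^sup>2\<^sup>H\<close> for the variance comes from
  \<open>2s + h \<le> 3h\<close>; elsewhere the relative error is at most \<open>1\<close>.
\<close>

lemma rel_sd_bounded:
  assumes "0 \<le> s" "0 < h" "s + h \<le> T" shows "rel_sd s h \<le> 4"
proof (cases "h \<le> s")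
  case True
  then have "(h / s) powr (2 - 2 * H) \<le> 1" using assms H_less by (intro powr_le1) auto
  then show ?thesis using rel_sd_close[of s h] assms True by auto
next
  case False
  have "2 powr (2 * H) / 2 * forward_diff (h / 2) 2 (\<lambda>y. y powr (2 * H)) s
     = 2 powr (2 * H) / 2 * ((s + h) powr (2 * H) + s powr (2 * H)) - (2 * (s + h / 2)) powr (2 * H)"
  proof -
    have f: "forward_diff (h / 2) 2 (\<lambda>y. y powr (2 * H)) s
        = (s + h) powr (2 * H) - 2 * (s + h / 2) powr (2 * H) + s powr (2 * H)"
      by (simp add: numeral_2_eq_2 add.commute[of h s])
    have p: "(2 * (s + h / 2)) powr (2 * H) = 2 powr (2 * H) * (s + h / 2) powr (2 * H)"
      by (rule powr_mult)
    show ?thesis unfolding f p by (simp add: algebra_simps)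
  qed
  moreover have "0 \<le> 2 powr (2 * H) / 2 * ((s + h) powr (2 * H) + s powr (2 * H))" by auto
  ultimately have "expectation (\<lambda>w. (X (s + h) w - X s w)\<^sup>2) \<le> h powr (2 * H) + (2 * (s + h / 2)) powr (2 * H)"
    using incr_variance[OF assms] by linarith
  also have "(2 * (s + h / 2)) powr (2 * H) \<le> (3 * h) powr (2 * H)"
    using assms False H_pos by (intro powr_mono2) auto
  also have "\<dots> = 3 powr (2 * H) * h powr (2 * H)" using assms by (simp add: powr_mult)
  also have "3 powr (2 * H) * h powr (2 * H) \<le> 9 * h powr (2 * H)"
    using powr_mono[of "2 * H" 2 "3::real"] H_less by (intro mult_right_mono) auto
  finally have "expectation (\<lambda>w. (X (s + h) w - X s w)\<^sup>2) \<le> 10 * h powr (2 * H)" by simp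
  then have "(rel_sd s h)\<^sup>2 \<le> 10" unfolding rel_sd_square[OF assms(2)] using assms by (simp add: pos_divide_le_eq)
  also have "\<dots> \<le> 4\<^sup>2" by simp
  finally show ?thesis by (rule power2_le_imp_le) simp
qed

lemma condition_C2: "condition_C2 M T X 1 H"
  unfolding condition_C2_def
proof
  fix \<phi> assume \<phi>: "\<phi> \<in> Psi T"
  note ev = Psi_eventually[OF \<phi> T_pos]
  have up: "((\<lambda>\<delta>. ereal ((\<delta> / \<phi> \<delta>) powr (2 - 2 * H))) \<longlongrightarrow> 0) (at_right 0)"
  proof -
    have "((\<lambda>\<delta>. (\<delta> / \<phi> \<delta>) powr (2 - 2 * H)) \<longlongrightarrow> 0) (at_right 0)"
      by (rule tendsto_zero_powrI[OF ev(2) tendsto_const]) (use ev(1) H_less in \<open>auto elim: eventually_mono\<close>)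
    then show ?thesis by (simp add: zero_ereal_def)
  qed
  show "((\<lambda>\<delta>. SUP t\<in>{\<phi> \<delta>..T - \<delta>}. SUP h\<in>{0<..\<delta>}. ereal \<bar>incr_sd M X t (t + h) / (1 * h powr H) - 1\<bar>) \<longlongrightarrow> 0) (at_right 0)"
  proof (rule tendsto_sandwich[OF _ _ tendsto_const up])
    show "\<forall>\<^sub>F \<delta> in at_right 0. 0 \<le> (SUP t\<in>{\<phi> \<delta>..T - \<delta>}. SUP h\<in>{0<..\<delta>}. ereal \<bar>incr_sd M X t (t + h) / (1 * h powr H) - 1\<bar>)"
      using ev(1)
    proof eventually_elim
      case (elim \<delta>)
      then show ?case by (intro SUP_upper2[of "\<phi> \<delta>"] SUP_upper2[of \<delta>]) auto
    qed
    show "\<forall>\<^sub>F \<delta> in at_right 0. (SUP t\<in>{\<phi> \<delta>..T - \<delta>}. SUP h\<in>{0<..\<delta>}. ereal \<bar>incr_sd M X t (t + h) / (1 * h powr H) - 1\<bar>)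
       \<le> ereal ((\<delta> / \<phi> \<delta>) powr (2 - 2 * H))"
      using ev(1)
    proof eventually_elim
      case (elim \<delta>)
      show ?case
      proof (intro SUP_least)
        fix t h assume t: "t \<in> {\<phi> \<delta>..T - \<delta>}" and h: "h \<in> {0<..\<delta>}"
        have "\<bar>rel_sd t h - 1\<bar> \<le> (h / t) powr (2 - 2 * H)" using t h elim by (intro rel_sd_close) auto
        also have "\<dots> \<le> (\<delta> / \<phi> \<delta>) powr (2 - 2 * H)"
          using t h elim H_less by (intro powr_mono2 frac_le) auto
        finally show "ereal \<bar>incr_sd M X t (t + h) / (1 * h powr H) - 1\<bar> \<le> ereal ((\<delta> / \<phi> \<delta>) powr (2 - 2 * H))"
          by (simp add: rel_sd_def)
      qed
    qed
  qed
qed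

lemma orey_ratio_eq:
  assumes "0 < h" "0 < rel_sd s h"
  shows "orey_ratio M X g s h = ereal (h powr (g - H) / rel_sd s h)"
proof -
  have "incr_sd M X s (s + h) = h powr H * rel_sd s h" using assms by (simp add: incr_sd_eq)
  moreover have "h powr g = h powr (g - H) * h powr H" using assms by (simp add: powr_add[symmetric])
  ultimately show ?thesis using assms by (simp add: orey_ratio_def field_simps)
qed

lemma orey_ratio_bounds:
  assumes "\<phi> \<in> Psi T"
  shows "\<forall>\<^sub>F h in at_right 0. 0 < h \<and> \<phi> h \<le> T - h \<and>
     (\<forall>s\<in>{\<phi> h..T - h}. ereal (1 / 2 * h powr (g - H)) \<le> orey_ratio M X g s h \<and>
        orey_ratio M X g s h \<le> ereal (2 * h powr (g - H)))"
proof -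
  note ev = Psi_eventually[OF assms T_pos]
  have "((\<lambda>h. (h / \<phi> h) powr (2 - 2 * H)) \<longlongrightarrow> 0) (at_right 0)"
    by (rule tendsto_zero_powrI[OF ev(2) tendsto_const]) (use ev(1) H_less in \<open>auto elim: eventually_mono\<close>)
  then have "\<forall>\<^sub>F h in at_right 0. (h / \<phi> h) powr (2 - 2 * H) < 1 / 2" by (rule order_tendstoD(2)) simp
  then show ?thesis using ev(1)
  proof eventually_elim
    case (elim h)
    have "ereal (1 / 2 * h powr (g - H)) \<le> orey_ratio M X g s h \<and> orey_ratio M X g s h \<le> ereal (2 * h powr (g - H))"
      if s: "s \<in> {\<phi> h..T - h}" for s
    proof -
      have "\<bar>rel_sd s h - 1\<bar> \<le> (h / s) powr (2 - 2 * H)" using s elim by (intro rel_sd_close) auto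
      also have "\<dots> \<le> (h / \<phi> h) powr (2 - 2 * H)" using s elim H_less by (intro powr_mono2 frac_le) auto
      finally have r: "1 / 2 \<le> rel_sd s h" "rel_sd s h \<le> 2" using elim by linarith+
      have p: "0 < h powr (g - H)" using elim by simp
      have "1 / 2 * h powr (g - H) \<le> h powr (g - H) / rel_sd s h"
        using r p by (simp add: field_simps)
      moreover have "h powr (g - H) / rel_sd s h \<le> 2 * h powr (g - H)"
        using r p by (simp add: field_simps)
      moreover have "0 < rel_sd s h" using r by linarith
      ultimately show ?thesis using elim by (subst (1 2) orey_ratio_eq) auto
    qed
    then show ?case using elim by auto
  qed
qed

lemma orey_exponents:
  assumes "\<phi> \<in> Psi T"
  shows "orey_lower M T X \<phi> = ereal H" "orey_upper M T X \<phi> = ereal H"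
proof -
  have b: "\<forall>\<^sub>F h in at_right 0. ereal (1 / 2 * h powr (g - H)) \<le> (SUP s\<in>{\<phi> h..T - h}. orey_ratio M X g s h)
     \<and> (SUP s\<in>{\<phi> h..T - h}. orey_ratio M X g s h) \<le> ereal (2 * h powr (g - H))" for g
    using orey_ratio_bounds[OF assms, of g]
    by eventually_elim (auto intro!: SUP_least intro: SUP_upper2)
  show "orey_lower M T X \<phi> = ereal H"
    unfolding orey_lower_def by (rule critical_exponent(1)[OF H_pos _ b]) simp
  have b': "\<forall>\<^sub>F h in at_right 0. ereal (1 / 2 * h powr (g - H)) \<le> (INF s\<in>{\<phi> h..T - h}. orey_ratio M X g s h)
     \<and> (INF s\<in>{\<phi> h..T - h}. orey_ratio M X g s h) \<le> ereal (2 * h powr (g - H))" for g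
    using orey_ratio_bounds[OF assms, of g]
    by eventually_elim (auto intro!: INF_greatest intro: INF_lower2)
  show "orey_upper M T X \<phi> = ereal H"
    unfolding orey_upper_def by (rule critical_exponent(2)[OF H_pos _ b']) simp
qed

lemma orey_exponents_zero: "orey_lower_zero M X = ereal H" "orey_upper_zero M X = ereal H"
proof -
  define \<theta> where "\<theta> = sqrt (2 - 2 powr (2 * H) / 2)"
  have \<theta>: "0 < \<theta>" using norm_const_pos by (simp add: \<theta>_def norm_const_def)
  have "\<forall>\<^sub>F h in at_right 0. 0 < h \<and> h \<le> T"
    unfolding eventually_at_right_field using T_pos by (intro exI[of _ T]) auto
  then have b: "\<forall>\<^sub>F h in at_right 0. ereal (1 / \<theta> * h powr (g - H)) \<le> orey_ratio M X g 0 h \<and>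
     orey_ratio M X g 0 h \<le> ereal (1 / \<theta> * h powr (g - H))" for g
  proof eventually_elim
    case (elim h)
    have r: "rel_sd 0 h = \<theta>" using elim by (simp add: \<theta>_def rel_sd_zero)
    have "orey_ratio M X g 0 h = ereal (h powr (g - H) / \<theta>)"
      using orey_ratio_eq[of h 0 g] elim \<theta> unfolding r by simp
    then show ?case by simp
  qed
  have c: "0 < 1 / \<theta>" using \<theta> by simp
  show "orey_lower_zero M X = ereal H" "orey_upper_zero M X = ereal H"
    unfolding orey_lower_zero_def orey_upper_zero_def
    using critical_exponent[OF H_pos c b] by auto
qed

lemma has_orey_index: "has_orey_index M T X H"
proof -
  have "((\<lambda>h. SUP s\<in>{0..T - h}. ereal (incr_sd M X s (s + h))) \<longlongrightarrow> 0) (at_right 0)"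
  proof (rule tendsto_sandwich[OF _ _ tendsto_const])
    have ev: "\<forall>\<^sub>F h in at_right 0. 0 < h \<and> h \<le> T"
      unfolding eventually_at_right_field using T_pos by (intro exI[of _ T]) auto
    show "\<forall>\<^sub>F h in at_right 0. 0 \<le> (SUP s\<in>{0..T - h}. ereal (incr_sd M X s (s + h)))"
      using ev by eventually_elim (auto intro!: SUP_upper2[of 0] simp: incr_sd_def)
    show "\<forall>\<^sub>F h in at_right 0. (SUP s\<in>{0..T - h}. ereal (incr_sd M X s (s + h))) \<le> ereal (4 * h powr H)"
      using ev
    proof eventually_elim
      case (elim h)
      show ?case
      proof (intro SUP_least)
        fix s assume s: "s \<in> {0..T - h}"
        have "h powr H * rel_sd s h \<le> h powr H * 4"
          using s elim by (intro mult_left_mono rel_sd_bounded) auto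
        then show "ereal (incr_sd M X s (s + h)) \<le> ereal (4 * h powr H)"
          using elim by (simp add: incr_sd_eq mult.commute)
      qed
    qed
    show "((\<lambda>h. ereal (4 * h powr H)) \<longlongrightarrow> 0) (at_right 0)"
      using tendsto_mult_right_zero[OF powr_tendsto_0_at_right[OF H_pos], of 4] by (simp add: zero_ereal_def)
  qed
  then show ?thesis
    unfolding has_orey_index_def using zero_mean orey_exponents orey_exponents_zero by simp
qed

end

section \<open>Asymptotics for sub-fractional Brownian motion\<close>

theorem proposition10:
  fixes M :: "'a measure" and S :: "real \<Rightarrow> 'a \<Rightarrow> real" and T H :: real
  assumes "prob_space M" and "0 < T" and "0 < H" and "H < 1"
    and "sub_fractional_brownian_motion M T H S"
  shows "has_orey_index M T S H \<and>
    condition_C2 M T S 1 H \<and>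
    (\<exists>C. \<forall>n\<ge>1. \<forall>i\<in>{1, 2}. max_column_sum M T H (i * n) S \<le> C) \<and>
    (\<forall>(P :: 'b measure) B. prob_space P \<and> fractional_brownian_motion P T H B \<longrightarrow>
      (\<forall>i\<in>{1, 2}. \<forall>j\<in>{1, 2}.
        (\<lambda>n. 1 / real n *
           (covariance M (\<lambda>\<omega>. quad_var2 T H (i * n) S \<omega> / real i)
                         (\<lambda>\<omega>. quad_var2 T H (j * n) S \<omega> / real j)
          - covariance P (\<lambda>\<omega>. quad_var2 T H (i * n) B \<omega> / real i)
                         (\<lambda>\<omega>. quad_var2 T H (j * n) B \<omega> / real j))) \<longlonglongrightarrow> 0)) \<and>
    (\<forall>i\<in>{1, 2}.
      (\<lambda>n. sqrt (real n) *
         ((\<integral>\<omega>. quad_var2 T H (i * n) S \<omega> \<partial>M) / real (i * n) - 1)) \<longlonglongrightarrow> 0) \<and>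
    (AE \<omega> in M. (\<lambda>n. gamma_hat T S n \<omega>) \<longlonglongrightarrow> H) \<and>
    weak_conv_m
      (\<lambda>n. distr M borel (\<lambda>\<omega>. 2 * ln 2 * sqrt (real n) * (gamma_hat T S n \<omega> - H)))
      (normal_law 0 (sigma_sq H))"
proof -
  interpret S: fractional_process M "process_span T S" S T H 1 "\<lambda>s. s powr (2 * H)"
    by (rule fractional_process_subfbm[OF assms])
  interpret S: subfbm M "process_span T S" S T H ..
  have "(\<lambda>n. 1 / real n *
           (covariance M (\<lambda>\<omega>. quad_var2 T H (i * n) S \<omega> / real i)
                         (\<lambda>\<omega>. quad_var2 T H (j * n) S \<omega> / real j)
          - covariance P (\<lambda>\<omega>. quad_var2 T H (i * n) B \<omega> / real i)
                         (\<lambda>\<omega>. quad_var2 T H (j * n) B \<omega> / real j))) \<longlonglongrightarrow> 0"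
    if P: "prob_space P" "fractional_brownian_motion P T H B" and ij: "i \<in> {1, 2}" "j \<in> {1, 2}"
    for P :: "'b measure" and B and i j :: nat
  proof -
    interpret B: fractional_process P "process_span T B" B T H 0 "\<lambda>s. s powr (2 * H) / 2"
      by (rule fractional_process_fbm[OF P(1) assms(2,3,4) P(2)])
    have "B.cov_limit i j = S.cov_limit i j"
      by (simp add: B.cov_limit_def S.cov_limit_def B.same_limit_def S.same_limit_def B.cross_limit_def S.cross_limit_def
          B.same_corr_def S.same_corr_def B.cross_corr_def S.cross_corr_def B.norm_const_def S.norm_const_def)
    then show ?thesis
      using tendsto_diff[OF S.covariance_limit[OF ij] B.covariance_limit[OF ij]]
      by (simp add: right_diff_distrib)
  qed
  moreover have "\<exists>C. \<forall>n\<ge>1. \<forall>i\<in>{1, 2}. max_column_sum M T H (i * n) S \<le> C"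
    using S.max_column_sum_bounded by blast
  moreover have "(\<lambda>n. sqrt (real n) * (S.expectation (quad_var2 T H (i * n) S) / real (i * n) - 1)) \<longlonglongrightarrow> 0"
    if "i \<in> {1, 2}" for i
    using that by (intro S.expectation_quad_var2_limit) auto
  ultimately show ?thesis
    using S.has_orey_index S.condition_C2 S.AE_gamma_hat S.gamma_hat_clt
    by (intro conjI allI impI ballI) blast+
qed

end
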